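(* Let $P\subset\mathbb{R}^d$ be a convex $d$-polytope and let $p\in\mathbb{R}^d$ be a generic sweep direction. The recursive construction of $\mathcal{B}(P)$ described in the context is well defined (the mergings in Steps 3 and 4 do not conflict), and $\mathcal{B}(P)$ is a partition of the set of nonempty faces of the complete truncation $T(P)$.
   Context: Complete truncation (for $d\ge1$): for $i=0,\dots,d-1$ in turn, each $i$-face $F$ of $P$ is cut off by translating a supporting hyperplane meeting $P$ exactly in $F$ a depth $\epsilon^{i+1}$ into the polytope ($\epsilon>0$ sufficiently small); the new facet gets label $i$. $T(P)$ is the result; for $d=0$, $T(P)=P$. For a nonempty face $G$ of $T(P)$, $\sigma(G)$ is the set of labels of the facets of $T(P)$ containing $G$ ($\sigma(T(P))=\emptyset$). The vector $p$ is chosen so that $p\cdot x$ is distinct on all vertices arising at all stages of the truncation, also for all lower-dimensional polytopes to which the construction is applied recursively (these lie in affine subspaces and are swept by the same linear function $p\cdot x$). For $G$ of positive dimension, with $j=\min\{i:i\notin\sigma(G)\}$: the top face $\tau(G)$ (resp. bottom face $\beta(G)$) is the unique face of $G$ of dimension $\dim G-1$ with label set $\sigma(G)\cup\{j\}$ containing the vertex of $G$ maximizing (resp. minimizing) $p\cdot x$. For a vertex $v$ of $P$: $Q_v$ is the $(d-1)$-polytope created by truncating $v$; $T(Q_v)$ is the label-$0$ facet of $T(P)$ arising from $v$, the complete truncation of $Q_v$ induced by $T(P)$. $H_v=\{p\cdot x=p\cdot v\}$, $H_v^{\pm}=\{\pm(p\cdot x-p\cdot v)>0\}$. Faces of $T(Q_v)$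 are upper/middle/lower if they lie in $H_v^+$/meet $H_v$/lie in $H_v^-$. $R_v=Q_v\cap H_v$ (empty iff $v$ minimizes or maximizes $p\cdot x$ on $P$, otherwise of dimension $d-2$), and $T(R_v)=T(Q_v)\cap H_v$ is its induced complete truncation; its faces are exactly the intersections of $H_v$ with the middle faces of $T(Q_v)$. Construction of $\mathcal{B}(P)=\bigcup_{v}\mathcal{B}_v(P)$ (recursive on dimension; $\mathcal{B}_v(P)$ is a possibly empty collection of blocks attached to vertex $v$): Step 0: if $d=0$, $T(P)$ is a single vertex $v$ and $\mathcal{B}_v(P)=\{\{v\}\}$. Step 1: for every face $G$ of $T(P)$ with $0\notin\sigma(G)$ form the pre-block $\{G,\tau(G),\beta(G)\}$. Step 2: for each vertex $v$ and each middle face $G$ of $T(Q_v)$, insert $G$ into the pre-block containing $\tau(G)$ (an upper face of $T(Q_v)$). Step 3: for each vertex $v$ and each block $B$ of the recursively defined partition $\mathcal{B}(R_v)$ of the nonempty faces of $T(R_v)$ (none if $R_v=\emptyset$), merge the pre-blocks containing the middle faces of $T(Q_v)$ corresponding to the faces of $B$ into one block, placed into $\mathcal{B}_v(P)$. Step 4: for each vertex $v$, consider the recursively defined partition $\mathcal{B}(Q_v)$ of the nonempty faces of $T(Q_v)$; for each vertex $w$ of $Q_v$ in $H_v^+$ and each block $B\in\mathcal{B}_w(Q_v)$ (whose faces are upper faces of $T(Q_v)$), merge the pre-blocks containing the faces of $B$ into one block, placed into $\mathcal{B}_v(P)$.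
   Formalization: Since p·x is constant on R_v, p cannot be generic there when d ≥ 3; so P and the Q_v are swept by p, while each passage to a section R_v uses the next vector of a sequence p = p_0, p_1, …, each generic on the polytopes it sweeps; ε is small depending on these vectors. *)

theory Defs
  imports "HOL-Analysis.Analysis" "HOL-Library.Disjoint_Sets"
begin

definition vertices :: "'a::real_vector set \<Rightarrow> 'a set" where
  "vertices X = {v. v extreme_point_of X}"

definition faces :: "'a::real_vector set \<Rightarrow> 'a set set" where
  "faces X = {G. G face_of X \<and> G \<noteq> {}}"

definition proper_faces :: "'a::real_vector set \<Rightarrow> 'a set set" where
  "proper_faces X = faces X - {X}"

text \<open>
  For every nonempty proper face \<open>F\<close> of \<open>P\<close>, the hyperplane \<open>a F \<bullet> x = b F\<close> supports \<open>P\<close>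
  exactly in \<open>F\<close>. The outer normal \<open>a F\<close> is a unit vector parallel to the affine hull of \<open>P\<close>,
  so that lowering the offset by \<open>t\<close> moves the hyperplane to depth \<open>t\<close>, measured in that hull.
  If \<open>P\<close> is full-dimensional, being parallel to the hull is no restriction.
\<close>

definition supporting_hyperplanes ::
    "'a::euclidean_space set \<Rightarrow> ('a set \<Rightarrow> 'a) \<Rightarrow> ('a set \<Rightarrow> real) \<Rightarrow> bool" where
  "supporting_hyperplanes P a b \<longleftrightarrow>
     (\<forall>F\<in>proper_faces P.
        norm (a F) = 1 \<and> (\<forall>x\<in>P. x + a F \<in> affine hull P) \<and>
        P \<subseteq> {x. a F \<bullet> x \<le> b F} \<and> F = P \<inter> {x. a F \<bullet> x = b F})"

text \<open>
  All polytopes met in the recursion are sections of \<open>P\<close>, obtained by intersecting with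
  truncating hyperplanes (the \<open>Q\<close>-steps) and with sweep hyperplanes (the \<open>R\<close>-steps). They are
  represented by the plain set \<open>X\<close>; the induced complete truncation is \<open>X \<inter> T(P)\<close>, and a face
  \<open>E\<close> of \<open>X\<close> is cut off by the hyperplane belonging to the smallest face of \<open>P\<close> containing it.

  The linear function \<open>p 0 \<bullet> x\<close> sweeps \<open>P\<close> and every \<open>Q\<^sub>v\<close>. As it is constant on
  \<open>R\<^sub>v = Q\<^sub>v \<inter> H\<^sub>v\<close>, it cannot sweep \<open>R\<^sub>v\<close>: a polytope reached through \<open>r\<close> steps of
  the second kind is swept by \<open>p r \<bullet> x\<close>.
\<close>

locale swept_truncation =
  fixes P :: "'a::euclidean_space set"
    and a :: "'a set \<Rightarrow> 'a" and b :: "'a set \<Rightarrow> real"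
    and \<epsilon> :: real
    and p :: "nat \<Rightarrow> 'a"
begin

definition carrier_face :: "'a set \<Rightarrow> 'a set" where
  "carrier_face E = \<Inter>{F. F face_of P \<and> E \<subseteq> F}"

definition cut_offset :: "'a set \<Rightarrow> real" where
  "cut_offset F = b F - \<epsilon> ^ (nat (aff_dim F) + 1)"

definition cut_halfspace :: "'a set \<Rightarrow> 'a set" where
  "cut_halfspace E = {x. a (carrier_face E) \<bullet> x \<le> cut_offset (carrier_face E)}"

definition cut_hyperplane :: "'a set \<Rightarrow> 'a set" where
  "cut_hyperplane E = {x. a (carrier_face E) \<bullet> x = cut_offset (carrier_face E)}"

text \<open>The polytope obtained from \<open>X\<close> by cutting off its faces of dimension less than \<open>k\<close>.\<close>

definition stage :: "nat \<Rightarrow> 'a set \<Rightarrow> 'a set" where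
  "stage k X = X \<inter> (\<Inter>E\<in>{E \<in> proper_faces X. aff_dim E < int k}. cut_halfspace E)"

definition T :: "'a set \<Rightarrow> 'a set" where
  "T X = X \<inter> stage (nat (aff_dim P)) P"

definition has_label :: "'a set \<Rightarrow> 'a set \<Rightarrow> nat \<Rightarrow> bool" where
  "has_label X D i \<longleftrightarrow> D facet_of T X \<and>
     (\<exists>E\<in>proper_faces X. aff_dim E = int i \<and> D = T X \<inter> cut_hyperplane E)"

definition \<sigma> :: "'a set \<Rightarrow> 'a set \<Rightarrow> nat set" where
  "\<sigma> X G = {i. \<exists>D. has_label X D i \<and> G \<subseteq> D}"

definition is_end_face :: "'a \<Rightarrow> 'a set \<Rightarrow> 'a set \<Rightarrow> 'a set \<Rightarrow> bool" where
  "is_end_face q X G U \<longleftrightarrow>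
     U face_of G \<and> aff_dim U = aff_dim G - 1 \<and>
     \<sigma> X U = insert (LEAST i. i \<notin> \<sigma> X G) (\<sigma> X G) \<and>
     (\<exists>u\<in>vertices G. (\<forall>w\<in>vertices G. q \<bullet> w \<le> q \<bullet> u) \<and> u \<in> U)"

definition is_top :: "nat \<Rightarrow> 'a set \<Rightarrow> 'a set \<Rightarrow> 'a set \<Rightarrow> bool" where
  "is_top r = is_end_face (p r)"

definition is_bottom :: "nat \<Rightarrow> 'a set \<Rightarrow> 'a set \<Rightarrow> 'a set \<Rightarrow> bool" where
  "is_bottom r = is_end_face (- p r)"

definition \<tau> :: "nat \<Rightarrow> 'a set \<Rightarrow> 'a set \<Rightarrow> 'a set" where
  "\<tau> r X G = (THE U. is_top r X G U)"

definition \<beta> :: "nat \<Rightarrow> 'a set \<Rightarrow> 'a set \<Rightarrow> 'a set" where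
  "\<beta> r X G = (THE U. is_bottom r X G U)"

definition Q :: "'a set \<Rightarrow> 'a \<Rightarrow> 'a set" where
  "Q X v = X \<inter> cut_hyperplane {v}"

definition H :: "nat \<Rightarrow> 'a \<Rightarrow> 'a set" where
  "H r v = {x. p r \<bullet> x = p r \<bullet> v}"

definition Hplus :: "nat \<Rightarrow> 'a \<Rightarrow> 'a set" where
  "Hplus r v = {x. p r \<bullet> x - p r \<bullet> v > 0}"

definition R :: "nat \<Rightarrow> 'a set \<Rightarrow> 'a \<Rightarrow> 'a set" where
  "R r X v = Q X v \<inter> H r v"

definition upper_faces :: "nat \<Rightarrow> 'a set \<Rightarrow> 'a \<Rightarrow> 'a set set" where
  "upper_faces r X v = {G \<in> faces (T (Q X v)). G \<subseteq> Hplus r v}"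

definition middle_faces :: "nat \<Rightarrow> 'a set \<Rightarrow> 'a \<Rightarrow> 'a set set" where
  "middle_faces r X v = {G \<in> faces (T (Q X v)). G \<inter> H r v \<noteq> {}}"

text \<open>The pre-blocks after Step 1 and after Step 2.\<close>

definition initial_preblocks :: "nat \<Rightarrow> 'a set \<Rightarrow> 'a set set set" where
  "initial_preblocks r X = {{G, \<tau> r X G, \<beta> r X G} | G. G \<in> faces (T X) \<and> 0 \<notin> \<sigma> X G}"

definition preblocks :: "nat \<Rightarrow> 'a set \<Rightarrow> 'a set set set" where
  "preblocks r X =
     (\<lambda>A. A \<union> {G. \<exists>v\<in>vertices X. G \<in> middle_faces r X v \<and> \<tau> r X G \<in> A}) ` initial_preblocks r X"

text \<open>
  A merging at \<open>v\<close> is given by a set \<open>S\<close> of faces of \<open>T (Q X v)\<close>: all pre-blocks containing a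
  member of \<open>S\<close> are to be merged. The arguments \<open>BR\<close> and \<open>BQ\<close> stand for the recursively
  constructed blocks attached to the vertices of \<open>R r X v\<close> (Step 3) and of \<open>Q X v\<close> (Step 4).
\<close>

definition merges_middle ::
    "('a \<Rightarrow> 'a set set set) \<Rightarrow> nat \<Rightarrow> 'a set \<Rightarrow> 'a \<Rightarrow> 'a set set set" where
  "merges_middle BR r X v =
     {{G \<in> middle_faces r X v. G \<inter> H r v \<in> B} | B. \<exists>u\<in>vertices (R r X v). B \<in> BR u}"

definition merges_upper ::
    "('a \<Rightarrow> 'a set set set) \<Rightarrow> nat \<Rightarrow> 'a set \<Rightarrow> 'a \<Rightarrow> 'a set set set" where
  "merges_upper BQ r X v = (\<Union>w \<in> vertices (Q X v) \<inter> Hplus r v. BQ w)"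

definition merge_preblocks :: "nat \<Rightarrow> 'a set \<Rightarrow> 'a set set \<Rightarrow> 'a set set" where
  "merge_preblocks r X S = \<Union>{A \<in> preblocks r X. A \<inter> S \<noteq> {}}"

text \<open>
  \<open>blocks_at n r X v\<close> is \<open>\<B>\<^sub>v(X)\<close> for an \<open>n\<close>-polytope \<open>X\<close>. For \<open>n = 0\<close> below, the section
  \<open>R r X v\<close> of the segment \<open>X\<close> is empty, and the truncated dimension \<open>n - 1\<close> is immaterial.
\<close>

fun blocks_at :: "nat \<Rightarrow> nat \<Rightarrow> 'a set \<Rightarrow> 'a \<Rightarrow> 'a set set set" where
  "blocks_at 0 r X v = {{{v}}}"
| "blocks_at (Suc n) r X v =
     merge_preblocks r X `
       (merges_middle (blocks_at (n - 1) (Suc r) (R r X v)) r X v \<union>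
        merges_upper (blocks_at n r (Q X v)) r X v)"

definition blocks :: "nat \<Rightarrow> nat \<Rightarrow> 'a set \<Rightarrow> 'a set set set" where
  "blocks n r X = (\<Union>v\<in>vertices X. blocks_at n r X v)"

definition merges :: "nat \<Rightarrow> nat \<Rightarrow> 'a set \<Rightarrow> 'a \<Rightarrow> 'a set set set" where
  "merges n r X v =
     merges_middle (blocks_at (n - 1) (Suc r) (R r X v)) r X v \<union>
     merges_upper (blocks_at n r (Q X v)) r X v"

text \<open>
  All objects introduced by a definite article in the construction exist and are unique, and no
  pre-block takes part in two different mergings, at the top level and in all recursive calls.
\<close>

definition steps12_well_defined :: "nat \<Rightarrow> 'a set \<Rightarrow> bool" where
  "steps12_well_defined r X \<longleftrightarrow>
     (\<forall>G\<in>faces (T X). 0 \<notin> \<sigma> X G \<longrightarrow> (\<exists>!U. is_top r X G U) \<and> (\<exists>!U. is_bottom r X G U)) \<and>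
     (\<forall>v\<in>vertices X. \<forall>G\<in>middle_faces r X v.
        (\<exists>!U. is_top r X G U) \<and> \<tau> r X G \<in> upper_faces r X v \<and>
        (\<exists>!A. A \<in> initial_preblocks r X \<and> \<tau> r X G \<in> A))"

definition steps34_well_defined :: "nat \<Rightarrow> nat \<Rightarrow> 'a set \<Rightarrow> bool" where
  "steps34_well_defined n r X \<longleftrightarrow>
     (\<forall>v\<in>vertices X.
        (\<forall>B\<in>blocks (n - 1) (Suc r) (R r X v). \<forall>F\<in>B.
           \<exists>!G. G \<in> middle_faces r X v \<and> G \<inter> H r v = F) \<and>
        (\<forall>w \<in> vertices (Q X v) \<inter> Hplus r v. \<forall>B\<in>blocks_at n r (Q X v) w.
           B \<subseteq> upper_faces r X v) \<and>
        (\<forall>S\<in>merges n r X v. \<forall>G\<in>S. \<exists>!A. A \<in> preblocks r X \<and> G \<in> A)) \<and>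
     (\<forall>v\<in>vertices X. \<forall>v'\<in>vertices X. \<forall>S\<in>merges n r X v. \<forall>S'\<in>merges n r X v'.
        (\<exists>A\<in>preblocks r X. A \<inter> S \<noteq> {} \<and> A \<inter> S' \<noteq> {}) \<longrightarrow> v = v' \<and> S = S')"

fun well_defined :: "nat \<Rightarrow> nat \<Rightarrow> 'a set \<Rightarrow> bool" where
  "well_defined 0 r X \<longleftrightarrow> (\<exists>v. X = {v} \<and> T X = {v})"
| "well_defined (Suc n) r X \<longleftrightarrow>
     steps12_well_defined r X \<and> steps34_well_defined n r X \<and>
     (\<forall>v\<in>vertices X.
        (R r X v \<noteq> {} \<longrightarrow>
           well_defined (n - 1) (Suc r) (R r X v) \<and>
           partition_on (faces (T (R r X v))) (blocks (n - 1) (Suc r) (R r X v))) \<and>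
        well_defined n r (Q X v) \<and>
        partition_on (faces (T (Q X v))) (blocks n r (Q X v)))"

text \<open>
  The sweep functions separate the vertices arising at all stages of the truncation of each
  polytope occurring in the recursion.
\<close>

fun generic :: "nat \<Rightarrow> nat \<Rightarrow> 'a set \<Rightarrow> bool" where
  "generic 0 r X \<longleftrightarrow> True"
| "generic (Suc n) r X \<longleftrightarrow>
     inj_on (\<lambda>x. p r \<bullet> x) (\<Union>k\<le>Suc n. vertices (stage k X)) \<and>
     (\<forall>v\<in>vertices X.
        generic n r (Q X v) \<and>
        (R r X v \<noteq> {} \<longrightarrow> generic (n - 1) (Suc r) (R r X v)))"

end

end

theory Submission
  imports Defs
begin

text \<open>
  Every polytope occurring in the recursion is, for small \<open>\<epsilon>\<close>, the image under a similarity of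
  a polytope that does not depend on \<open>\<epsilon>\<close>, so it suffices to treat finitely many fixed polytopes.
  For such a polytope \<open>X\<close> and small \<open>\<epsilon>\<close>, the faces of \<open>T X\<close> correspond to the chains of proper
  nonempty faces of \<open>X\<close>, the labels being the dimensions of the members. For a face \<open>G\<close> without
  label \<open>0\<close>, the top and the bottom face arise by inserting into the chain the vertex of its
  smallest member at which the sweep function is maximal or minimal.

  Consequently every lower face of \<open>T (Q X v)\<close> is the top, and every upper face the bottom, of
  exactly one such \<open>G\<close>, so each pre-block contains exactly one upper face \<open>U\<close>, which determines the
  vertex \<open>v\<close> where the pre-block is merged. If \<open>U\<close> is the top of a middle face \<open>M\<close>, then \<open>M\<close> is
  unique and the pre-block is merged in Step 3. Otherwise \<open>U\<close> lies in a recursively constructed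
  block at a vertex of \<open>Q X v\<close> above \<open>H\<close>, and the pre-block is merged in Step 4.
\<close>

text \<open>The depths \<open>\<epsilon> ^ (i + 1)\<close> are what makes the reduction to fixed
  polytopes close up. Rescaling the section at a vertex by the depth of its cut divides the depth of
  every cut through the vertex by that amount, while the section lowers dimensions by one; the
  depths thus return to the powers belonging to the section. A slice by a sweep hyperplane lowers
  dimensions too but rescales nothing, so models carry a shift \<open>k\<close> of the exponent.
  With the vertex moved to the origin, its sweep hyperplane becomes the fixed hyperplane
  \<open>p r \<bullet> y = 0\<close>. The obstacle is uniformity: position and scale of a section
  vary with \<epsilon>, whereas the meaning of "small" has to come from the model. Thresholds are
  therefore stated for a model, uniformly in its placements, and finitely many are combined by
  strong induction on the dimension. Genericity is assumed at an individual \<epsilon>; it enters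
  through injectivity of the sweep on vertices, which is a property of the model.\<close>

lemma finite_arg_max:
  fixes f :: "'a \<Rightarrow> 'b::linorder"
  assumes "finite S" "S \<noteq> {}"
  obtains x where "x \<in> S" "\<And>y. y \<in> S \<Longrightarrow> f y \<le> f x"
proof -
  have "Max (f ` S) \<in> f ` S" using assms by simp
  then obtain x where "x \<in> S" "f x = Max (f ` S)" by auto
  with assms that show ?thesis by simp
qed

lemma finite_arg_min:
  fixes f :: "'a \<Rightarrow> 'b::linorder"
  assumes "finite S" "S \<noteq> {}"
  obtains x where "x \<in> S" "\<And>y. y \<in> S \<Longrightarrow> f x \<le> f y"
proof -
  have "Min (f ` S) \<in> f ` S" using assms by simp
  then obtain x where "x \<in> S" "f x = Min (f ` S)" by auto
  with assms that show ?thesis by simp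
qed

section \<open>Faces, vertices and convex weights of a polytope\<close>

lemma faces_iff: "G \<in> faces X \<longleftrightarrow> G face_of X \<and> G \<noteq> {}"
  by (simp add: faces_def)

lemma proper_faces_iff: "G \<in> proper_faces X \<longleftrightarrow> G face_of X \<and> G \<noteq> {} \<and> G \<noteq> X"
  by (auto simp: proper_faces_def faces_def)

lemma finite_faces: "polytope (X :: 'a::euclidean_space set) \<Longrightarrow> finite (faces X)"
  unfolding faces_def by (rule finite_subset[OF _ finite_polytope_faces]) auto

lemma finite_proper_faces: "polytope (X :: 'a::euclidean_space set) \<Longrightarrow> finite (proper_faces X)"
  by (simp add: finite_faces proper_faces_def)

lemma finite_vertices: "polytope (X :: 'a::euclidean_space set) \<Longrightarrow> finite (vertices X)"
  by (simp add: vertices_def finite_polyhedron_extreme_points polytope_imp_polyhedron)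

lemma vertices_face: "F face_of X \<Longrightarrow> vertices F = vertices X \<inter> F"
  by (auto simp: vertices_def extreme_point_of_face)

lemma vertices_subset: "vertices X \<subseteq> X"
  by (auto simp: vertices_def extreme_point_of_def)

lemma vertices_singleton [simp]: "vertices {v} = {v}"
  by (auto simp: vertices_def)

lemma vertices_empty [simp]: "vertices {} = {}"
  by (auto simp: vertices_def)

lemma singleton_face_iff: "{v} face_of X \<longleftrightarrow> v \<in> vertices X"
  by (simp add: vertices_def face_of_singleton)

lemma polytope_hull_vertices: "polytope (X :: 'a::euclidean_space set) \<Longrightarrow> X = convex hull (vertices X)"
  unfolding vertices_def
  by (rule Krein_Milman_Minkowski) (auto simp: polytope_imp_compact polytope_imp_convex)

lemma polytope_weights:
  fixes X :: "'a::euclidean_space set"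
  assumes "polytope X" "y \<in> X"
  obtains w where "\<And>u. u \<in> vertices X \<Longrightarrow> 0 \<le> w u" "sum w (vertices X) = 1"
    "y = (\<Sum>u\<in>vertices X. w u *\<^sub>R u)"
proof -
  have "y \<in> convex hull (vertices X)"
    using assms polytope_hull_vertices by blast
  then show ?thesis
    using that by (auto simp: convex_hull_finite[OF finite_vertices[OF assms(1)]])
qed

lemma polytope_gt:
  fixes X :: "'a::euclidean_space set"
  assumes "polytope X" "\<And>u. u \<in> vertices X \<Longrightarrow> \<theta> < q \<bullet> u" "y \<in> X"
  shows "\<theta> < q \<bullet> y"
proof -
  have "convex hull (vertices X) \<subseteq> {x. q \<bullet> x > \<theta>}"
    using assms(2) by (intro hull_minimal convex_halfspace_gt) auto
  then show ?thesis
    using assms polytope_hull_vertices by blast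
qed

lemma polytope_lt:
  fixes X :: "'a::euclidean_space set"
  assumes "polytope X" "\<And>u. u \<in> vertices X \<Longrightarrow> q \<bullet> u < \<theta>" "y \<in> X"
  shows "q \<bullet> y < \<theta>"
  using polytope_gt[of X "- \<theta>" "- q" y] assms by simp

lemma polytope_vertex_ge:
  fixes X :: "'a::euclidean_space set"
  assumes "polytope X" "y \<in> X"
  obtains u where "u \<in> vertices X" "q \<bullet> y \<le> q \<bullet> u"
  using polytope_lt[of X q "q \<bullet> y" y] assms by fastforce

lemma polytope_vertex_le:
  fixes X :: "'a::euclidean_space set"
  assumes "polytope X" "y \<in> X"
  obtains u where "u \<in> vertices X" "q \<bullet> u \<le> q \<bullet> y"
  using polytope_gt[of X "q \<bullet> y" q y] assms by fastforce

lemma vertices_nonempty: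
  fixes X :: "'a::euclidean_space set"
  assumes "polytope X" "X \<noteq> {}"
  shows "vertices X \<noteq> {}"
  using polytope_hull_vertices[OF assms(1)] assms(2) by auto

text \<open>The intersection of all faces containing \<open>x\<close> works: if \<open>x\<close> lay
  on its relative boundary, a facet of it would be a smaller face containing
  \<open>x\<close>.\<close>

lemma min_face:
  fixes K :: "'a::euclidean_space set"
  assumes K: "polytope K" and x: "x \<in> K"
  obtains G where "G face_of K" "x \<in> rel_interior G"
proof -
  define G where "G = \<Inter>{F. F face_of K \<and> x \<in> F}"
  have G: "G face_of K"
    unfolding G_def using K x face_of_refl[OF polytope_imp_convex[OF K]]
    by (intro face_of_Inter) auto
  have xG: "x \<in> G"
    by (auto simp: G_def)
  have "x \<in> rel_interior G"
  proof (rule ccontr)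
    assume "x \<notin> rel_interior G"
    then have "x \<in> \<Union>{F. F facet_of G}"
      using xG rel_boundary_of_polyhedron[of G] G K face_of_polytope_polytope polytope_imp_polyhedron
      by blast
    then obtain F where F: "F facet_of G" "x \<in> F"
      by auto
    then have "F face_of K"
      using G facet_of_imp_face_of face_of_trans by blast
    then have "G \<subseteq> F"
      using F by (auto simp: G_def)
    then have "G = F"
      using F facet_of_imp_subset by blast
    then show False
      using F by (simp add: facet_of_def)
  qed
  with G show ?thesis by (rule that)
qed

subsection \<open>Hyperplane sections\<close>

text \<open>The segment from a relative interior point \<open>z\<close> to a point \<open>u\<close>
  of \<open>G\<close> stays in the relative interior except perhaps at \<open>u\<close>, and
  \<open>c\<close> falls along it from at least \<open>h\<close> to below \<open>h\<close>;
  \<open>t\<close> marks the crossing.\<close>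

lemma rel_interior_meets_level:
  fixes G :: "'a::euclidean_space set"
  assumes G: "convex G" and z: "z \<in> rel_interior G" and u: "u \<in> G"
    and lt: "c \<bullet> u < h" "h \<le> c \<bullet> z"
  shows "rel_interior G \<inter> {x. c \<bullet> x = h} \<noteq> {}"
proof (cases "h = c \<bullet> z")
  case True
  then show ?thesis using z by auto
next
  case False
  define t where "t = (c \<bullet> z - h) / (c \<bullet> z - c \<bullet> u)"
  have t: "0 < t" "t < 1"
    using lt False by (auto simp: t_def field_simps)
  let ?x = "(1 - t) *\<^sub>R z + t *\<^sub>R u"
  have "?x \<in> open_segment z u"
    using t lt by (auto simp: in_segment)
  then have "?x \<in> rel_interior G"
    using rel_interior_closure_convex_segment[OF G z, of u] u closure_subset by blast
  moreover have "t * (c \<bullet> z - c \<bullet> u) = c \<bullet> z - h"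
    using lt False by (simp add: t_def)
  then have "c \<bullet> ?x = h"
    by (simp add: inner_add_right algebra_simps)
  ultimately show ?thesis by blast
qed

text \<open>Because the hyperplane contains no vertex, a face that it meets has vertices strictly on
  both sides. This gives crossings in relative interiors and dimension drops of exactly one, for
  vertex cuts as well as for the sweep hyperplane through a vertex section.\<close>

locale transversal_slice =
  fixes K :: "'a::euclidean_space set" and c :: 'a and h :: real
  assumes K: "polytope K" and nv: "\<And>u. u \<in> vertices K \<Longrightarrow> c \<bullet> u \<noteq> h"
begin

abbreviation "hyp \<equiv> {x. c \<bullet> x = h}"

lemma slice_sides:
  assumes "G face_of K" "G \<inter> hyp \<noteq> {}"
  obtains u u' where "u \<in> vertices G" "c \<bullet> u < h" "u' \<in> vertices G" "h < c \<bullet> u'"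
proof -
  have P: "polytope G"
    using assms K face_of_polytope_polytope by blast
  obtain x where x: "x \<in> G" "c \<bullet> x = h"
    using assms by auto
  have *: "c \<bullet> u \<noteq> h" if "u \<in> vertices G" for u
    using nv that vertices_face[OF assms(1)] by auto
  obtain u where "u \<in> vertices G" "c \<bullet> u \<le> c \<bullet> x"
    using polytope_vertex_le[OF P x(1)] by metis
  moreover obtain u' where "u' \<in> vertices G" "c \<bullet> x \<le> c \<bullet> u'"
    using polytope_vertex_ge[OF P x(1)] by metis
  ultimately show ?thesis
    using that[of u u'] * x by force
qed

lemma slice_nonempty:
  assumes "G face_of K" "u \<in> G" "c \<bullet> u < h" "u' \<in> G" "h < c \<bullet> u'"
  shows "rel_interior G \<inter> hyp \<noteq> {}"
proof -
  have G: "convex G"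
    using assms K face_of_imp_convex by blast
  obtain z where z: "z \<in> rel_interior G"
    using G assms(2) rel_interior_eq_empty by blast
  show ?thesis
  proof (cases "h \<le> c \<bullet> z")
    case True
    then show ?thesis
      using rel_interior_meets_level[OF G z assms(2,3)] by simp
  next
    case False
    then show ?thesis
      using rel_interior_meets_level[OF G z assms(4), of "- c" "- h"] assms(5) by simp
  qed
qed

lemma slice_rel_interior:
  assumes "G face_of K" "G \<inter> hyp \<noteq> {}"
  shows "rel_interior G \<inter> hyp \<noteq> {}"
  using slice_sides[OF assms] slice_nonempty[OF assms(1)] vertices_subset by (metis subsetD)

lemma slice_subset_iff:
  assumes "G face_of K" "G \<inter> hyp \<noteq> {}" "G' face_of K"
  shows "G \<inter> hyp \<subseteq> G' \<longleftrightarrow> G \<subseteq> G'"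
proof
  assume "G \<inter> hyp \<subseteq> G'"
  then have "G' \<inter> rel_interior G \<noteq> {}"
    using slice_rel_interior[OF assms(1,2)] rel_interior_subset by blast
  then show "G \<subseteq> G'"
    using subset_of_face_of[OF assms(3)] assms(1) face_of_imp_subset by blast
qed auto

lemma slice_eq_iff:
  assumes "G face_of K" "G \<inter> hyp \<noteq> {}" "G' face_of K"
  shows "G \<inter> hyp = G' \<inter> hyp \<longleftrightarrow> G = G'"
  using assms slice_subset_iff[of G G'] slice_subset_iff[of G' G] by blast

text \<open>Given a face \<open>E\<close> of the slice, let \<open>G\<close> be the face of
  \<open>K\<close> whose relative interior contains a relative interior point \<open>x\<close> of
  \<open>E\<close>. From any \<open>y\<close> of \<open>G\<close> in the hyperplane the segment can
  be prolonged beyond \<open>x\<close> inside the slice, so \<open>E\<close>, being a face, contains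
  \<open>y\<close>.\<close>

lemma slice_faces: "faces (K \<inter> hyp) = {G \<inter> hyp | G. G face_of K \<and> G \<inter> hyp \<noteq> {}}"
proof (intro equalityI subsetI)
  fix E assume "E \<in> faces (K \<inter> hyp)"
  then have E: "E face_of (K \<inter> hyp)" "E \<noteq> {}"
    by (auto simp: faces_iff)
  have cE: "convex E"
    using E face_of_imp_convex by blast
  obtain x where x: "x \<in> rel_interior E"
    using E cE rel_interior_eq_empty by blast
  then have xK: "x \<in> K" "x \<in> hyp"
    using rel_interior_subset E(1) face_of_imp_subset by blast+
  obtain G where G: "G face_of K" "x \<in> rel_interior G"
    using min_face[OF K xK(1)] .
  have "x \<in> G"
    using G rel_interior_subset by blast
  have "G \<inter> hyp face_of K \<inter> hyp"
    using G by (intro face_of_slice) (auto simp: convex_hyperplane)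
  then have sub: "E \<subseteq> G \<inter> hyp"
    using subset_of_face_of[of "G \<inter> hyp" "K \<inter> hyp" E] E x \<open>x \<in> G\<close> xK face_of_imp_subset by blast
  have "G \<inter> hyp \<subseteq> E"
  proof
    fix y assume y: "y \<in> G \<inter> hyp"
    have "convex G" "G \<noteq> {}"
      using G face_of_imp_convex K rel_interior_subset by blast+
    then obtain e where e: "e > 1" "(1 - e) *\<^sub>R y + e *\<^sub>R x \<in> G"
      using G(2) y convex_rel_interior_iff[of G x] by auto
    let ?z = "(1 - e) *\<^sub>R y + e *\<^sub>R x"
    have zh: "?z \<in> hyp"
      using y xK by (simp add: inner_add_right algebra_simps)
    show "y \<in> E"
    proof (cases "x = y")
      case True
      then show ?thesis using x rel_interior_subset by blast
    next
      case False
      have xx: "x = (1 - 1/e) *\<^sub>R y + (1/e) *\<^sub>R ?z"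
        using e False by (simp add: algebra_simps)
      have "y \<noteq> ?z"
      proof
        assume "y = ?z"
        then have "e *\<^sub>R (x - y) = 0" by (simp add: algebra_simps) metis
        then show False using False e by simp
      qed
      then have "x \<in> open_segment y ?z"
        using e xx unfolding in_segment by (intro conjI exI[of _ "1/e"]) auto
      moreover have "x \<in> E"
        using x rel_interior_subset by blast
      moreover have "y \<in> K \<inter> hyp" "?z \<in> K \<inter> hyp"
        using y e zh G(1) face_of_imp_subset by blast+
      ultimately show ?thesis
        using E(1) unfolding face_of_def by blast
    qed
  qed
  then show "E \<in> {G \<inter> hyp | G. G face_of K \<and> G \<inter> hyp \<noteq> {}}"
    using sub G(1) E by blast
next
  fix E assume "E \<in> {G \<inter> hyp | G. G face_of K \<and> G \<inter> hyp \<noteq> {}}"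
  then show "E \<in> faces (K \<inter> hyp)"
    by (auto simp: faces_iff intro!: face_of_slice convex_hyperplane)
qed

text \<open>The relative interior of \<open>G\<close> is open in the affine hull, so its part in the
  hyperplane is open and nonempty in \<open>affine hull G \<inter> hyp\<close> and spans it.
  Vertices on both sides show that the hyperplane does not contain the affine hull.\<close>

lemma slice_aff_dim:
  assumes "G face_of K" "G \<inter> hyp \<noteq> {}"
  shows "aff_dim (G \<inter> hyp) = aff_dim G - 1"
proof -
  obtain u u' where u: "u \<in> G" "c \<bullet> u < h" "u' \<in> G" "h < c \<bullet> u'"
    using slice_sides[OF assms] vertices_subset by (metis subsetD)
  let ?L = "affine hull G \<inter> hyp"
  have aff: "affine ?L"
    by (simp add: affine_Int affine_hyperplane)
  obtain U where U: "open U" "rel_interior G = affine hull G \<inter> U"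
    using openin_rel_interior[of G] unfolding openin_open by blast
  have hL: "affine hull ?L = ?L"
    using aff by (simp add: affine_hull_eq)
  have "rel_interior G \<inter> hyp = ?L \<inter> U"
    using U by blast
  then have "openin (top_of_set (affine hull ?L)) (rel_interior G \<inter> hyp)"
    using U(1) hL openin_open by metis
  then have "affine hull (rel_interior G \<inter> hyp) = ?L"
    using affine_hull_openin[of ?L "rel_interior G \<inter> hyp"] slice_rel_interior[OF assms] hL by simp
  moreover have "rel_interior G \<inter> hyp \<subseteq> G \<inter> hyp" "G \<inter> hyp \<subseteq> ?L"
    using rel_interior_subset hull_subset[of G affine] by blast+
  ultimately have "affine hull (G \<inter> hyp) = ?L"
    using hull_minimal[of "G \<inter> hyp" ?L affine] hull_mono[of "rel_interior G \<inter> hyp" "G \<inter> hyp" affine] aff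
    by blast
  then have "aff_dim (G \<inter> hyp) = aff_dim ?L"
    by (metis aff_dim_affine_hull)
  also have "\<dots> = aff_dim (affine hull G) - 1"
  proof -
    have "?L \<noteq> {}" using assms hull_subset[of G affine] by blast
    moreover have "\<not> affine hull G \<subseteq> hyp"
      using u hull_subset[of G affine] by fastforce
    ultimately show ?thesis
      by (subst aff_dim_affine_Int_hyperplane) auto
  qed
  finally show ?thesis by simp
qed

lemma slice_polytope: "polytope (K \<inter> hyp)"
  using K by (intro polytope_Int_polyhedron) (auto simp: polyhedron_hyperplane)

end

subsection \<open>Flags\<close>

text \<open>The order complex of the proper nonempty faces, that is, the barycentric subdivision of
  the boundary. The complete truncation is combinatorially dual to it, which is why its faces are
  indexed by these sets; the empty chain stands for the truncation itself.\<close>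

definition chains :: "'a::euclidean_space set \<Rightarrow> 'a set set set" where
  "chains X = {C. C \<subseteq> proper_faces X \<and> (\<forall>E\<in>C. \<forall>F\<in>C. E \<subseteq> F \<or> F \<subseteq> E)}"

lemma chains_subset: "C \<in> chains X \<Longrightarrow> D \<subseteq> C \<Longrightarrow> D \<in> chains X"
  unfolding chains_def by blast

lemma finite_chain: "polytope X \<Longrightarrow> C \<in> chains X \<Longrightarrow> finite C"
  by (auto simp: chains_def intro: finite_subset finite_proper_faces)

lemma proper_face_aff_dim:
  assumes "polytope X" "E \<in> proper_faces X"
  shows "0 \<le> aff_dim E" "aff_dim E < aff_dim X"
proof -
  show "0 \<le> aff_dim E"
    using assms aff_dim_empty[of E] aff_dim_geq[of E] by (auto simp: proper_faces_iff)
  show "aff_dim E < aff_dim X"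
    using assms face_of_aff_dim_lt[of X E] polytope_imp_convex by (auto simp: proper_faces_iff)
qed

lemma faces_nested:
  assumes "polytope X" "E face_of X" "F face_of X" "E \<subseteq> F \<or> F \<subseteq> E" "aff_dim E \<le> aff_dim F"
  shows "E \<subseteq> F"
proof (rule ccontr)
  assume "\<not> E \<subseteq> F"
  then have "F \<subseteq> E" "F \<noteq> E" using assms by auto
  moreover have "F face_of E"
    using assms face_of_face \<open>F \<subseteq> E\<close> by blast
  moreover have "convex E" using assms face_of_imp_convex by blast
  ultimately show False
    using face_of_aff_dim_lt[of E F] assms by simp
qed

lemma chain_nested:
  assumes "polytope X" "C \<in> chains X" "E \<in> insert X C" "F \<in> insert X C" "aff_dim E \<le> aff_dim F"
  shows "E \<subseteq> F"
proof (rule faces_nested[OF assms(1) _ _ _ assms(5)])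
  have *: "G face_of X" if "G \<in> insert X C" for G
    using that assms(1,2) by (auto simp: chains_def proper_faces_iff face_of_refl polytope_imp_convex)
  show "E face_of X" "F face_of X" using * assms by auto
  then have "E \<subseteq> X" "F \<subseteq> X" by (auto simp: face_of_imp_subset)
  then show "E \<subseteq> F \<or> F \<subseteq> E"
    using assms(2-4) unfolding chains_def by blast
qed

lemma chain_dim_inj:
  assumes "polytope X" "C \<in> chains X"
  shows "inj_on aff_dim C"
  using chain_nested[OF assms] by (intro inj_onI) (metis insertCI order_refl subset_antisym)

text \<open>A chain of maximal size misses no dimension: if \<open>i\<close> were missing, a facet
  of the smallest member above \<open>i\<close> that contains the largest member below
  \<open>i\<close> could be inserted.\<close>

lemma full_flag:
  assumes X: "polytope X" "aff_dim X = int n" and C: "C \<in> chains X"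
  obtains D where "D \<in> chains X" "C \<subseteq> D" "aff_dim ` D = int ` {..<n}" "card D = n"
proof -
  let ?S = "{D. D \<in> chains X \<and> C \<subseteq> D}"
  have fin: "finite ?S"
    by (rule finite_subset[of _ "Pow (proper_faces X)"]) (auto simp: chains_def finite_proper_faces X)
  obtain D where D: "D \<in> ?S" and mx: "\<And>D'. D' \<in> ?S \<Longrightarrow> card D' \<le> card D"
    using finite_arg_max[of ?S card] fin C by blast
  have Dc: "D \<in> chains X" "C \<subseteq> D" using D by auto
  have finD: "finite D" using finite_chain X Dc by blast
  have dims: "0 \<le> aff_dim E \<and> aff_dim E < int n" if "E \<in> D" for E
    using proper_face_aff_dim[OF X(1)] that Dc X(2) by (auto simp: chains_def)
  have "int i \<in> aff_dim ` D" if i: "i < n" for i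
  proof (rule ccontr)
    assume ni: "int i \<notin> aff_dim ` D"
    have face: "E face_of X" if "E \<in> insert X D" for E
      using that X Dc by (auto simp: chains_def proper_faces_iff face_of_refl polytope_imp_convex)
    let ?B = "{E \<in> insert X D. int i < aff_dim E}"
    have "finite ?B" "X \<in> ?B" using finD X(2) i by auto
    then obtain G where G: "G \<in> ?B" "\<And>E. E \<in> ?B \<Longrightarrow> aff_dim G \<le> aff_dim E"
      using finite_arg_min[of ?B aff_dim] by (metis (no_types, lifting) empty_iff)
    have G': "G face_of X" "polytope G"
      using G face X face_of_polytope_polytope by blast+
    \<comment> \<open>If the chain has no member of dimension below \<open>i\<close>, a vertex of
      \<open>G\<close> takes its place, so that there is a proper face of \<open>G\<close> to
      enlarge to a facet.\<close>
    obtain F where F: "F face_of G" "F \<noteq> {}" "F \<noteq> G"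
        "\<And>E. E \<in> D \<Longrightarrow> aff_dim E < int i \<Longrightarrow> E \<subseteq> F"
    proof (cases "\<exists>E\<in>D. aff_dim E < int i")
      case True
      let ?A = "{E \<in> D. aff_dim E < int i}"
      have "finite ?A" "?A \<noteq> {}" using finD True by auto
      then obtain F where F: "F \<in> ?A" "\<And>E. E \<in> ?A \<Longrightarrow> aff_dim E \<le> aff_dim F"
        using finite_arg_max[of ?A aff_dim] by blast
      have "F \<subseteq> G" "F \<noteq> G" "F face_of X"
        using chain_nested[OF X(1) Dc(1), of F G] F(1) G(1) face by auto
      moreover have "F \<noteq> {}"
        using F(1) Dc by (auto simp: chains_def proper_faces_iff)
      moreover have "E \<subseteq> F" if "E \<in> D" "aff_dim E < int i" for E
        using chain_nested[OF X(1) Dc(1), of E F] F that by auto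
      ultimately show ?thesis
        using that[of F] G'(1) face_of_face by blast
    next
      case False
      have "G \<noteq> {}" using G(1) by auto
      then obtain v where v: "v \<in> vertices G"
        using vertices_nonempty G'(2) by blast
      have "{v} \<noteq> G" using G(1) by (metis (mono_tags, lifting) aff_dim_sing mem_Collect_eq of_nat_0_le_iff not_le)
      then show ?thesis
        by (intro that[of "{v}"]) (use False v in \<open>auto simp: singleton_face_iff\<close>)
    qed
    obtain H where H: "H facet_of G" "F \<subseteq> H"
      using face_of_polyhedron_subset_facet[of G F] F G'(2) polytope_imp_polyhedron by blast
    have Hf: "H face_of X" "H \<noteq> {}" "aff_dim H = aff_dim G - 1" "H \<subseteq> G"
    proof -
      have "H face_of G" "H \<noteq> {}" "aff_dim H = aff_dim G - 1"
        using H by (auto simp: facet_of_def)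
      with G'(1) show "H face_of X" "H \<noteq> {}" "aff_dim H = aff_dim G - 1" "H \<subseteq> G"
        using face_of_trans face_of_imp_subset by blast+
    qed
    have HX: "H \<noteq> X"
    proof
      assume "H = X"
      then have "aff_dim G - 1 = aff_dim X" using Hf(3) by simp
      then show False using aff_dim_subset[OF face_of_imp_subset[OF G'(1)]] by linarith
    qed
    \<comment> \<open>\<open>H\<close> has dimension at least \<open>i\<close>; as a member of the
      chain it would exceed \<open>i\<close> and contradict the minimality of
      \<open>G\<close>.\<close>
    have "H \<notin> D"
    proof
      assume "H \<in> D"
      then have "aff_dim H \<noteq> int i" using ni by force
      then have "int i < aff_dim H" using Hf(3) G(1) by auto
      then show False using G(2)[of H] Hf(3) \<open>H \<in> D\<close> by auto
    qed
    have "E \<subseteq> H \<or> H \<subseteq> E" if E: "E \<in> D" for E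
    proof (cases "aff_dim E < int i")
      case True
      then show ?thesis using F(4)[OF E] H(2) by blast
    next
      case False
      then have "aff_dim E > int i" using ni E by force
      then have "aff_dim G \<le> aff_dim E" using G(2)[of E] E by auto
      then have "G \<subseteq> E" using chain_nested[OF X(1) Dc(1), of G E] G(1) E by auto
      then show ?thesis using Hf(4) by blast
    qed
    moreover have "H \<in> proper_faces X"
      using Hf HX by (simp add: proper_faces_iff)
    ultimately have "insert H D \<in> chains X"
      using Dc(1) by (simp add: chains_def) blast
    then have "insert H D \<in> ?S"
      using Dc(2) by auto
    then have "card (insert H D) \<le> card D" by (rule mx)
    then show False using \<open>H \<notin> D\<close> finD by simp
  qed
  then have im: "aff_dim ` D = int ` {..<n}"
  proof (intro equalityI subsetI)
    fix z :: int assume "z \<in> aff_dim ` D"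
    then have "0 \<le> z" "z < int n" using dims by auto
    then show "z \<in> int ` {..<n}" by (intro image_eqI[of _ _ "nat z"]) auto
  qed auto
  have "card D = card (aff_dim ` D)"
    using chain_dim_inj[OF X(1) Dc(1)] by (simp add: card_image)
  also have "\<dots> = n" unfolding im by (simp add: card_image)
  finally show ?thesis using that Dc im by blast
qed

subsection \<open>Vertex figures\<close>

text \<open>All vertices but \<open>v\<close> lie deeper than \<open>t0\<close>, so a point at depth
  \<open>t\<close> lies on a segment from \<open>v\<close> to a point of the hull of the other
  vertices. That segment also crosses depth \<open>t0\<close>, and seen from \<open>v\<close> the
  two crossings differ by the factor \<open>t / t0\<close>.\<close>

lemma vertex_section_homothetic:
  fixes F :: "'a::euclidean_space set"
  assumes F: "polytope F" and v: "v \<in> vertices F" and \<alpha>v: "\<alpha> \<bullet> v = \<beta>"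
    and lt: "\<And>u. u \<in> vertices F \<Longrightarrow> u \<noteq> v \<Longrightarrow> \<alpha> \<bullet> u < \<beta> - t0"
    and t: "0 < t" "t \<le> t0"
  shows "F \<inter> {x. \<alpha> \<bullet> x = \<beta> - t} =
    (\<lambda>y. v + t *\<^sub>R y) ` (\<lambda>x. (1/t0) *\<^sub>R (x - v)) ` (F \<inter> {x. \<alpha> \<bullet> x = \<beta> - t0})"
proof (intro equalityI subsetI)
  have vF: "v \<in> F" using v vertices_subset by blast
  have cF: "convex F" using F polytope_imp_convex by blast
  {
    fix x assume "x \<in> (\<lambda>y. v + t *\<^sub>R y) ` (\<lambda>x. (1/t0) *\<^sub>R (x - v)) ` (F \<inter> {x. \<alpha> \<bullet> x = \<beta> - t0})"
    then obtain y where y: "y \<in> F" "\<alpha> \<bullet> y = \<beta> - t0" "x = v + (t / t0) *\<^sub>R (y - v)"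
      by (auto simp: field_simps)
    have "x = (1 - t/t0) *\<^sub>R v + (t/t0) *\<^sub>R y" by (simp add: y algebra_simps)
    then have "x \<in> F"
      using cF vF y(1) t by (auto intro!: convexD_alt)
    moreover have "\<alpha> \<bullet> x = \<beta> - t"
      using t by (simp add: y inner_add_right inner_diff_right \<alpha>v)
    ultimately show "x \<in> F \<inter> {x. \<alpha> \<bullet> x = \<beta> - t}" by auto
  next
    fix x assume x: "x \<in> F \<inter> {x. \<alpha> \<bullet> x = \<beta> - t}"
    define W where "W = vertices F - {v}"
    have hull: "F = convex hull (insert v W)"
      using polytope_hull_vertices[OF F] v by (auto simp: W_def insert_absorb)
    have "W \<noteq> {}"
    proof
      assume "W = {}"
      then have "x = v" using hull x by auto
      then show False using x t \<alpha>v by simp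
    qed
    then have "\<exists>l m z. 0 \<le> l \<and> 0 \<le> m \<and> l + m = 1 \<and> z \<in> convex hull W \<and> x = l *\<^sub>R v + m *\<^sub>R z"
      using x hull convex_hull_insert[OF \<open>W \<noteq> {}\<close>, of v] by auto
    then obtain l m z where lm: "0 \<le> m" "l + m = 1" "z \<in> convex hull W" "x = l *\<^sub>R v + m *\<^sub>R z"
      by blast
    have "l = 1 - m" using lm(2) by simp
    with lm have m: "0 \<le> m" "z \<in> convex hull W" "x = v + m *\<^sub>R (z - v)"
      by (simp_all add: algebra_simps)
    have "convex hull W \<subseteq> {x. \<alpha> \<bullet> x < \<beta> - t0}"
      using lt by (intro hull_minimal convex_halfspace_lt) (auto simp: W_def)
    then have z: "\<alpha> \<bullet> z < \<beta> - t0" using m by auto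
    have zF: "z \<in> F" using m(2) hull hull_mono[of W "insert v W" convex] by blast
    have tm: "t = m * (\<beta> - \<alpha> \<bullet> z)"
      using x m(3) \<alpha>v by (simp add: inner_add_right inner_diff_right algebra_simps)
    \<comment> \<open>The parameter at which the segment from \<open>v\<close> to \<open>z\<close>
      reaches depth \<open>t0\<close>.\<close>
    define l where "l = t0 / (\<beta> - \<alpha> \<bullet> z)"
    have l: "0 \<le> l" "l \<le> 1" using z t by (auto simp: l_def field_simps)
    let ?y = "v + l *\<^sub>R (z - v)"
    have "?y = (1 - l) *\<^sub>R v + l *\<^sub>R z" by (simp add: algebra_simps)
    then have "?y \<in> F"
      using cF vF zF l by (auto intro!: convexD_alt)
    moreover have "\<alpha> \<bullet> ?y = \<beta> - t0"
    proof -
      have "l * (\<beta> - \<alpha> \<bullet> z) = t0" using z t by (simp add: l_def)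
      then show ?thesis using \<alpha>v by (simp add: inner_add_right inner_diff_right algebra_simps)
    qed
    moreover have "x = v + t *\<^sub>R ((1/t0) *\<^sub>R (?y - v))"
      using t z by (simp add: m(3) tm l_def)
    ultimately show "x \<in> (\<lambda>y. v + t *\<^sub>R y) ` (\<lambda>x. (1/t0) *\<^sub>R (x - v)) ` (F \<inter> {x. \<alpha> \<bullet> x = \<beta> - t0})"
      by blast
  }
qed

subsection \<open>Shallow truncations of a fixed polytope\<close>

text \<open>In contrast to \<open>supporting_hyperplanes\<close> the normals are not normalised: a
  section inherits them from larger faces, and they are then in general not parallel to its affine
  hull.\<close>

definition supports :: "'a::euclidean_space set \<Rightarrow> ('a set \<Rightarrow> 'a) \<Rightarrow> ('a set \<Rightarrow> real) \<Rightarrow> bool" where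
  "supports S \<alpha> \<beta> \<longleftrightarrow>
     (\<forall>E\<in>proper_faces S. S \<subseteq> {x. \<alpha> E \<bullet> x \<le> \<beta> E} \<and> E = S \<inter> {x. \<alpha> E \<bullet> x = \<beta> E})"

text \<open>The shift \<open>k\<close> counts the slices by sweep hyperplanes since the last
  rescaling: each slice lowers the dimension of a face by one but leaves the depth of its cut
  unchanged.\<close>

definition depth :: "real \<Rightarrow> nat \<Rightarrow> 'a::euclidean_space set \<Rightarrow> real" where
  "depth \<epsilon> k E = \<epsilon> ^ (nat (aff_dim E) + 1 + k)"

lemma supports_le: "supports S \<alpha> \<beta> \<Longrightarrow> E \<in> proper_faces S \<Longrightarrow> y \<in> S \<Longrightarrow> \<alpha> E \<bullet> y \<le> \<beta> E"
  by (auto simp: supports_def)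

lemma supports_eq_iff:
  "supports S \<alpha> \<beta> \<Longrightarrow> E \<in> proper_faces S \<Longrightarrow> y \<in> S \<Longrightarrow> \<alpha> E \<bullet> y = \<beta> E \<longleftrightarrow> y \<in> E"
  unfolding supports_def by blast

lemma eventually_small:
  assumes "0 < (c::real)"
  shows "\<forall>\<^sub>F \<epsilon> in at_right 0. 0 < \<epsilon> \<and> \<epsilon> < c"
  using eventually_at_right_real[OF assms] by eventually_elim auto

lemma depth_pos: "0 < \<epsilon> \<Longrightarrow> 0 < depth \<epsilon> k E"
  by (simp add: depth_def)

lemma depth_le:
  assumes "0 < \<epsilon>" "\<epsilon> < 1"
  shows "depth \<epsilon> k E \<le> \<epsilon>"
  using power_decreasing[of 1 "nat (aff_dim E) + 1 + k" \<epsilon>] assms by (simp add: depth_def)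

lemma depth_le_step:
  assumes "0 < \<epsilon>" "\<epsilon> < 1" "0 \<le> aff_dim E" "aff_dim E < aff_dim F"
  shows "depth \<epsilon> k F \<le> \<epsilon> * depth \<epsilon> k E"
proof -
  have "\<epsilon> ^ (nat (aff_dim F) + 1 + k) \<le> \<epsilon> ^ (Suc (nat (aff_dim E) + 1 + k))"
    using assms by (intro power_decreasing) auto
  then show ?thesis by (simp add: depth_def)
qed

lemma finite_pos_lower_bound:
  assumes "finite A" "\<And>x. x \<in> A \<Longrightarrow> 0 < (f x :: real)"
  shows "\<exists>c>0. \<forall>x\<in>A. c \<le> f x"
proof (cases "A = {}")
  case True
  then show ?thesis by (intro exI[of _ 1]) simp
next
  case False
  then obtain x where "x \<in> A" "\<And>y. y \<in> A \<Longrightarrow> f x \<le> f y"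
    using finite_arg_min[OF assms(1)] by blast
  then show ?thesis using assms(2) by (intro exI[of _ "f x"]) blast
qed

lemma finite_upper_bound:
  assumes "finite A"
  shows "\<exists>M>0. \<forall>x\<in>A. (f x :: real) \<le> M"
proof (cases "A = {}")
  case True
  then show ?thesis by (intro exI[of _ 1]) simp
next
  case False
  then obtain x where x: "x \<in> A" "\<And>y. y \<in> A \<Longrightarrow> f y \<le> f x"
    using finite_arg_max[OF assms(1)] by blast
  show ?thesis
    by (rule exI[of _ "max 1 (f x)"]) (use x in \<open>auto simp: le_max_iff_disj\<close>)
qed

section \<open>Two-sided bounds for the distances to supporting hyperplanes\<close>

definition slack_weights where
  "slack_weights S \<alpha> \<beta> c M y w \<longleftrightarrow>
     (\<forall>u\<in>vertices S. 0 \<le> w u) \<and> sum w (vertices S) = 1 \<and>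
       y = (\<Sum>u\<in>vertices S. w u *\<^sub>R u) \<and>
       (\<forall>E\<in>proper_faces S. c * sum w (vertices S - E) \<le> \<beta> E - \<alpha> E \<bullet> y \<and>
          \<beta> E - \<alpha> E \<bullet> y \<le> M * sum w (vertices S - E))"

text \<open>The slack at a convex combination is the weighted mean of the slacks at the vertices,
  which vanish on \<open>E\<close> and are positive off it; \<open>c\<close> and \<open>M\<close>
  bound the finitely many positive values. A single weight vector serves all faces, so that the
  slacks of different faces can be compared.\<close>

lemma slack_bounds:
  assumes S: "polytope S" and sup: "supports S \<alpha> \<beta>"
  shows "\<exists>c>0. \<exists>M>0. \<forall>y\<in>S. \<exists>w. slack_weights S \<alpha> \<beta> c M y w"
proof -
  let ?A = "Sigma (proper_faces S) (\<lambda>E. vertices S - E)"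
  let ?f = "\<lambda>(E, u). \<beta> E - \<alpha> E \<bullet> u"
  have fin: "finite ?A" using S by (intro finite_SigmaI) (auto simp: finite_proper_faces finite_vertices)
  have pos: "0 < ?f x" if xA: "x \<in> ?A" for x
  proof -
    obtain E u where x: "x = (E, u)" "E \<in> proper_faces S" "u \<in> vertices S" "u \<notin> E"
      using xA by blast
    moreover have "u \<in> S" using x vertices_subset by blast
    ultimately have "\<alpha> E \<bullet> u \<noteq> \<beta> E" "\<alpha> E \<bullet> u \<le> \<beta> E"
      using supports_le[OF sup x(2)] supports_eq_iff[OF sup x(2)] by blast+
    then show ?thesis using x by simp
  qed
  obtain c where c: "0 < c" "\<And>x. x \<in> ?A \<Longrightarrow> c \<le> ?f x"
    using finite_pos_lower_bound[of ?A ?f, OF fin pos] by blast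
  obtain M where M: "0 < M" "\<And>x. x \<in> ?A \<Longrightarrow> ?f x \<le> M"
    using finite_upper_bound[of ?A ?f, OF fin] by blast
  show ?thesis
  proof (rule exI[of _ c], intro conjI exI[of _ M] ballI)
    show "0 < c" "0 < M" using c(1) M(1) .
    fix y assume "y \<in> S"
    then obtain w where w: "\<And>u. u \<in> vertices S \<Longrightarrow> 0 \<le> w u" "sum w (vertices S) = 1"
      "y = (\<Sum>u\<in>vertices S. w u *\<^sub>R u)"
      using polytope_weights[OF S] by metis
    moreover have "c * sum w (vertices S - E) \<le> \<beta> E - \<alpha> E \<bullet> y \<and> \<beta> E - \<alpha> E \<bullet> y \<le> M * sum w (vertices S - E)"
      if E: "E \<in> proper_faces S" for E
    proof -
      have "\<beta> E - \<alpha> E \<bullet> y = (\<Sum>u\<in>vertices S. w u * (\<beta> E - \<alpha> E \<bullet> u))"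
        by (simp add: w(3) inner_sum_right right_diff_distrib sum_subtractf w(2) flip: sum_distrib_right)
      also have "\<dots> = (\<Sum>u\<in>vertices S - E. w u * (\<beta> E - \<alpha> E \<bullet> u))"
      proof (intro sum.mono_neutral_right ballI)
        fix u assume u: "u \<in> vertices S - (vertices S - E)"
        then have "u \<in> S" "u \<in> E" using vertices_subset by auto
        then have "\<beta> E - \<alpha> E \<bullet> u = 0" using supports_eq_iff[OF sup E, of u] by simp
        then show "w u * (\<beta> E - \<alpha> E \<bullet> u) = 0" by simp
      qed (use finite_vertices[OF S] in auto)
      finally have eq: "\<beta> E - \<alpha> E \<bullet> y = (\<Sum>u\<in>vertices S - E. w u * (\<beta> E - \<alpha> E \<bullet> u))" .
      show ?thesis
        unfolding eq sum_distrib_left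
      proof (intro conjI sum_mono)
        fix u assume "u \<in> vertices S - E"
        then have "c \<le> \<beta> E - \<alpha> E \<bullet> u" "\<beta> E - \<alpha> E \<bullet> u \<le> M" "0 \<le> w u"
          using c(2)[of "(E, u)"] M(2)[of "(E, u)"] E w(1) by auto
        then show "c * w u \<le> w u * (\<beta> E - \<alpha> E \<bullet> u)" "w u * (\<beta> E - \<alpha> E \<bullet> u) \<le> M * w u"
          by (simp_all add: mult.commute[of _ "w u"] mult_left_mono)
      qed
    qed
    ultimately show "\<exists>w. slack_weights S \<alpha> \<beta> c M y w"
      unfolding slack_weights_def by blast
  qed
qed

lemma Int_proper_face:
  assumes "E \<in> proper_faces S" "F \<in> proper_faces S" "E \<inter> F \<noteq> {}"
  shows "E \<inter> F \<in> proper_faces S"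
  using assms face_of_Int[of E S F] face_of_imp_subset by (auto simp: proper_faces_iff)

text \<open>
  A point at small distance from two faces is at comparably small distance from their
  intersection, whose cut is deeper by a factor of order \<open>1/\<epsilon>\<close> if the faces are incomparable.
\<close>

lemma eventually_tight_nested:
  assumes S: "polytope S" and sup: "supports S \<alpha> \<beta>"
  shows "\<forall>\<^sub>F \<epsilon> in at_right 0. \<forall>E\<in>proper_faces S. \<forall>F\<in>proper_faces S. \<forall>y\<in>S.
    (\<forall>G\<in>proper_faces S. \<alpha> G \<bullet> y \<le> \<beta> G - depth \<epsilon> k G) \<longrightarrow>
    \<alpha> E \<bullet> y = \<beta> E - depth \<epsilon> k E \<longrightarrow> \<alpha> F \<bullet> y = \<beta> F - depth \<epsilon> k F \<longrightarrow> E \<subseteq> F \<or> F \<subseteq> E"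
proof -
  obtain c M where c: "0 < c" and M: "0 < M" and cM:
    "\<And>y. y \<in> S \<Longrightarrow> \<exists>w. slack_weights S \<alpha> \<beta> c M y w"
    using slack_bounds[OF assms] by blast
  \<comment> \<open>Disjoint faces call for \<open>2 * \<epsilon> < c\<close>, faces with a common
    part for \<open>2 * M * \<epsilon> < c\<close>.\<close>
  have "0 < min 1 (min (c / 2) (c / (2 * M)))" using c M by simp
  from eventually_small[OF this] show ?thesis
  proof eventually_elim
    case (elim \<epsilon>)
    then have e: "0 < \<epsilon>" "\<epsilon> < 1" "2 * \<epsilon> < c" "2 * M * \<epsilon> < c"
      using M by (auto simp: field_simps)
    show ?case
    proof (intro ballI impI)
      fix E F y
      assume E: "E \<in> proper_faces S" and F: "F \<in> proper_faces S" and y: "y \<in> S"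
        and tr: "\<forall>G\<in>proper_faces S. \<alpha> G \<bullet> y \<le> \<beta> G - depth \<epsilon> k G"
        and tE: "\<alpha> E \<bullet> y = \<beta> E - depth \<epsilon> k E" and tF: "\<alpha> F \<bullet> y = \<beta> F - depth \<epsilon> k F"
      let ?V = "vertices S"
      have finV: "finite ?V" using S by (rule finite_vertices)
      obtain w where w: "\<forall>u\<in>?V. 0 \<le> w u" "sum w ?V = 1"
        "\<forall>E\<in>proper_faces S. c * sum w (?V - E) \<le> \<beta> E - \<alpha> E \<bullet> y \<and> \<beta> E - \<alpha> E \<bullet> y \<le> M * sum w (?V - E)"
        using cM[OF y] unfolding slack_weights_def by blast
      have offE: "c * sum w (?V - E) \<le> depth \<epsilon> k E" and offF: "c * sum w (?V - F) \<le> depth \<epsilon> k F"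
        using w(3) E F tE tF by force+
      have "sum w (?V - E \<inter> F) \<le> sum w (?V - E) + sum w (?V - F)"
      proof -
        have "?V - E \<inter> F = (?V - E) \<union> (?V - F)" by blast
        then have "sum w (?V - E \<inter> F) + sum w ((?V - E) \<inter> (?V - F)) = sum w (?V - E) + sum w (?V - F)"
          using finV by (simp add: sum.union_inter)
        moreover have "0 \<le> sum w ((?V - E) \<inter> (?V - F))"
          using w(1) by (intro sum_nonneg) auto
        ultimately show ?thesis by linarith
      qed
      then have both: "c * sum w (?V - E \<inter> F) \<le> depth \<epsilon> k E + depth \<epsilon> k F"
        using offE offF c mult_left_mono[of "sum w (?V - E \<inter> F)" "sum w (?V - E) + sum w (?V - F)" c]
        by (simp add: distrib_left)
      show "E \<subseteq> F \<or> F \<subseteq> E"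
      proof (rule ccontr)
        assume inc: "\<not> (E \<subseteq> F \<or> F \<subseteq> E)"
        show False
        proof (cases "E \<inter> F = {}")
          case True
          \<comment> \<open>No vertex lies on both faces, so the whole weight 1 is off the
            intersection.\<close>
          then have "c \<le> depth \<epsilon> k E + depth \<epsilon> k F"
            using both w(2) by simp
          then show False
            using depth_le[OF e(1,2), of k E] depth_le[OF e(1,2), of k F] e(3) by linarith
        next
          case False
          let ?G = "E \<inter> F"
          have G: "?G \<in> proper_faces S" using Int_proper_face[OF E F False] .
          have EF: "E face_of S" "F face_of S" "?G face_of S"
            using E F G by (auto simp: proper_faces_iff)
          have "?G face_of E" "?G face_of F" "?G \<noteq> E" "?G \<noteq> F" "convex E" "convex F"
            using EF face_of_face inc face_of_imp_convex by blast+
          then have dims: "aff_dim ?G < aff_dim E" "aff_dim ?G < aff_dim F"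
            using face_of_aff_dim_lt by blast+
          have "0 \<le> aff_dim ?G" using proper_face_aff_dim(1)[OF S G] .
          then have st: "depth \<epsilon> k E \<le> \<epsilon> * depth \<epsilon> k ?G" "depth \<epsilon> k F \<le> \<epsilon> * depth \<epsilon> k ?G"
            using depth_le_step[OF e(1,2)] dims by blast+
          have "depth \<epsilon> k ?G \<le> \<beta> ?G - \<alpha> ?G \<bullet> y" using tr G by force
          also have "\<dots> \<le> M * sum w (?V - ?G)" using w(3) G by blast
          finally have "c * depth \<epsilon> k ?G \<le> M * (c * sum w (?V - ?G))"
            using c by (simp add: mult.left_commute)
          also have "\<dots> \<le> M * (2 * \<epsilon> * depth \<epsilon> k ?G)"
            using M both st by (intro mult_left_mono) auto
          finally have "(c - 2 * M * \<epsilon>) * depth \<epsilon> k ?G \<le> 0"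
            by (simp add: algebra_simps)
          moreover have "0 < (c - 2 * M * \<epsilon>) * depth \<epsilon> k ?G"
            using e depth_pos[OF e(1)] by (intro mult_pos_pos) auto
          ultimately show False by linarith
        qed
      qed
    qed
  qed
qed

text \<open>On the cut along \<open>E\<close> the weight off \<open>E\<close> is at most
  \<open>\<epsilon> / c\<close>. Vertices of \<open>E\<close> exceed \<theta> by at least
  \<open>m\<close> and the others fall short of it by at most \<open>L\<close>, so that
  \<open>\<epsilon> < c * m / (m + L)\<close> suffices.\<close>

lemma eventually_tight_gt:
  assumes S: "polytope S" and sup: "supports S \<alpha> \<beta>" and E: "E \<in> insert S (proper_faces S)"
    and q: "\<And>u. u \<in> vertices E \<Longrightarrow> \<theta> < q \<bullet> u"
  shows "\<forall>\<^sub>F \<epsilon> in at_right 0. \<forall>y\<in>S. E = S \<or> \<alpha> E \<bullet> y = \<beta> E - depth \<epsilon> k E \<longrightarrow> \<theta> < q \<bullet> y"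
proof (cases "E = S")
  case True
  then show ?thesis using polytope_gt[OF S] q by simp
next
  case False
  then have E: "E \<in> proper_faces S" using E by simp
  obtain c M where c: "0 < c" and cM:
    "\<And>y. y \<in> S \<Longrightarrow> \<exists>w. slack_weights S \<alpha> \<beta> c M y w"
    using slack_bounds[OF S sup] by blast
  have fin: "finite (vertices S)" "finite (vertices E)"
    using S E finite_vertices face_of_polytope_polytope by (auto simp: proper_faces_iff)
  obtain m where m: "0 < m" "\<And>u. u \<in> vertices E \<Longrightarrow> m \<le> q \<bullet> u - \<theta>"
    using finite_pos_lower_bound[OF fin(2), of "\<lambda>u. q \<bullet> u - \<theta>"] q by auto
  obtain L where L: "0 < L" "\<And>u. u \<in> vertices S \<Longrightarrow> \<theta> - q \<bullet> u \<le> L"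
    using finite_upper_bound[OF fin(1), of "\<lambda>u. \<theta> - q \<bullet> u"] by auto
  have vE: "vertices E = vertices S \<inter> E"
    using E by (intro vertices_face) (auto simp: proper_faces_iff)
  have "0 < min 1 (c * m / (m + L))" using c m L by simp
  from eventually_small[OF this] show ?thesis
  proof eventually_elim
    case (elim \<epsilon>)
    then have e: "0 < \<epsilon>" "\<epsilon> < 1" "(m + L) * \<epsilon> < c * m"
      using m L by (auto simp: field_simps)
    show ?case
    proof (intro ballI impI)
      fix y assume y: "y \<in> S" and "E = S \<or> \<alpha> E \<bullet> y = \<beta> E - depth \<epsilon> k E"
      then have t: "\<beta> E - \<alpha> E \<bullet> y = depth \<epsilon> k E" using False by auto
      let ?V = "vertices S"
      obtain w where w: "\<forall>u\<in>?V. 0 \<le> w u" "sum w ?V = 1" "y = (\<Sum>u\<in>?V. w u *\<^sub>R u)"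
        "c * sum w (?V - E) \<le> \<beta> E - \<alpha> E \<bullet> y"
        using cM[OF y] E unfolding slack_weights_def by blast
      let ?o = "sum w (?V - E)"
      have o: "c * ?o \<le> \<epsilon>" using w(4) t depth_le[OF e(1,2), of k E] by linarith
      have split: "sum f ?V = sum f (?V \<inter> E) + sum f (?V - E)" for f :: "_ \<Rightarrow> real"
        using fin(1) by (simp add: sum.Int_Diff)
      have in1: "sum w (?V \<inter> E) = 1 - ?o" using split[of w] w(2) by simp
      have "q \<bullet> y - \<theta> = (\<Sum>u\<in>?V. w u * (q \<bullet> u - \<theta>))"
        by (simp add: w(3) inner_sum_right right_diff_distrib sum_subtractf w(2) flip: sum_distrib_right)
      also have "\<dots> = (\<Sum>u\<in>?V \<inter> E. w u * (q \<bullet> u - \<theta>)) + (\<Sum>u\<in>?V - E. w u * (q \<bullet> u - \<theta>))"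
        by (rule split)
      also have "\<dots> \<ge> (\<Sum>u\<in>?V \<inter> E. w u * m) + (\<Sum>u\<in>?V - E. w u * (- L))"
        using w(1) m(2) L(2) vE by (intro add_mono sum_mono mult_left_mono) force+
      also have "(\<Sum>u\<in>?V \<inter> E. w u * m) + (\<Sum>u\<in>?V - E. w u * (- L)) = m - (m + L) * ?o"
      proof -
        have "(\<Sum>u\<in>?V \<inter> E. w u * m) = (1 - ?o) * m"
          using in1 by (simp flip: sum_distrib_right)
        moreover have "(\<Sum>u\<in>?V - E. w u * (- L)) = ?o * (- L)"
          by (rule sum_distrib_right[symmetric])
        ultimately show ?thesis by (simp add: algebra_simps)
      qed
      finally have "m - (m + L) * ?o \<le> q \<bullet> y - \<theta>" .
      moreover have "c * ((m + L) * ?o) < c * m"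
      proof -
        have "c * ((m + L) * ?o) = (m + L) * (c * ?o)" by simp
        also have "\<dots> \<le> (m + L) * \<epsilon>" using o m L by (intro mult_left_mono) auto
        finally show ?thesis using e(3) by linarith
      qed
      then have "(m + L) * ?o < m" using c by simp
      ultimately show "\<theta> < q \<bullet> y" by linarith
    qed
  qed
qed

text \<open>Back substitution: equation \<open>i\<close> determines \<open>\<mu> (Suc i)\<close>
  once the later coefficients are known. Those are of order \<open>\<delta> (Suc i) / c\<close>, and
  the decay of \<delta> keeps their total contribution below half of \<open>d i\<close>; this is the
  origin of the 2 in the lower bound.\<close>

lemma triangular_system:
  fixes g :: "nat \<Rightarrow> nat \<Rightarrow> real"
  assumes c: "0 < c" and M: "0 < M" and g: "\<And>i j. i < j \<Longrightarrow> j \<le> n \<Longrightarrow> c \<le> g i j \<and> g i j \<le> M"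
    and \<delta>: "\<And>i. 0 < \<delta> i" "\<And>i. \<delta> (Suc i) \<le> \<delta> i" "\<And>i. 4 * real n * M * \<delta> (Suc i) \<le> c * \<delta> i"
    and d: "\<And>i. i < n \<Longrightarrow> \<delta> i \<le> d i \<and> d i \<le> 2 * \<delta> i"
  shows "\<exists>\<mu>. \<forall>i<n. (\<Sum>j\<in>{i<..n}. \<mu> j * g i j) = d i \<and> d i / (2 * M) \<le> \<mu> (Suc i) \<and> \<mu> (Suc i) \<le> d i / c"
proof -
  have dec: "\<delta> j \<le> \<delta> i" if "i \<le> j" for i j
    using \<delta>(2) that by (rule lift_Suc_antimono_le)
  \<comment> \<open>\<open>m\<close> counts the equations solved so far, starting from the last
    one.\<close>
  have "\<exists>\<mu>. \<forall>i<n. n - m \<le> i \<longrightarrow>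
      (\<Sum>j\<in>{i<..n}. \<mu> j * g i j) = d i \<and> d i / (2 * M) \<le> \<mu> (Suc i) \<and> \<mu> (Suc i) \<le> d i / c" for m
  proof (induction m)
    case 0
    then show ?case by auto
  next
    case (Suc m)
    then obtain \<mu> where \<mu>: "\<And>i. i < n \<Longrightarrow> n - m \<le> i \<Longrightarrow>
      (\<Sum>j\<in>{i<..n}. \<mu> j * g i j) = d i \<and> d i / (2 * M) \<le> \<mu> (Suc i) \<and> \<mu> (Suc i) \<le> d i / c"
      by blast
    show ?case
    proof (cases "m < n")
      case False
      then show ?thesis using \<mu> by (intro exI[of _ \<mu>]) auto
    next
      case True
      define i0 where "i0 = n - Suc m"
      have i0: "i0 < n" "Suc i0 = n - m" using True by (auto simp: i0_def)
      let ?s = "\<Sum>j\<in>{Suc i0<..n}. \<mu> j * g i0 j"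
      have dpos: "0 < d i" if "i < n" for i using d[OF that] \<delta>(1)[of i] by linarith
      have trm: "0 \<le> \<mu> j * g i0 j \<and> \<mu> j * g i0 j \<le> 2 * \<delta> (Suc i0) / c * M" if j: "j \<in> {Suc i0<..n}" for j
      proof -
        obtain i where i: "j = Suc i" "Suc i0 \<le> i" "i < n" using j by (cases j) auto
        have mu: "d i / (2 * M) \<le> \<mu> j" "\<mu> j \<le> d i / c" using \<mu>[of i] i i0 by auto
        have "0 \<le> \<mu> j" using mu(1) dpos[OF i(3)] M by (smt (verit) divide_nonneg_pos)
        moreover have "\<mu> j \<le> 2 * \<delta> (Suc i0) / c"
        proof -
          have "d i \<le> 2 * \<delta> (Suc i0)" using d[OF i(3)] dec[OF i(2)] by linarith
          then show ?thesis using mu(2) c by (smt (verit) divide_right_mono)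
        qed
        moreover have "0 \<le> g i0 j" "g i0 j \<le> M" using g[of i0 j] j c by auto
        ultimately show ?thesis using mult_mono[of "\<mu> j" "2 * \<delta> (Suc i0) / c" "g i0 j" M] by simp
      qed
      have s0: "0 \<le> ?s" using trm by (intro sum_nonneg) auto
      have "?s \<le> (\<Sum>j\<in>{Suc i0<..n}. 2 * \<delta> (Suc i0) / c * M)"
        using trm by (intro sum_mono) auto
      also have "\<dots> = real (n - Suc i0) * (2 * \<delta> (Suc i0) / c * M)" by simp
      also have "\<dots> \<le> real n * (2 * \<delta> (Suc i0) / c * M)"
        using c M \<delta>(1)[of "Suc i0"] by (intro mult_right_mono) auto
      also have "\<dots> \<le> \<delta> i0 / 2"
        using \<delta>(3)[of i0] c by (simp add: field_simps)
      finally have s1: "?s \<le> d i0 / 2" using d[OF i0(1)] by linarith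
      define x where "x = (d i0 - ?s) / g i0 (Suc i0)"
      have gp: "0 < g i0 (Suc i0)" "c \<le> g i0 (Suc i0)" "g i0 (Suc i0) \<le> M"
        using g[of i0 "Suc i0"] i0 c by auto
      have "d i0 / 2 / M \<le> (d i0 - ?s) / g i0 (Suc i0)"
        using s1 gp dpos[OF i0(1)] by (intro frac_le) auto
      then have x1: "d i0 / (2 * M) \<le> x" by (simp add: x_def)
      have x2: "x \<le> d i0 / c"
        unfolding x_def using s0 gp dpos[OF i0(1)] c s1 by (intro frac_le) auto
      let ?\<mu> = "\<mu>(Suc i0 := x)"
      show ?thesis
      proof (intro exI[of _ ?\<mu>] allI impI)
        fix i assume i: "i < n" "n - Suc m \<le> i"
        show "(\<Sum>j\<in>{i<..n}. ?\<mu> j * g i j) = d i \<and> d i / (2 * M) \<le> ?\<mu> (Suc i) \<and> ?\<mu> (Suc i) \<le> d i / c"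
        proof (cases "i = i0")
          case True
          have "{i0<..n} = insert (Suc i0) {Suc i0<..n}" using i0 by auto
          then have "(\<Sum>j\<in>{i0<..n}. ?\<mu> j * g i0 j) = x * g i0 (Suc i0) + (\<Sum>j\<in>{Suc i0<..n}. ?\<mu> j * g i0 j)"
            by simp
          also have "(\<Sum>j\<in>{Suc i0<..n}. ?\<mu> j * g i0 j) = ?s"
            by (intro sum.cong) auto
          also have "x * g i0 (Suc i0) + ?s = d i0"
            using gp by (simp add: x_def)
          finally show ?thesis using True x1 x2 by simp
        next
          case False
          then have "n - m \<le> i" using i i0 by (simp add: i0_def)
          moreover have "(\<Sum>j\<in>{i<..n}. ?\<mu> j * g i j) = (\<Sum>j\<in>{i<..n}. \<mu> j * g i j)"
            using \<open>n - m \<le> i\<close> i0 by (intro sum.cong) auto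
          ultimately show ?thesis using \<mu>[OF i(1)] False by simp
        qed
      qed
    qed
  qed
  from this[of n] show ?thesis by simp
qed

lemma flag_enumeration:
  assumes X: "polytope X" "aff_dim X = int n" and C: "C \<in> chains X"
  obtains e where "\<And>i. i < n \<Longrightarrow> e i \<in> proper_faces X" "e n = X" "C \<subseteq> e ` {..<n}"
    "\<And>i. i \<le> n \<Longrightarrow> aff_dim (e i) = int i" "\<And>i j. i \<le> j \<Longrightarrow> j \<le> n \<Longrightarrow> e i \<subseteq> e j"
proof -
  obtain D where D: "D \<in> chains X" "C \<subseteq> D" "aff_dim ` D = int ` {..<n}"
    using full_flag[OF assms] by metis
  have "\<exists>E\<in>D. aff_dim E = int i" if "i < n" for i
    using D(3) that by (metis (no_types, lifting) imageE imageI lessThan_iff)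
  then obtain f where f: "\<And>i. i < n \<Longrightarrow> f i \<in> D \<and> aff_dim (f i) = int i" by metis
  define e where "e = f(n := X)"
  have dim: "aff_dim (e i) = int i" if "i \<le> n" for i
    using f[of i] that X by (auto simp: e_def)
  have mem: "e i \<in> insert X D" if "i \<le> n" for i
    using f[of i] that by (auto simp: e_def)
  show ?thesis
  proof (rule that[of e])
    show "e i \<in> proper_faces X" if "i < n" for i
      using f[OF that] that D(1) by (auto simp: e_def chains_def)
    show "e n = X" by (simp add: e_def)
    show "C \<subseteq> e ` {..<n}"
    proof
      fix E assume "E \<in> C"
      then have E: "E \<in> D" using D by blast
      then obtain i where i: "i < n" "aff_dim E = int i" using D(3) by blast
      then have "f i = E"
        using f[OF i(1)] inj_onD[OF chain_dim_inj[OF X(1) D(1)], of "f i" E] E by simp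
      then show "E \<in> e ` {..<n}" using i by (auto simp: e_def)
    qed
    show "aff_dim (e i) = int i" if "i \<le> n" for i by (rule dim[OF that])
    show "e i \<subseteq> e j" if "i \<le> j" "j \<le> n" for i j
      using chain_nested[OF X(1) D(1), of "e i" "e j"] mem[of i] mem[of j] dim[of i] dim[of j] that by simp
  qed
qed

text \<open>
  Take a point \<open>z\<^sub>j\<close> in the relative interior of the \<open>j\<close>-th member of a full flag. At a
  combination of these points, prescribing the distances to the members of the flag is a
  triangular system for the coefficients; doubling the distance to the members outside \<open>C\<close>
  makes the cuts along \<open>C\<close> the only tight ones.
\<close>

lemma eventually_chain_point:
  assumes S: "polytope S" "aff_dim S = int n" and sup: "supports S \<alpha> \<beta>"
  shows "\<forall>\<^sub>F \<epsilon> in at_right 0. \<forall>C\<in>chains S. \<exists>y\<in>S.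
    (\<forall>E\<in>C. \<alpha> E \<bullet> y = \<beta> E - depth \<epsilon> k E) \<and> (\<forall>E\<in>proper_faces S - C. \<alpha> E \<bullet> y < \<beta> E - depth \<epsilon> k E)"
proof -
  have finF: "finite (insert S (proper_faces S))" using S by (simp add: finite_proper_faces)
  have "\<exists>z. z \<in> rel_interior G" if "G \<in> insert S (proper_faces S)" for G
  proof -
    have "convex G" "G \<noteq> {}"
      using that S polytope_imp_convex face_of_imp_convex by (auto simp: proper_faces_iff)
    then show ?thesis using rel_interior_eq_empty by blast
  qed
  then obtain z where z: "\<And>G. G \<in> insert S (proper_faces S) \<Longrightarrow> z G \<in> rel_interior G"
    by metis
  have sub: "G \<subseteq> S" if "G \<in> insert S (proper_faces S)" for G
    using that by (auto simp: proper_faces_iff dest: face_of_imp_subset)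
  have zG: "z G \<in> G" "z G \<in> S" if "G \<in> insert S (proper_faces S)" for G
    using z[OF that] sub[OF that] rel_interior_subset[of G] by blast+
  let ?A = "{(E, G). E \<in> proper_faces S \<and> G \<in> insert S (proper_faces S) \<and> \<not> G \<subseteq> E}"
  let ?f = "\<lambda>(E, G). \<beta> E - \<alpha> E \<bullet> z G"
  have finA: "finite ?A"
    by (rule finite_subset[OF _ finite_cartesian_product[OF finF finF]]) auto
  have pos: "0 < ?f x" if xA: "x \<in> ?A" for x
  proof -
    obtain E G where x: "x = (E, G)" "E \<in> proper_faces S" "G \<in> insert S (proper_faces S)" "\<not> G \<subseteq> E"
      using xA by auto
    have "G \<subseteq> S" using sub[OF x(3)] .
    then have "z G \<notin> E"
      using subset_of_face_of[of E S G] x z[OF x(3)] by (auto simp: proper_faces_iff)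
    then have "\<alpha> E \<bullet> z G \<noteq> \<beta> E" using supports_eq_iff[OF sup x(2)] zG x(3) by blast
    then show ?thesis using supports_le[OF sup x(2), of "z G"] zG x(3) x(1) by force
  qed
  obtain c where c: "0 < c" "\<And>x. x \<in> ?A \<Longrightarrow> c \<le> ?f x"
    using finite_pos_lower_bound[of ?A ?f, OF finA pos] by blast
  obtain M where M: "0 < M" "\<And>x. x \<in> ?A \<Longrightarrow> ?f x \<le> M"
    using finite_upper_bound[of ?A ?f, OF finA] by blast
  have cM: "c \<le> \<beta> E - \<alpha> E \<bullet> z G \<and> \<beta> E - \<alpha> E \<bullet> z G \<le> M"
    if "E \<in> proper_faces S" "G \<in> insert S (proper_faces S)" "\<not> G \<subseteq> E" for E G
    using c(2)[of "(E, G)"] M(2)[of "(E, G)"] that by auto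
  \<comment> \<open>After 1, which makes powers decrease, the bounds serve in turn: faces that miss
    the vertex of the flag; the decay in the triangular system; a total of at most one half for the
    \<mu>; and faces off the flag that contain one of its members. \<open>Suc n\<close> avoids a
    division by zero.\<close>
  have "0 < min (min 1 (c / 2)) (min (c / (4 * real (Suc n) * M)) (min (c / (4 * real (Suc n))) (c / (2 * M))))"
    using c(1) M(1) by simp
  from eventually_small[OF this] show ?thesis
  proof eventually_elim
    case (elim \<epsilon>)
    then have e: "0 < \<epsilon>" "\<epsilon> < 1" "2 * \<epsilon> < c" "2 * M * \<epsilon> < c" by (auto simp: field_simps M(1))
    have e5: "4 * real n * M * \<epsilon> \<le> c" "4 * real n * \<epsilon> \<le> c"
    proof -
      have "4 * real (Suc n) * M * \<epsilon> < c" "4 * real (Suc n) * \<epsilon> < c"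
        using elim M(1) by (auto simp: pos_less_divide_eq mult.commute)
      moreover have "4 * real n * M * \<epsilon> \<le> 4 * real (Suc n) * M * \<epsilon>" "4 * real n * \<epsilon> \<le> 4 * real (Suc n) * \<epsilon>"
        using e(1) M(1) by (intro mult_right_mono; simp)+
      ultimately show "4 * real n * M * \<epsilon> \<le> c" "4 * real n * \<epsilon> \<le> c" by linarith+
    qed
    show ?case
    proof
      fix C assume C: "C \<in> chains S"
      obtain e where e_prop: "\<And>i. i < n \<Longrightarrow> e i \<in> proper_faces S" and en: "e n = S"
        and Ce: "C \<subseteq> e ` {..<n}" and edim: "\<And>i. i \<le> n \<Longrightarrow> aff_dim (e i) = int i"
        and emono: "\<And>i j. i \<le> j \<Longrightarrow> j \<le> n \<Longrightarrow> e i \<subseteq> e j"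
        using flag_enumeration[OF S C] by metis
      have e_mem: "e i \<in> insert S (proper_faces S)" if "i \<le> n" for i
        using e_prop[of i] en that by (cases "i = n") auto
      have not_sub: "\<not> e j \<subseteq> e i" if "i < j" "j \<le> n" for i j
        using aff_dim_subset[of "e j" "e i"] edim[of i] edim[of j] that by auto
      define g where "g i j = \<beta> (e i) - \<alpha> (e i) \<bullet> z (e j)" for i j
      define \<delta> where "\<delta> i = \<epsilon> ^ (i + 1 + k)" for i
      define d where "d i = (if e i \<in> C then \<delta> i else 2 * \<delta> i)" for i
      have dep: "depth \<epsilon> k (e i) = \<delta> i" if "i \<le> n" for i
        using edim[OF that] by (simp add: depth_def \<delta>_def)
      have \<delta>: "0 < \<delta> i" "\<delta> (Suc i) = \<epsilon> * \<delta> i" for i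
        using e(1) by (auto simp: \<delta>_def)
      have \<delta>1: "\<delta> (Suc i) \<le> \<delta> i" for i
        using \<delta>[of i] e by (simp add: mult_left_le_one_le)
      have \<delta>2: "4 * real n * M * \<delta> (Suc i) \<le> c * \<delta> i" for i
        using mult_right_mono[OF e5(1), of "\<delta> i"] \<delta>[of i] by (simp add: mult.assoc)
      have dd: "\<delta> i \<le> d i \<and> d i \<le> 2 * \<delta> i" for i
        using \<delta>(1)[of i] by (auto simp: d_def)
      obtain \<mu> where \<mu>: "\<And>i. i < n \<Longrightarrow> (\<Sum>j\<in>{i<..n}. \<mu> j * g i j) = d i \<and>
          d i / (2 * M) \<le> \<mu> (Suc i) \<and> \<mu> (Suc i) \<le> d i / c"
      proof -
        have "c \<le> g i j \<and> g i j \<le> M" if "i < j" "j \<le> n" for i j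
          using cM[of "e i" "e j"] that e_prop[of i] e_mem[of j] not_sub[OF that] by (simp add: g_def)
        then show ?thesis
          using triangular_system[of c M n g \<delta> d] c(1) M(1) \<delta> \<delta>1 \<delta>2 dd that by blast
      qed
      have \<mu>0: "0 \<le> \<mu> (Suc i) \<and> \<mu> (Suc i) \<le> 2 * \<epsilon> / c" if "i < n" for i
      proof
        have "0 \<le> d i / (2 * M)" using dd[of i] \<delta>(1)[of i] M(1) by auto
        then show "0 \<le> \<mu> (Suc i)" using \<mu>[OF that] by linarith
        have "\<delta> i \<le> \<epsilon>"
          using power_decreasing[of 1 "i + 1 + k" \<epsilon>] e by (simp add: \<delta>_def)
        then have "d i / c \<le> 2 * \<epsilon> / c" using dd[of i] c(1) by (intro divide_right_mono) auto
        then show "\<mu> (Suc i) \<le> 2 * \<epsilon> / c" using \<mu>[OF that] by linarith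
      qed
      \<comment> \<open>The vertex \<open>e 0\<close> lies in every proper member of the flag and
        adds no slack there, so its weight is free to absorb the remaining mass.\<close>
      define l where "l j = (if j = 0 then 1 - (\<Sum>j\<in>{0<..n}. \<mu> j) else \<mu> j)" for j
      have "(\<Sum>j\<in>{0<..n}. \<mu> j) \<le> (\<Sum>j\<in>{0<..n}. 2 * \<epsilon> / c)"
      proof (rule sum_mono)
        fix j assume "j \<in> {0<..n}"
        then show "\<mu> j \<le> 2 * \<epsilon> / c" using \<mu>0[of "j - 1"] by auto
      qed
      also have "\<dots> = real n * (2 * \<epsilon> / c)" by simp
      also have "\<dots> \<le> 1 / 2" using e5(2) c(1) by (simp add: field_simps)
      finally have l0: "1 / 2 \<le> l 0" by (simp add: l_def)
      have l_nonneg: "0 \<le> l j" if "j \<le> n" for j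
        using l0 \<mu>0[of "j - 1"] that by (cases j) (auto simp: l_def)
      have split0: "{..n} = insert 0 {0<..n}" by auto
      have lsum: "(\<Sum>j\<le>n. l j) = 1"
      proof -
        have "(\<Sum>j\<in>{0<..n}. l j) = (\<Sum>j\<in>{0<..n}. \<mu> j)" by (intro sum.cong) (auto simp: l_def)
        then show ?thesis unfolding split0 by (simp add: l_def)
      qed
      define y where "y = (\<Sum>j\<le>n. l j *\<^sub>R z (e j))"
      have yS: "y \<in> S"
        unfolding y_def using l_nonneg lsum zG(2) e_mem
        by (intro convex_sum) (auto simp: polytope_imp_convex S)
      have slack: "\<beta> E - \<alpha> E \<bullet> y = (\<Sum>j\<le>n. l j * (\<beta> E - \<alpha> E \<bullet> z (e j)))" for E
        by (simp add: y_def inner_sum_right right_diff_distrib sum_subtractf lsum flip: sum_distrib_right)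
      have flag: "\<beta> (e i) - \<alpha> (e i) \<bullet> y = d i" if i: "i < n" for i
      proof -
        have "\<beta> (e i) - \<alpha> (e i) \<bullet> z (e j) = 0" if "j \<le> i" for j
          using supports_eq_iff[OF sup e_prop[OF i], of "z (e j)"] zG e_mem[of j] emono[of j i] that i by force
        then have "\<beta> (e i) - \<alpha> (e i) \<bullet> y = (\<Sum>j\<in>{i<..n}. l j * g i j)"
          unfolding slack g_def by (intro sum.mono_neutral_right) auto
        also have "\<dots> = (\<Sum>j\<in>{i<..n}. \<mu> j * g i j)"
          by (intro sum.cong) (auto simp: l_def)
        finally show ?thesis using \<mu>[OF i] by simp
      qed
      have off: "depth \<epsilon> k F < \<beta> F - \<alpha> F \<bullet> y" if F: "F \<in> proper_faces S" "F \<notin> e ` {..<n}" for F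
      proof -
        \<comment> \<open>\<open>e j\<close> is the first member not inside \<open>F\<close>. For
          \<open>j > 0\<close> the cut of \<open>F\<close> is shallower by a factor \<epsilon> than
          that of \<open>e (j - 1)\<close>, while the weight of \<open>e j\<close> alone already
          produces a slack of the latter order.\<close>
        define j where "j = (LEAST j. \<not> e j \<subseteq> F)"
        have Fn: "\<not> e n \<subseteq> F" using F(1) en sub[of F] by (auto simp: proper_faces_iff)
        have j: "\<not> e j \<subseteq> F" "j \<le> n" unfolding j_def using Fn by (rule LeastI, rule Least_le)
        have below: "e i \<subseteq> F" if "i < j" for i using not_less_Least[of i] that unfolding j_def by blast
        have "l j * c \<le> l j * (\<beta> F - \<alpha> F \<bullet> z (e j))"
          using cM[OF F(1) e_mem[OF j(2)] j(1)] l_nonneg[OF j(2)] by (intro mult_left_mono) auto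
        also have "\<dots> \<le> (\<Sum>j\<le>n. l j * (\<beta> F - \<alpha> F \<bullet> z (e j)))"
          using j(2) l_nonneg supports_le[OF sup F(1)] zG(2) e_mem
          by (intro member_le_sum mult_nonneg_nonneg) auto
        finally have ge: "l j * c \<le> \<beta> F - \<alpha> F \<bullet> y" by (simp add: slack)
        show ?thesis
        proof (cases j)
          case 0
          then have "c / 2 \<le> l j * c" using l0 c(1) mult_right_mono[of "1/2" "l 0" c] by simp
          then show ?thesis using ge depth_le[OF e(1,2), of k F] e(3) by linarith
        next
          case (Suc i)
          then have i: "i < n" "e i \<subseteq> F" "e i \<noteq> F" using j below[of i] F(2) by auto
          have "e i face_of F"
            using i(2) e_prop[OF i(1)] F(1) face_of_face by (auto simp: proper_faces_iff)
          moreover have "convex F" using F(1) face_of_imp_convex by (auto simp: proper_faces_iff)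
          ultimately have "aff_dim (e i) < aff_dim F" using face_of_aff_dim_lt i(3) by blast
          then have "depth \<epsilon> k F \<le> \<epsilon> * \<delta> i"
            using depth_le_step[OF e(1,2), of "e i" F k] edim[of i] dep[of i] i(1) by simp
          also have "\<dots> < c * (\<delta> i / (2 * M))"
            using mult_strict_right_mono[OF e(4) \<delta>(1)[of i]] M(1) by (simp add: field_simps)
          also have "\<dots> \<le> l j * c"
          proof -
            have "\<delta> i / (2 * M) \<le> d i / (2 * M)" using dd[of i] M(1) by (intro divide_right_mono) auto
            then have "\<delta> i / (2 * M) \<le> l j" using \<mu>[OF i(1)] Suc by (simp add: l_def)
            then show ?thesis using c(1) mult_left_mono[of "\<delta> i / (2 * M)" "l j" c] by (simp add: mult.commute)
          qed
          finally show ?thesis using ge by linarith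
        qed
      qed
      show "\<exists>y\<in>S. (\<forall>E\<in>C. \<alpha> E \<bullet> y = \<beta> E - depth \<epsilon> k E) \<and>
        (\<forall>E\<in>proper_faces S - C. \<alpha> E \<bullet> y < \<beta> E - depth \<epsilon> k E)"
      proof (intro bexI[of _ y] conjI ballI yS)
        fix E assume E: "E \<in> C"
        then obtain i where i: "i < n" "E = e i" using Ce by blast
        then show "\<alpha> E \<bullet> y = \<beta> E - depth \<epsilon> k E"
          using flag[OF i(1)] dep[of i] E by (simp add: d_def)
      next
        fix E assume E: "E \<in> proper_faces S - C"
        show "\<alpha> E \<bullet> y < \<beta> E - depth \<epsilon> k E"
        proof (cases "E \<in> e ` {..<n}")
          case True
          then obtain i where i: "i < n" "E = e i" by blast
          then show ?thesis using flag[OF i(1)] dep[of i] E \<delta>(1)[of i] by (simp add: d_def)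
        next
          case False
          then show ?thesis using off[of E] E by simp
        qed
      qed
    qed
  qed
qed

subsection \<open>The face lattice of the truncation\<close>

lemma chain_proper: "C \<in> chains X \<Longrightarrow> C \<subseteq> proper_faces X"
  by (simp add: chains_def)

lemma proper_face_dim_0:
  assumes "E \<in> proper_faces X" "aff_dim E = 0"
  obtains v where "E = {v}" "v \<in> vertices X"
proof -
  obtain v where v: "E = {v}" using assms(2) aff_dim_eq_0[of E] by blast
  then have "v \<in> vertices X" using assms(1) by (simp add: proper_faces_iff singleton_face_iff)
  with v show ?thesis by (rule that)
qed

lemma vertex_proper_face:
  assumes "v \<in> vertices X" "aff_dim X \<noteq> 0"
  shows "{v} \<in> proper_faces X"
proof -
  have "{v} \<noteq> X" using assms(2) by force
  then show ?thesis using assms(1) by (simp add: proper_faces_iff singleton_face_iff)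
qed

text \<open>The smallest member of the chain; intersecting with \<open>X\<close> makes it
  \<open>X\<close> itself for the empty chain. Its vertices are the vertices of \<open>X\<close>
  that may be inserted into the chain.\<close>

definition base :: "'a set \<Rightarrow> 'a set set \<Rightarrow> 'a set" where
  "base X C = X \<inter> \<Inter>C"

lemma base_mem:
  assumes "polytope X" "C \<in> chains X"
  shows "base X C \<in> insert X C"
proof (cases "C = {}")
  case False
  then obtain E where E: "E \<in> C" "\<And>F. F \<in> C \<Longrightarrow> aff_dim E \<le> aff_dim F"
    using finite_arg_min[OF finite_chain[OF assms]] by metis
  have "E \<subseteq> F" if "F \<in> C" for F
    using chain_nested[OF assms, of E F] E that by simp
  moreover have "E \<subseteq> X"
    using subsetD[OF chain_proper[OF assms(2)] E(1)] face_of_imp_subset[of E X] by (auto simp: proper_faces_iff)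
  ultimately have "base X C = E" using E(1) by (auto simp: base_def)
  then show ?thesis using E by simp
qed (simp add: base_def)

lemma chain_face:
  assumes "polytope X" "C \<in> chains X" "E \<in> insert X C"
  shows "E face_of X"
proof (cases "E = X")
  case True
  then show ?thesis using assms(1) by (simp add: face_of_refl polytope_imp_convex)
next
  case False
  then have "E \<in> proper_faces X" using assms(2,3) chain_proper by blast
  then show ?thesis by (simp add: proper_faces_iff)
qed

lemma base_face: "polytope X \<Longrightarrow> C \<in> chains X \<Longrightarrow> base X C face_of X"
  by (rule chain_face[OF _ _ base_mem])

lemma base_polytope: "polytope X \<Longrightarrow> C \<in> chains X \<Longrightarrow> polytope (base X C)"
  by (rule face_of_polytope_polytope[OF _ base_face])

lemma base_nonempty:
  assumes "polytope X" "X \<noteq> {}" "C \<in> chains X"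
  shows "base X C \<noteq> {}"
  using base_mem[OF assms(1,3)] assms(2) chain_proper[OF assms(3)] by (auto simp: proper_faces_iff)

lemma insert_vertex_chain:
  assumes "polytope X" "C \<in> chains X" "v \<in> vertices X" "v \<in> base X C" "aff_dim X \<noteq> 0"
  shows "insert {v} C \<in> chains X"
  using assms(2,4) vertex_proper_face[OF assms(3,5)] unfolding chains_def base_def by auto

lemma vertex_in_base:
  assumes "polytope X" "C \<in> chains X" "{v} \<in> C"
  shows "v \<in> base X C" "v \<in> vertices X"
proof -
  have v: "{v} \<in> proper_faces X" using assms by (auto simp: chains_def)
  then show "v \<in> vertices X" by (simp add: proper_faces_iff singleton_face_iff)
  have "{v} \<subseteq> E" if E: "E \<in> insert X C" for E
    using chain_nested[OF assms(1,2), of "{v}" E] assms E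
      proper_face_aff_dim(1)[OF assms(1), of E] proper_face_aff_dim[OF assms(1) v]
    by (auto simp: chains_def)
  then show "v \<in> base X C" by (auto simp: base_def)
qed

text \<open>The dimensions of the members are distinct and below \<open>n\<close>, so
  \<open>n\<close> members use all of them, in particular 0.\<close>

lemma full_chain_vertex:
  assumes X: "polytope X" "aff_dim X = int n" and C: "C \<in> chains X" "card C = n" and n: "0 < n"
  obtains v where "{v} \<in> C"
proof -
  have sub: "aff_dim ` C \<subseteq> int ` {..<n}"
  proof
    fix z assume "z \<in> aff_dim ` C"
    then have "0 \<le> z" "z < int n"
      using proper_face_aff_dim[OF X(1)] C(1) X(2) by (auto simp: chains_def)
    then show "z \<in> int ` {..<n}" by (intro image_eqI[of _ _ "nat z"]) auto
  qed
  have "card (aff_dim ` C) = card (int ` {..<n})"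
    using chain_dim_inj[OF X(1) C(1)] C(2) by (simp add: card_image)
  then have "aff_dim ` C = int ` {..<n}"
    using card_subset_eq[OF _ sub] by simp
  then have "0 \<in> aff_dim ` C" using n by force
  then obtain E where "E \<in> C" "aff_dim E = 0" by force
  then show ?thesis
    using proper_face_dim_0[of E X] C(1) that by (auto simp: chains_def)
qed

context swept_truncation
begin

text \<open>The last two conditions carry the combinatorics: they make the sets of cuts that are
  tight together exactly the chains. Disjointness from the proper faces puts \<open>T X\<close> into
  the relative interior of \<open>X\<close>, so that the facets of \<open>X\<close> contribute no
  faces of their own.\<close>

definition simple_truncation :: "nat \<Rightarrow> 'a set \<Rightarrow> bool" where
  "simple_truncation n X \<longleftrightarrow> polytope X \<and> aff_dim X = int n \<and>
     T X = X \<inter> (\<Inter>E\<in>proper_faces X. cut_halfspace E) \<and>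
     (\<forall>E\<in>proper_faces X. T X \<inter> E = {}) \<and>
     (\<forall>E\<in>proper_faces X. \<forall>F\<in>proper_faces X.
        T X \<inter> cut_hyperplane E \<inter> cut_hyperplane F \<noteq> {} \<longrightarrow> E \<subseteq> F \<or> F \<subseteq> E) \<and>
     (\<forall>C\<in>chains X. \<exists>y\<in>T X. \<forall>E\<in>proper_faces X. y \<in> cut_hyperplane E \<longleftrightarrow> E \<in> C)"

definition tface :: "'a set \<Rightarrow> 'a set set \<Rightarrow> 'a set" where
  "tface X C = T X \<inter> (\<Inter>E\<in>C. cut_hyperplane E)"

definition ordered_near_vertices :: "'a \<Rightarrow> 'a set \<Rightarrow> bool" where
  "ordered_near_vertices q X \<longleftrightarrow> (\<forall>u\<in>vertices X. \<forall>v\<in>vertices X. q \<bullet> u < q \<bullet> v \<longrightarrow>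
     (\<forall>y\<in>tface X {{u}}. \<forall>z\<in>tface X {{v}}. q \<bullet> y < q \<bullet> z))"

text \<open>Used for \<open>q\<close> and for \<open>- q\<close>, this transfers the position of a
  face of \<open>X\<close> relative to a level to the faces of \<open>T X\<close> near it.
  \<open>X\<close> itself has no cut, hence the disjunct \<open>E = X\<close>.\<close>

definition above_near_faces :: "'a \<Rightarrow> real \<Rightarrow> 'a set \<Rightarrow> bool" where
  "above_near_faces q \<theta> X \<longleftrightarrow> (\<forall>E\<in>insert X (proper_faces X). (\<forall>u\<in>vertices E. \<theta> < q \<bullet> u) \<longrightarrow>
     (\<forall>y\<in>T X. E = X \<or> y \<in> cut_hyperplane E \<longrightarrow> \<theta> < q \<bullet> y))"

lemma T_subset: "T X \<subseteq> X"
  by (auto simp: T_def)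

lemma tface_empty [simp]: "tface X {} = T X"
  by (simp add: tface_def)

lemma tface_antimono: "D \<subseteq> C \<Longrightarrow> tface X C \<subseteq> tface X D"
  by (auto simp: tface_def)

context
  fixes n :: nat and X :: "'a set"
  assumes st: "simple_truncation n X"
begin

lemma st_polytope: "polytope X"
  using st unfolding simple_truncation_def by (elim conjE)

lemma st_dim: "aff_dim X = int n"
  using st unfolding simple_truncation_def by (elim conjE)

lemma st_T: "T X = X \<inter> (\<Inter>E\<in>proper_faces X. cut_halfspace E)"
  using st unfolding simple_truncation_def by (elim conjE)

lemma st_disjoint:
  assumes "E \<in> proper_faces X"
  shows "T X \<inter> E = {}"
proof -
  have "\<forall>E\<in>proper_faces X. T X \<inter> E = {}"
    using st unfolding simple_truncation_def by (elim conjE)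
  then show ?thesis using assms by (rule bspec)
qed

lemma st_nested:
  assumes "E \<in> proper_faces X" "F \<in> proper_faces X"
    and "y \<in> T X" "y \<in> cut_hyperplane E" "y \<in> cut_hyperplane F"
  shows "E \<subseteq> F \<or> F \<subseteq> E"
proof -
  have "T X \<inter> cut_hyperplane E \<inter> cut_hyperplane F \<noteq> {}" using assms by blast
  moreover have "\<forall>E\<in>proper_faces X. \<forall>F\<in>proper_faces X.
      T X \<inter> cut_hyperplane E \<inter> cut_hyperplane F \<noteq> {} \<longrightarrow> E \<subseteq> F \<or> F \<subseteq> E"
    using st unfolding simple_truncation_def by (elim conjE)
  ultimately show ?thesis using assms(1,2) by meson
qed

lemma st_point:
  assumes "C \<in> chains X"
  shows "\<exists>y\<in>T X. \<forall>E\<in>proper_faces X. y \<in> cut_hyperplane E \<longleftrightarrow> E \<in> C"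
proof -
  have "\<forall>C\<in>chains X. \<exists>y\<in>T X. \<forall>E\<in>proper_faces X. y \<in> cut_hyperplane E \<longleftrightarrow> E \<in> C"
    using st unfolding simple_truncation_def by (elim conjE)
  then show ?thesis using assms by (rule bspec)
qed

lemma st_nonempty: "X \<noteq> {}"
  using st_dim by auto

lemma T_polytope: "polytope (T X)"
proof -
  have "polyhedron (\<Inter>E\<in>proper_faces X. cut_halfspace E)"
    using finite_proper_faces[OF st_polytope]
    by (intro polyhedron_Inter) (auto simp: cut_halfspace_def polyhedron_halfspace_le)
  then show ?thesis
    unfolding st_T using st_polytope by (rule polytope_Int_polyhedron[rotated])
qed

lemma T_convex: "convex (T X)"
  using T_polytope polytope_imp_convex by blast

lemma tface_face:
  assumes "C \<subseteq> proper_faces X"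
  shows "tface X C face_of T X"
proof (cases "C = {}")
  case True
  then show ?thesis using T_convex by (simp add: face_of_refl)
next
  case False
  have "T X \<inter> cut_hyperplane E face_of T X" if "E \<in> C" for E
    unfolding cut_hyperplane_def
    using that assms st_T by (intro face_of_Int_supporting_hyperplane_le T_convex) (auto simp: cut_halfspace_def)
  then have "\<Inter>((\<lambda>E. T X \<inter> cut_hyperplane E) ` C) face_of T X"
    using False by (intro face_of_Inter) auto
  moreover have "\<Inter>((\<lambda>E. T X \<inter> cut_hyperplane E) ` C) = tface X C"
    using False by (auto simp: tface_def)
  ultimately show ?thesis by simp
qed

lemma chain_tface_point:
  assumes "C \<in> chains X"
  shows "\<exists>y\<in>tface X C. \<forall>E\<in>proper_faces X. y \<in> cut_hyperplane E \<longleftrightarrow> E \<in> C"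
proof -
  obtain y where y: "y \<in> T X" "\<And>E. E \<in> proper_faces X \<Longrightarrow> y \<in> cut_hyperplane E \<longleftrightarrow> E \<in> C"
    using st_point[OF assms] by blast
  have "y \<in> cut_hyperplane E" if "E \<in> C" for E
    using y(2)[of E] chain_proper[OF assms] that by blast
  then have "y \<in> tface X C"
    using y(1) by (simp add: tface_def)
  then show ?thesis using y(2) by blast
qed

lemma chain_tface_nonempty:
  assumes "C \<in> chains X"
  obtains y where "y \<in> tface X C"
proof -
  obtain y where "y \<in> tface X C" using chain_tface_point[OF assms] by (rule bexE)
  then show ?thesis by (rule that)
qed

lemma tface_faces:
  assumes "C \<in> chains X"
  shows "tface X C \<in> faces (T X)"
proof -
  obtain y where "y \<in> tface X C" using chain_tface_nonempty[OF assms] .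
  then show ?thesis using tface_face[OF chain_proper[OF assms]] by (auto simp: faces_iff)
qed

lemma tface_chain:
  assumes "C \<subseteq> proper_faces X" "tface X C \<noteq> {}"
  shows "C \<in> chains X"
proof -
  obtain y where y: "y \<in> tface X C" using assms(2) by blast
  have "E \<subseteq> F \<or> F \<subseteq> E" if "E \<in> C" "F \<in> C" for E F
    using st_nested[of E F y] y that assms(1) unfolding tface_def by blast
  then show ?thesis using assms(1) unfolding chains_def by blast
qed

lemma tface_subset_iff:
  assumes "C \<in> chains X" "D \<in> chains X"
  shows "tface X C \<subseteq> tface X D \<longleftrightarrow> D \<subseteq> C"
proof
  assume sub: "tface X C \<subseteq> tface X D"
  obtain y where y: "y \<in> tface X C" "\<And>E. E \<in> proper_faces X \<Longrightarrow> y \<in> cut_hyperplane E \<longleftrightarrow> E \<in> C"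
    using chain_tface_point[OF assms(1)] by (rule bexE) blast
  then have "y \<in> cut_hyperplane E" if "E \<in> D" for E
    using sub that unfolding tface_def by blast
  then show "D \<subseteq> C" using y(2) assms(2) unfolding chains_def by blast
qed (rule tface_antimono)

lemma tface_eq_iff:
  assumes "C \<in> chains X" "D \<in> chains X"
  shows "tface X C = tface X D \<longleftrightarrow> C = D"
  unfolding set_eq_subset[of "tface X C"] set_eq_subset[of C]
    tface_subset_iff[OF assms] tface_subset_iff[OF assms(2,1)] by (rule conj_commute)

lemma T_rel_interior: "T X \<subseteq> rel_interior X"
proof
  fix x assume x: "x \<in> T X"
  show "x \<in> rel_interior X"
  proof (rule ccontr)
    assume "x \<notin> rel_interior X"
    then have "x \<in> \<Union>{F. F facet_of X}"
      using x T_subset rel_boundary_of_polyhedron[OF polytope_imp_polyhedron[OF st_polytope]] by blast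
    then obtain F where F: "F facet_of X" "x \<in> F" by blast
    then have "F \<in> proper_faces X" by (auto simp: facet_of_def proper_faces_iff)
    then show False using st_disjoint F(2) x by blast
  qed
qed

text \<open>Let \<open>C\<close> consist of the cuts tight at a relative interior point
  \<open>x\<close> of the face. Moving on from \<open>x\<close> away from a point \<open>y\<close>
  of \<open>tface X C\<close> keeps tight cuts tight, keeps slack ones slack for a while, and stays
  in \<open>X\<close> because \<open>T X\<close> lies in its relative interior. So \<open>x\<close>
  is an inner point of a segment in \<open>T X\<close> that starts at \<open>y\<close>.\<close>

lemma faces_T:
  assumes "G \<in> faces (T X)"
  obtains C where "C \<in> chains X" "G = tface X C"
proof -
  have G: "G face_of T X" "G \<noteq> {}" using assms by (auto simp: faces_iff)
  have "convex G" using G face_of_imp_convex by blast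
  then obtain x where x: "x \<in> rel_interior G" using G(2) rel_interior_eq_empty by blast
  then have xG: "x \<in> G" and xT: "x \<in> T X"
    using rel_interior_subset[of G] face_of_imp_subset[OF G(1)] by auto
  define C where "C = {E \<in> proper_faces X. x \<in> cut_hyperplane E}"
  have Cp: "C \<subseteq> proper_faces X" by (auto simp: C_def)
  have xC: "x \<in> tface X C" using xT by (auto simp: tface_def C_def)
  have C: "C \<in> chains X" using tface_chain[OF Cp] xC by blast
  have "G \<subseteq> tface X C"
    using subset_of_face_of[OF tface_face[OF Cp], of G] face_of_imp_subset[OF G(1)] xC x by blast
  moreover have "tface X C \<subseteq> G"
  proof
    fix y assume y: "y \<in> tface X C"
    show "y \<in> G"
    proof (cases "y = x")
      case True
      then show ?thesis using xG by simp
    next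
      case False
      let ?z = "\<lambda>t. x + t *\<^sub>R (x - y)"
      have yX: "y \<in> X" "y \<in> T X" using y T_subset by (auto simp: tface_def)
      have xr: "x \<in> rel_interior X" "x \<in> X" using xT T_rel_interior T_subset by auto
      obtain e where e: "e > 1" "(1 - e) *\<^sub>R y + e *\<^sub>R x \<in> X"
        using xr(1) convex_rel_interior_iff[of X x] polytope_imp_convex[OF st_polytope] st_nonempty yX by auto
      have inX: "?z t \<in> X" if "0 < t" "t < e - 1" for t
      proof -
        have "?z t = (1 - t / (e - 1)) *\<^sub>R x + (t / (e - 1)) *\<^sub>R ((1 - e) *\<^sub>R y + e *\<^sub>R x)"
        proof -
          have "(1 - e) *\<^sub>R y + e *\<^sub>R x = x + (e - 1) *\<^sub>R (x - y)" by (simp add: algebra_simps)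
          moreover have "(1 - s) *\<^sub>R x + s *\<^sub>R (x + r *\<^sub>R d) = x + (s * r) *\<^sub>R d" for s r and d :: 'a
            by (simp add: algebra_simps)
          ultimately show ?thesis using e by simp
        qed
        moreover have "0 \<le> t / (e - 1)" "t / (e - 1) \<le> 1" using that by (auto simp: field_simps)
        ultimately show ?thesis
          using convexD_alt[OF polytope_imp_convex[OF st_polytope] xr(2) e(2)] by simp
      qed
      have "\<forall>\<^sub>F t in at_right 0. ?z t \<in> cut_halfspace F" if F: "F \<in> proper_faces X" for F
      proof (cases "F \<in> C")
        case True
        then have "x \<in> cut_hyperplane F" "y \<in> cut_hyperplane F"
          using xC y by (auto simp: tface_def)
        then have "?z t \<in> cut_halfspace F" for t
          by (simp add: cut_hyperplane_def cut_halfspace_def inner_add_right inner_diff_right)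
        then show ?thesis by simp
      next
        case False
        let ?a = "a (carrier_face F)" and ?c = "cut_offset (carrier_face F)"
        have "?a \<bullet> x \<noteq> ?c" using False F by (auto simp: C_def cut_hyperplane_def)
        moreover have "?a \<bullet> x \<le> ?c" using xT F st_T by (auto simp: cut_halfspace_def)
        ultimately have "?a \<bullet> x < ?c" by simp
        moreover have "((\<lambda>t. ?a \<bullet> ?z t) \<longlongrightarrow> ?a \<bullet> (x + 0 *\<^sub>R (x - y))) (at_right 0)"
          by (intro tendsto_intros)
        ultimately have "\<forall>\<^sub>F t in at_right 0. ?a \<bullet> ?z t < ?c"
          by (intro order_tendstoD(2)) auto
        then show ?thesis by eventually_elim (simp add: cut_halfspace_def)
      qed
      then have "\<forall>\<^sub>F t in at_right 0. \<forall>F\<in>proper_faces X. ?z t \<in> cut_halfspace F"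
        using finite_proper_faces[OF st_polytope] by (simp add: eventually_ball_finite)
      moreover have "\<forall>\<^sub>F t in at_right (0::real). 0 < t \<and> t < e - 1"
        using eventually_small[of "e - 1"] e by simp
      ultimately have "\<forall>\<^sub>F t in at_right (0::real). 0 < t \<and> ?z t \<in> T X"
        by eventually_elim (use inX in \<open>auto simp: st_T\<close>)
      then obtain t where t: "0 < t" "?z t \<in> T X"
        using eventually_happens'[of "at_right (0::real)"] by (metis (no_types, lifting) trivial_limit_at_right_real)
      have "x = (1 - 1 / (1 + t)) *\<^sub>R y + (1 / (1 + t)) *\<^sub>R ?z t"
      proof -
        have "(1 + t) *\<^sub>R x = t *\<^sub>R y + ?z t" by (simp add: algebra_simps)
        then have "(1 / (1 + t)) *\<^sub>R ((1 + t) *\<^sub>R x) = (1 / (1 + t)) *\<^sub>R (t *\<^sub>R y + ?z t)" by simp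
        moreover have "1 - 1 / (1 + t) = t / (1 + t)" using t by (simp add: field_simps)
        ultimately show ?thesis using t by (simp add: scaleR_add_right)
      qed
      moreover have "y \<noteq> ?z t"
      proof
        assume "y = ?z t"
        then have "(1 + t) *\<^sub>R (x - y) = 0" by (simp add: algebra_simps)
        then show False using t False by simp
      qed
      moreover have "0 < 1 / (1 + t)" "1 / (1 + t) < 1" using t by auto
      ultimately have "x \<in> open_segment y (?z t)" unfolding in_segment by blast
      then show ?thesis using G(1) xG yX t(2) unfolding face_of_def by blast
    qed
  qed
  ultimately show ?thesis using that C by blast
qed

text \<open>Extend \<open>C\<close> to a full flag of \<open>n\<close> members. Imposing their cuts
  one by one lowers the dimension strictly, from at most \<open>n\<close> to at least 0 in
  \<open>n\<close> steps, so every step lowers it by exactly one.\<close>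

lemma tface_aff_dim:
  assumes C: "C \<in> chains X"
  shows "aff_dim (tface X C) = int n - int (card C)"
proof -
  obtain D where D: "D \<in> chains X" "C \<subseteq> D" "card D = n"
    using full_flag[OF st_polytope st_dim C] by metis
  have finD: "finite D" using finite_chain[OF st_polytope D(1)] .
  have lt: "aff_dim (tface X (insert E B)) < aff_dim (tface X B)"
    if "insert E B \<subseteq> D" "E \<notin> B" for E B
  proof -
    have ch: "insert E B \<in> chains X" "B \<in> chains X"
      using chains_subset[OF D(1)] that by auto
    have "tface X (insert E B) face_of tface X B"
      using face_of_face[OF tface_face[OF chain_proper[OF ch(2)]]] tface_face[OF chain_proper[OF ch(1)]]
        tface_antimono[of B "insert E B"] by blast
    moreover have "tface X (insert E B) \<noteq> tface X B"
      using tface_eq_iff[OF ch] that(2) by blast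
    moreover have "convex (tface X B)"
      using tface_face[of B] ch face_of_imp_convex by (auto simp: chains_def)
    ultimately show ?thesis using face_of_aff_dim_lt by blast
  qed
  have "finite B \<Longrightarrow> B \<subseteq> D \<Longrightarrow> aff_dim (tface X B) \<le> int n - int (card B)" for B
  proof (induction B rule: finite_induct)
    case empty
    show ?case using aff_dim_subset[OF T_subset[of X]] st_dim by simp
  next
    case (insert E B)
    then show ?case using lt[of E B] by simp
  qed
  then have "aff_dim (tface X C) \<le> int n - int (card C)"
    using D finD finite_subset by blast
  moreover have "finite B \<Longrightarrow> B \<subseteq> D \<Longrightarrow> int (card B) \<le> aff_dim (tface X (D - B))" for B
  proof (induction B rule: finite_induct)
    case empty
    have "tface X D \<noteq> {}" using chain_tface_nonempty[OF D(1)] by blast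
    then have "0 \<le> aff_dim (tface X D)" using aff_dim_geq[of "tface X D"] aff_dim_empty[of "tface X D"] by linarith
    then show ?case by simp
  next
    case (insert E B)
    have "insert E (D - insert E B) = D - B" using insert by auto
    then have "aff_dim (tface X (D - B)) < aff_dim (tface X (D - insert E B))"
      using lt[of E "D - insert E B"] insert by auto
    then show ?case using insert by simp
  qed
  then have "int (card (D - C)) \<le> aff_dim (tface X (D - (D - C)))"
    using finD by blast
  moreover have "D - (D - C) = C" using D by blast
  moreover have "card (D - C) = n - card C" "card C \<le> n"
    using D finD by (auto simp: card_Diff_subset finite_subset card_mono)
  ultimately show ?thesis by simp
qed

lemma has_label_iff:
  "has_label X D i \<longleftrightarrow> (\<exists>E\<in>proper_faces X. aff_dim E = int i \<and> D = tface X {E})"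
proof -
  have "tface X {E} facet_of T X" if E: "E \<in> proper_faces X" for E
  proof -
    have ch: "{E} \<in> chains X" "{} \<in> chains X" using E by (auto simp: chains_def)
    show ?thesis
      using tface_face[of "{E}"] tface_faces[OF ch(1)] tface_aff_dim[OF ch(1)] tface_aff_dim[OF ch(2)] E
      by (auto simp: facet_of_def faces_iff)
  qed
  then show ?thesis by (auto simp: has_label_def tface_def)
qed

lemma \<sigma>_tface:
  assumes C: "C \<in> chains X"
  shows "\<sigma> X (tface X C) = (\<lambda>E. nat (aff_dim E)) ` C"
proof -
  have "tface X C \<subseteq> tface X {E} \<longleftrightarrow> E \<in> C" if "E \<in> proper_faces X" for E
    using tface_subset_iff[OF C, of "{E}"] that by (auto simp: chains_def)
  then have "i \<in> \<sigma> X (tface X C) \<longleftrightarrow> (\<exists>E\<in>proper_faces X. aff_dim E = int i \<and> E \<in> C)" for i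
    by (auto simp: \<sigma>_def has_label_iff)
  moreover have "(\<exists>E\<in>proper_faces X. aff_dim E = int i \<and> E \<in> C) \<longleftrightarrow> i \<in> (\<lambda>E. nat (aff_dim E)) ` C" for i
    using C proper_face_aff_dim(1)[OF st_polytope] by (force simp: chains_def)
  ultimately show ?thesis by blast
qed

lemma zero_label_iff:
  assumes C: "C \<in> chains X"
  shows "0 \<in> \<sigma> X (tface X C) \<longleftrightarrow> (\<exists>v\<in>vertices X. {v} \<in> C)"
proof
  assume "0 \<in> \<sigma> X (tface X C)"
  then obtain E where E: "E \<in> C" "nat (aff_dim E) = 0" using \<sigma>_tface[OF C] by auto
  then have "E \<in> proper_faces X" using C by (auto simp: chains_def)
  then have "aff_dim E = 0" using E(2) proper_face_aff_dim(1)[OF st_polytope, of E] by simp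
  then show "\<exists>v\<in>vertices X. {v} \<in> C"
    using proper_face_dim_0[OF \<open>E \<in> proper_faces X\<close>] E(1) by metis
next
  assume "\<exists>v\<in>vertices X. {v} \<in> C"
  then show "0 \<in> \<sigma> X (tface X C)" using \<sigma>_tface[OF C] by force
qed

lemma face_of_tface:
  assumes C: "C \<in> chains X" and U: "U face_of tface X C" "U \<noteq> {}"
  obtains D where "D \<in> chains X" "C \<subseteq> D" "U = tface X D"
proof -
  have "tface X C face_of T X" using tface_face C by (auto simp: chains_def)
  then have "U \<in> faces (T X)" using U face_of_trans by (auto simp: faces_iff)
  then obtain D where D: "D \<in> chains X" "U = tface X D" using faces_T by metis
  then have "C \<subseteq> D" using tface_subset_iff[OF D(1) C] face_of_imp_subset[OF U(1)] by blast
  then show ?thesis using that D by blast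
qed

lemma tface_face_of_tface:
  assumes "C \<in> chains X" "D \<in> chains X" "C \<subseteq> D"
  shows "tface X D face_of tface X C"
  using face_of_face[OF tface_face[OF chain_proper[OF assms(1)]]] tface_face[OF chain_proper[OF assms(2)]]
    tface_antimono[OF assms(3)] by blast

lemma tface_polytope: "C \<in> chains X \<Longrightarrow> polytope (tface X C)"
  using face_of_polytope_polytope[OF T_polytope tface_face[OF chain_proper]] .

section \<open>Top and bottom faces as insertions of a vertex\<close>

lemma vertex_tface:
  assumes C: "C \<in> chains X" and u: "u \<in> vertices (tface X C)" and n: "0 < n"
  obtains v D where "D \<in> chains X" "C \<subseteq> D" "{u} = tface X D" "{v} \<in> D"
proof -
  have "{u} face_of tface X C" using u by (simp add: singleton_face_iff)
  then obtain D where D: "D \<in> chains X" "C \<subseteq> D" "{u} = tface X D"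
    using face_of_tface[OF C] by blast
  have "aff_dim {u} = 0" by simp
  then have "card D = n" using tface_aff_dim[OF D(1)] D(3) by simp
  then obtain v where "{v} \<in> D" using full_chain_vertex[OF st_polytope st_dim D(1) _ n] by blast
  then show ?thesis using that D by blast
qed

text \<open>The missing label is 0, so a candidate inserts some vertex \<open>w\<close> into
  \<open>C\<close>. Every vertex of the face lies on such a cut, and as the cuts at vertices are
  swept in the order of the vertices, a maximal one can only lie on the cut at the highest vertex of
  the base.\<close>

lemma is_end_face_iff:
  assumes n: "0 < n" and q: "ordered_near_vertices q X" and C: "C \<in> chains X"
    and C0: "0 \<notin> \<sigma> X (tface X C)"
    and v: "v \<in> vertices X" "v \<in> base X C"
    and mx: "\<And>u. u \<in> vertices X \<Longrightarrow> u \<in> base X C \<Longrightarrow> u \<noteq> v \<Longrightarrow> q \<bullet> u < q \<bullet> v"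
  shows "is_end_face q X (tface X C) U \<longleftrightarrow> U = tface X (insert {v} C)"
proof -
  let ?G = "tface X C" and ?W = "tface X (insert {v} C)"
  have iv: "insert {v} C \<in> chains X"
    using insert_vertex_chain[OF st_polytope C v] st_dim n by simp
  have no0: "{u} \<notin> C" for u
    using C0 zero_label_iff[OF C] vertex_in_base(2)[OF st_polytope C] by blast
  have least: "(LEAST i. i \<notin> \<sigma> X ?G) = 0" using C0 by (rule Least_eq_0)
  have finC: "finite C" using finite_chain[OF st_polytope C] .
  have PG: "polytope ?G" using tface_polytope[OF C] .
  obtain z where z: "z \<in> ?W" using chain_tface_nonempty[OF iv] by blast
  have zG: "z \<in> ?G" using z tface_antimono[of C "insert {v} C"] by blast
  have near: "w = v" if w: "{w} \<in> D" "D \<in> chains X" "C \<subseteq> D" and u: "u \<in> tface X D"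
    and um: "\<And>x. x \<in> vertices ?G \<Longrightarrow> q \<bullet> x \<le> q \<bullet> u" for u w D
  proof (rule ccontr)
    assume ne: "w \<noteq> v"
    have "w \<in> base X C" "w \<in> vertices X"
      using vertex_in_base[OF st_polytope w(2,1)] w(3) by (auto simp: base_def)
    then have "q \<bullet> w < q \<bullet> v" using mx ne by blast
    moreover have "u \<in> tface X {{w}}" "z \<in> tface X {{v}}"
      using u z w(1) by (auto simp: tface_def)
    ultimately have "q \<bullet> u < q \<bullet> z"
      using q v \<open>w \<in> vertices X\<close> unfolding ordered_near_vertices_def by blast
    moreover obtain x where "x \<in> vertices ?G" "q \<bullet> z \<le> q \<bullet> x"
      using polytope_vertex_ge[OF PG zG] by metis
    ultimately show False using um by fastforce
  qed
  show ?thesis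
  proof
    assume "is_end_face q X ?G U"
    then have end_face: "U face_of ?G \<and> aff_dim U = aff_dim ?G - 1 \<and> \<sigma> X U = insert 0 (\<sigma> X ?G) \<and>
        (\<exists>u\<in>vertices ?G. (\<forall>w\<in>vertices ?G. q \<bullet> w \<le> q \<bullet> u) \<and> u \<in> U)"
      by (simp only: is_end_face_def least)
    note U = conjunct1[OF end_face] conjunct1[OF conjunct2[OF end_face]]
      conjunct1[OF conjunct2[OF conjunct2[OF end_face]]]
    from end_face have "\<exists>u\<in>vertices ?G. (\<forall>w\<in>vertices ?G. q \<bullet> w \<le> q \<bullet> u) \<and> u \<in> U"
      by (elim conjE)
    then obtain u where u: "u \<in> vertices ?G" "\<And>w. w \<in> vertices ?G \<Longrightarrow> q \<bullet> w \<le> q \<bullet> u" "u \<in> U"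
      by auto
    obtain D where D: "D \<in> chains X" "C \<subseteq> D" "U = tface X D"
      using face_of_tface[OF C U(1)] u(3) by blast
    have finD: "finite D" using finite_chain[OF st_polytope D(1)] .
    have "card D = Suc (card C)"
      using U(2) tface_aff_dim[OF C] tface_aff_dim[OF D(1)] D(3) by simp
    moreover have "0 \<in> \<sigma> X (tface X D)" using U(3) D(3) by simp
    then obtain w where w: "{w} \<in> D" by (auto simp: zero_label_iff[OF D(1)])
    moreover have "card (insert {w} C) = Suc (card C)" using no0 finC by simp
    ultimately have "insert {w} C = D"
      using D(2) finD by (intro card_subset_eq) auto
    moreover have "w = v" using near[OF w D(1,2)] u D(3) by blast
    ultimately show "U = ?W" using D(3) by simp
  next
    assume UW: "U = ?W"
    have "finite (vertices ?G)" "vertices ?G \<noteq> {}"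
      using finite_vertices[OF PG] vertices_nonempty[OF PG] zG by auto
    then obtain u where u: "u \<in> vertices ?G" "\<And>w. w \<in> vertices ?G \<Longrightarrow> q \<bullet> w \<le> q \<bullet> u"
      using finite_arg_max[of "vertices ?G" "\<lambda>x. q \<bullet> x"] by blast
    obtain w D where D: "D \<in> chains X" "C \<subseteq> D" "{u} = tface X D" "{w} \<in> D"
      by (rule vertex_tface[OF C u(1) n])
    have "w = v" using near[OF D(4,1,2)] u D(3) by blast
    then have "u \<in> ?W" using D tface_antimono[of "insert {v} C" D] by blast
    moreover have "?W face_of ?G" using tface_face_of_tface[OF C iv] by blast
    moreover have "aff_dim ?W = aff_dim ?G - 1"
      using tface_aff_dim[OF C] tface_aff_dim[OF iv] no0 finC by simp
    moreover have "\<sigma> X ?W = insert 0 (\<sigma> X ?G)"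
      using \<sigma>_tface[OF C] \<sigma>_tface[OF iv] by simp
    ultimately show "is_end_face q X ?G U"
      unfolding is_end_face_def least UW using u by blast
  qed
qed

section \<open>Position of a face of the truncation relative to a level of the sweep\<close>

lemma tface_above:
  assumes "above_near_faces q \<theta> X" "C \<in> chains X" "\<And>u. u \<in> vertices (base X C) \<Longrightarrow> \<theta> < q \<bullet> u"
    "y \<in> tface X C"
  shows "\<theta> < q \<bullet> y"
proof -
  have "base X C = X \<or> y \<in> cut_hyperplane (base X C)"
    using base_mem[OF st_polytope assms(2)] assms(4) by (auto simp: tface_def)
  moreover have "base X C \<in> insert X (proper_faces X)"
    using base_mem[OF st_polytope assms(2)] assms(2) by (auto simp: chains_def)
  moreover have "y \<in> T X" using assms(4) by (simp add: tface_def)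
  ultimately show ?thesis
    using assms(1,3) unfolding above_near_faces_def by blast
qed

text \<open>Inserting \<open>u\<close> into the chain gives a subface near \<open>u\<close>, which
  lies above. In dimension 0 there is nothing to insert, but then the base is the point
  \<open>u\<close>.\<close>

lemma tface_meets_above:
  assumes q: "above_near_faces q \<theta> X" and C: "C \<in> chains X"
    and u: "u \<in> vertices (base X C)" "\<theta> < q \<bullet> u"
  obtains y where "y \<in> tface X C" "\<theta> < q \<bullet> y"
proof (cases "n = 0")
  case True
  then obtain x where "X = {x}" using st_dim aff_dim_eq_0[of X] by auto
  then have "base X C = {u}" using u vertices_subset by (auto simp: base_def)
  moreover obtain y where "y \<in> tface X C" using chain_tface_nonempty[OF C] by blast
  ultimately have "y \<in> tface X C" "\<theta> < q \<bullet> y"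
    using tface_above[OF q C] u by auto
  then show ?thesis by (rule that)
next
  case False
  have uX: "u \<in> vertices X" "u \<in> base X C"
    using u(1) vertices_face[OF base_face[OF st_polytope C]] by auto
  have iv: "insert {u} C \<in> chains X"
    using insert_vertex_chain[OF st_polytope C uX] st_dim False by simp
  have b: "base X (insert {u} C) = {u}" using uX(2) by (auto simp: base_def)
  obtain y where "y \<in> tface X (insert {u} C)" using chain_tface_nonempty[OF iv] by blast
  then have "y \<in> tface X C" "\<theta> < q \<bullet> y"
    using tface_above[OF q iv] b u(2) tface_antimono[of C "insert {u} C"] by auto
  then show ?thesis by (rule that)
qed

context
  fixes q :: 'a and \<theta> :: real
  assumes up: "above_near_faces q \<theta> X" and down: "above_near_faces (- q) (- \<theta>) X"
    and ne: "\<And>u. u \<in> vertices X \<Longrightarrow> q \<bullet> u \<noteq> \<theta>"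
begin

text \<open>No vertex lies on the level itself, and a base vertex below it would give a subface
  below it.\<close>

lemma tface_above_iff:
  assumes C: "C \<in> chains X"
  shows "(\<forall>y\<in>tface X C. \<theta> < q \<bullet> y) \<longleftrightarrow> (\<forall>u\<in>vertices (base X C). \<theta> < q \<bullet> u)"
proof (intro iffI ballI)
  fix u assume *: "\<forall>y\<in>tface X C. \<theta> < q \<bullet> y" and u: "u \<in> vertices (base X C)"
  show "\<theta> < q \<bullet> u"
  proof (rule ccontr)
    assume "\<not> \<theta> < q \<bullet> u"
    moreover have "q \<bullet> u \<noteq> \<theta>" using ne u vertices_face[OF base_face[OF st_polytope C]] by auto
    ultimately have "- \<theta> < (- q) \<bullet> u" by simp
    then obtain y where "y \<in> tface X C" "- \<theta> < (- q) \<bullet> y"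
      using tface_meets_above[OF down C u] by blast
    then show False using * by fastforce
  qed
next
  fix y assume "\<forall>u\<in>vertices (base X C). \<theta> < q \<bullet> u" "y \<in> tface X C"
  then show "\<theta> < q \<bullet> y" using tface_above[OF up C, of y] by blast
qed

lemma tface_below_iff:
  assumes C: "C \<in> chains X"
  shows "(\<forall>y\<in>tface X C. q \<bullet> y < \<theta>) \<longleftrightarrow> (\<forall>u\<in>vertices (base X C). q \<bullet> u < \<theta>)"
proof (intro iffI ballI)
  fix u assume *: "\<forall>y\<in>tface X C. q \<bullet> y < \<theta>" and u: "u \<in> vertices (base X C)"
  show "q \<bullet> u < \<theta>"
  proof (rule ccontr)
    assume "\<not> q \<bullet> u < \<theta>"
    moreover have "q \<bullet> u \<noteq> \<theta>" using ne u vertices_face[OF base_face[OF st_polytope C]] by auto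
    ultimately have "\<theta> < q \<bullet> u" by simp
    then obtain y where "y \<in> tface X C" "\<theta> < q \<bullet> y"
      using tface_meets_above[OF up C u] by blast
    then show False using * by fastforce
  qed
next
  fix y assume "\<forall>u\<in>vertices (base X C). q \<bullet> u < \<theta>" "y \<in> tface X C"
  then have "- \<theta> < (- q) \<bullet> y" using tface_above[OF down C, of y] by auto
  then show "q \<bullet> y < \<theta>" by simp
qed

text \<open>A vertex of \<open>T X\<close> belongs to a chain whose base is a single vertex of
  \<open>X\<close>, and it lies on the same side of the level as that vertex. So a sweep hyperplane
  transversal to a section is transversal to its truncation as well.\<close>

lemma T_vertex_ne:
  assumes w: "w \<in> vertices (T X)"
  shows "q \<bullet> w \<noteq> \<theta>"
proof -
  obtain C u where C: "C \<in> chains X" "{w} = tface X C" "base X C = {u}"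
  proof (cases "n = 0")
    case True
    then obtain x where x: "X = {x}" using st_dim aff_dim_eq_0[of X] by auto
    have "w \<in> T X" using w vertices_subset by blast
    then have "{w} = tface X {}" using x T_subset[of X] by auto
    moreover have "{} \<in> chains X" "base X {} = {x}" using x by (auto simp: base_def chains_def)
    ultimately show ?thesis using that by metis
  next
    case False
    have "{} \<in> chains X" by (simp add: chains_def)
    moreover have "w \<in> vertices (tface X {})" using w by simp
    ultimately obtain v D where D: "D \<in> chains X" "{w} = tface X D" "{v} \<in> D"
      using vertex_tface[of "{}" w] False by (metis gr0I)
    then have "base X D = {v}"
      using vertex_in_base(1)[OF st_polytope D(1,3)] by (auto simp: base_def)
    then show ?thesis by (rule that[OF D(1,2)])
  qed
  have "u \<in> vertices X"
    using base_face[OF st_polytope C(1)] C(3) by (simp add: singleton_face_iff)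
  then have "q \<bullet> u < \<theta> \<or> \<theta> < q \<bullet> u" using ne[of u] by auto
  then show ?thesis
    using tface_above_iff[OF C(1)] tface_below_iff[OF C(1)] C(2,3) by force
qed

end

end

end

subsection \<open>Vertex sections\<close>

text \<open>The excess over \<open>q \<bullet> v\<close> is a weighted mean of nonnegative vertex
  excesses; if it were not positive, all weight would sit at \<open>v\<close>.\<close>

lemma strict_min_vertex:
  fixes B :: "'a::euclidean_space set"
  assumes B: "polytope B" and v: "v \<in> vertices B"
    and lt: "\<And>w. w \<in> vertices B \<Longrightarrow> w \<noteq> v \<Longrightarrow> q \<bullet> v < q \<bullet> w"
    and x: "x \<in> B" "x \<noteq> v"
  shows "q \<bullet> v < q \<bullet> x"
proof (rule ccontr)
  assume "\<not> q \<bullet> v < q \<bullet> x"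
  then have le: "q \<bullet> x - q \<bullet> v \<le> 0" by simp
  let ?V = "vertices B"
  have fin: "finite ?V" using B by (rule finite_vertices)
  obtain w where w: "\<And>u. u \<in> ?V \<Longrightarrow> 0 \<le> w u" "sum w ?V = 1" "x = (\<Sum>u\<in>?V. w u *\<^sub>R u)"
    using polytope_weights[OF B x(1)] by blast
  have pos: "0 \<le> w u * (q \<bullet> u - q \<bullet> v)" if "u \<in> ?V" for u
    using w(1)[OF that] lt[OF that] by (cases "u = v") auto
  have "q \<bullet> x - q \<bullet> v = (\<Sum>u\<in>?V. w u * (q \<bullet> u - q \<bullet> v))"
    by (simp add: w(3) inner_sum_right right_diff_distrib sum_subtractf w(2) flip: sum_distrib_right)
  moreover have "0 \<le> (\<Sum>u\<in>?V. w u * (q \<bullet> u - q \<bullet> v))" by (intro sum_nonneg pos)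
  ultimately have "(\<Sum>u\<in>?V. w u * (q \<bullet> u - q \<bullet> v)) = 0" using le by simp
  then have "\<forall>u\<in>?V. w u * (q \<bullet> u - q \<bullet> v) = 0"
    using sum_nonneg_eq_0_iff[OF fin pos] by simp
  then have zero: "w u = 0" if "u \<in> ?V" "u \<noteq> v" for u
    using lt[OF that] that(1) by fastforce
  have "(\<Sum>u\<in>?V. w u *\<^sub>R u) = (\<Sum>u\<in>{v}. w u *\<^sub>R u)"
    using v zero fin by (intro sum.mono_neutral_right) auto
  moreover have "sum w ?V = sum w {v}"
    using v zero fin by (intro sum.mono_neutral_right) auto
  ultimately show False using w(2,3) x(2) by simp
qed

lemma affine_hull_eq_of_aff_dim:
  fixes S T :: "'a::euclidean_space set"
  assumes "S \<subseteq> T" "aff_dim T \<le> aff_dim S" "S \<noteq> {}"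
  shows "affine hull S = affine hull T"
proof (rule affine_dim_equal)
  show "affine hull S \<noteq> {}" using assms(3) by simp
  show "affine hull S \<subseteq> affine hull T" using assms(1) by (rule hull_mono)
  have "aff_dim S \<le> aff_dim T" using assms(1) by (rule aff_dim_subset)
  then show "aff_dim (affine hull S) = aff_dim (affine hull T)" using assms(2) by simp
qed (simp_all add: affine_affine_hull)

text \<open>Equal values at two distinct points make \<open>q\<close> constant on the line through
  them, and this line contains a vertex other than \<open>v\<close>.\<close>

lemma edge_inner_ne:
  fixes F :: "'a::euclidean_space set"
  assumes F: "polytope F" "aff_dim F = 1" and v: "v \<in> F" and u: "u \<in> F" "u \<noteq> v"
    and q: "\<And>w. w \<in> vertices F \<Longrightarrow> w \<noteq> v \<Longrightarrow> q \<bullet> w \<noteq> q \<bullet> v"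
  shows "q \<bullet> u \<noteq> q \<bullet> v"
proof
  assume eq: "q \<bullet> u = q \<bullet> v"
  have "\<exists>w\<in>vertices F. w \<noteq> v"
  proof (rule ccontr)
    assume "\<not> (\<exists>w\<in>vertices F. w \<noteq> v)"
    then have "vertices F \<subseteq> {v}" by blast
    then have "convex hull vertices F \<subseteq> {v}" using hull_minimal[of "vertices F" "{v}" convex] by simp
    then show False using polytope_hull_vertices[OF F(1)] u by blast
  qed
  then obtain w where w: "w \<in> vertices F" "w \<noteq> v" by (rule bexE)
  have "aff_dim {u, v} = 1" using u(2) by (simp add: aff_dim_2)
  then have "affine hull {u, v} = affine hull F"
    using u v F(2) by (intro affine_hull_eq_of_aff_dim) auto
  moreover have "w \<in> affine hull F"
    using w(1) vertices_subset[of F] hull_subset[of F affine] by blast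
  ultimately have "w \<in> affine hull {u, v}" by simp
  then obtain x y where xy: "w = x *\<^sub>R u + y *\<^sub>R v" "x + y = 1" by (auto simp: affine_hull_2)
  have "q \<bullet> w = (x + y) * (q \<bullet> v)" using eq by (simp add: xy(1) inner_add_right distrib_right)
  then show False using q[OF w] xy(2) by simp
qed

text \<open>The hyperplane separates \<open>v\<close> from all other vertices, so the slice is the
  vertex figure at \<open>v\<close>.\<close>

locale vertex_slice =
  fixes K :: "'a::euclidean_space set" and v c :: 'a and h :: real
  assumes polK: "polytope K" and vK: "v \<in> vertices K" and above: "h < c \<bullet> v"
    and below: "\<And>u. u \<in> vertices K \<Longrightarrow> u \<noteq> v \<Longrightarrow> c \<bullet> u < h"
begin

sublocale transversal_slice K c h
proof
  show "polytope K" by (rule polK)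
  show "c \<bullet> u \<noteq> h" if "u \<in> vertices K" for u
    using above below[OF that] by (cases "u = v") auto
qed

lemma vertex_slice_nonempty_iff:
  assumes G: "G face_of K"
  shows "G \<inter> hyp \<noteq> {} \<longleftrightarrow> v \<in> G \<and> G \<noteq> {v}"
proof
  assume ne: "G \<inter> hyp \<noteq> {}"
  obtain u u' where u: "u \<in> vertices G" "c \<bullet> u < h" "u' \<in> vertices G" "h < c \<bullet> u'"
    by (rule slice_sides[OF G ne])
  have vG: "vertices G \<subseteq> vertices K" "vertices G \<subseteq> G"
    using vertices_face[OF G] vertices_subset[of G] by auto
  have "u' = v" using below[of u'] u vG by force
  moreover have "u \<noteq> v" using above u by force
  ultimately show "v \<in> G \<and> G \<noteq> {v}" using u vG by blast
next
  assume G': "v \<in> G \<and> G \<noteq> {v}"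
  have PG: "polytope G" using polK G face_of_polytope_polytope by blast
  have "\<not> vertices G \<subseteq> {v}"
  proof
    assume "vertices G \<subseteq> {v}"
    then have "convex hull vertices G \<subseteq> {v}" using hull_minimal[of "vertices G" "{v}" convex] by simp
    then show False using polytope_hull_vertices[OF PG] G' by blast
  qed
  then obtain u where u: "u \<in> vertices G" "u \<noteq> v" by blast
  then have "u \<in> G" "u \<in> vertices K" using vertices_face[OF G] by auto
  then have "rel_interior G \<inter> hyp \<noteq> {}"
    using slice_nonempty[OF G, of u v] below[of u] u(2) above G' by blast
  then show "G \<inter> hyp \<noteq> {}" using rel_interior_subset[of G] by blast
qed

lemma vertex_slice_faces: "faces (K \<inter> hyp) = {F \<inter> hyp | F. F face_of K \<and> v \<in> F \<and> F \<noteq> {v}}"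
  unfolding slice_faces
  using vertex_slice_nonempty_iff by (intro Collect_cong ex_cong1 conj_cong refl) simp

lemma vertex_slice_proper_faces:
  assumes "K \<noteq> {v}"
  shows "proper_faces (K \<inter> hyp) = {F \<inter> hyp | F. F \<in> proper_faces K \<and> v \<in> F \<and> F \<noteq> {v}}" (is "?L = ?R")
proof (intro equalityI subsetI)
  fix E assume "E \<in> ?L"
  then have E: "E \<in> faces (K \<inter> hyp)" "E \<noteq> K \<inter> hyp" by (auto simp: proper_faces_def)
  then obtain F where F: "E = F \<inter> hyp" "F face_of K" "v \<in> F" "F \<noteq> {v}"
    unfolding vertex_slice_faces by blast
  moreover have "F \<noteq> K" using E(2) F(1) by auto
  ultimately show "E \<in> ?R" by (auto simp: proper_faces_iff)
next
  fix E assume "E \<in> ?R"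
  then obtain F where F: "E = F \<inter> hyp" "F \<in> proper_faces K" "v \<in> F" "F \<noteq> {v}" by blast
  then have FK: "F face_of K" "F \<noteq> K" by (auto simp: proper_faces_iff)
  have "E \<in> faces (K \<inter> hyp)" unfolding vertex_slice_faces using F(1,3,4) FK(1) by blast
  moreover have "F \<inter> hyp \<noteq> {}" using vertex_slice_nonempty_iff[OF FK(1)] F(3,4) by simp
  then have "E \<noteq> K \<inter> hyp"
    using slice_eq_iff[OF FK(1) _ face_of_refl[OF polytope_imp_convex[OF polK]]] F(1) FK(2) by simp
  ultimately show "E \<in> ?L" by (simp add: proper_faces_def)
qed

text \<open>A vertex of the vertex figure lies on an edge through \<open>v\<close>, along which
  \<open>q\<close> is not constant.\<close>

lemma vertex_slice_vertex_ne:
  assumes inj: "inj_on (\<lambda>x. q \<bullet> x) (vertices K)" and u: "u \<in> vertices (K \<inter> hyp)"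
  shows "q \<bullet> u \<noteq> q \<bullet> v"
proof -
  have "{u} \<in> faces (K \<inter> hyp)" using u by (simp add: faces_iff singleton_face_iff)
  then obtain F where F: "{u} = F \<inter> hyp" "F face_of K" "v \<in> F" "F \<noteq> {v}"
    unfolding vertex_slice_faces by blast
  have ne: "F \<inter> hyp \<noteq> {}" using F(1) by blast
  have "aff_dim (F \<inter> hyp) = 0" unfolding F(1)[symmetric] by simp
  then have "aff_dim F = 1" using slice_aff_dim[OF F(2) ne] by simp
  moreover have "polytope F" using F(2) polK face_of_polytope_polytope by blast
  moreover have uF: "u \<in> F" "u \<in> hyp" using F(1) by blast+
  moreover have "u \<noteq> v" using above uF(2) by auto
  moreover have "q \<bullet> w \<noteq> q \<bullet> v" if "w \<in> vertices F" "w \<noteq> v" for w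
    using inj_onD[OF inj, of w v] that vK vertices_face[OF F(2)] by blast
  ultimately show ?thesis using edge_inner_ne[of F v u q] F(3) by blast
qed

end

section \<open>The label-0 facet at a vertex as the truncation of the section\<close>

context swept_truncation
begin

text \<open>The last condition lets the truncation induced on the section be read off from that of
  \<open>X\<close>; it reflects that a face and its part in the section have the same carrier
  face.\<close>

definition vertex_section :: "'a set \<Rightarrow> 'a \<Rightarrow> bool" where
  "vertex_section X v \<longleftrightarrow>
     cut_offset (carrier_face {v}) < a (carrier_face {v}) \<bullet> v \<and>
     (\<forall>u\<in>vertices X - {v}. a (carrier_face {v}) \<bullet> u < cut_offset (carrier_face {v})) \<and>
     (\<forall>F\<in>proper_faces X. v \<in> F \<longrightarrow> F \<noteq> {v} \<longrightarrow> cut_hyperplane (F \<inter> cut_hyperplane {v}) = cut_hyperplane F)"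

lemma T_Q: "T (Q X v) = tface X {{v}}"
  by (auto simp: T_def tface_def Q_def)

context
  fixes n :: nat and X :: "'a set" and v :: 'a
  assumes stX: "simple_truncation (Suc n) X" and vX: "v \<in> vertices X"
    and sec: "vertex_section X v" and stY: "simple_truncation n (Q X v)"
begin

abbreviation "hyp \<equiv> cut_hyperplane {v}"

lemma sec_above: "cut_offset (carrier_face {v}) < a (carrier_face {v}) \<bullet> v"
  using sec unfolding vertex_section_def by (elim conjE)

lemma sec_below:
  assumes "u \<in> vertices X" "u \<noteq> v"
  shows "a (carrier_face {v}) \<bullet> u < cut_offset (carrier_face {v})"
proof -
  have "\<forall>u\<in>vertices X - {v}. a (carrier_face {v}) \<bullet> u < cut_offset (carrier_face {v})"
    using sec unfolding vertex_section_def by (elim conjE)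
  then show ?thesis using assms by blast
qed

lemma sec_hyperplane:
  assumes "F \<in> proper_faces X" "v \<in> F" "F \<noteq> {v}"
  shows "cut_hyperplane (F \<inter> hyp) = cut_hyperplane F"
proof -
  have "\<forall>F\<in>proper_faces X. v \<in> F \<longrightarrow> F \<noteq> {v} \<longrightarrow> cut_hyperplane (F \<inter> hyp) = cut_hyperplane F"
    using sec unfolding vertex_section_def by (elim conjE)
  then have "v \<in> F \<longrightarrow> F \<noteq> {v} \<longrightarrow> cut_hyperplane (F \<inter> hyp) = cut_hyperplane F"
    using assms(1) by (rule bspec)
  then show ?thesis using assms(2,3) by simp
qed

lemma polX: "polytope X" using st_polytope[OF stX] .

lemma v_notin_hyp: "v \<notin> hyp"
  using sec_above by (simp add: cut_hyperplane_def)

interpretation sl: vertex_slice X v "a (carrier_face {v})" "cut_offset (carrier_face {v})"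
  by unfold_locales (fact polX vX sec_above sec_below)+

lemma hyp_eq: "{x. a (carrier_face {v}) \<bullet> x = cut_offset (carrier_face {v})} = hyp"
  by (simp add: cut_hyperplane_def)

lemma slice_face_nonempty_iff:
  assumes G: "G face_of X"
  shows "G \<inter> hyp \<noteq> {} \<longleftrightarrow> v \<in> G \<and> G \<noteq> {v}"
  by (rule sl.vertex_slice_nonempty_iff[unfolded hyp_eq, OF G])

context
  fixes F
  assumes F: "F face_of X" "v \<in> F" "F \<noteq> {v}"
begin

lemma section_nonempty: "F \<inter> hyp \<noteq> {}"
  using slice_face_nonempty_iff[OF F(1)] F(2,3) by simp

lemma section_subset_iff:
  assumes "F' face_of X"
  shows "F \<inter> hyp \<subseteq> F' \<inter> hyp \<longleftrightarrow> F \<subseteq> F'"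
proof -
  have "F \<inter> hyp \<subseteq> F' \<longleftrightarrow> F \<subseteq> F'"
    by (rule sl.slice_subset_iff[unfolded hyp_eq, OF F(1) section_nonempty assms])
  then show ?thesis by simp
qed

lemma section_aff_dim: "aff_dim (F \<inter> hyp) = aff_dim F - 1"
  by (rule sl.slice_aff_dim[unfolded hyp_eq, OF F(1) section_nonempty])

end

lemma X_ne: "X \<noteq> {v}"
proof
  assume "X = {v}"
  then have "aff_dim X = 0" by simp
  then show False using st_dim[OF stX] by simp
qed

lemma section_proper_faces:
  "proper_faces (Q X v) = {F \<inter> hyp | F. F \<in> proper_faces X \<and> v \<in> F \<and> F \<noteq> {v}}"
  unfolding Q_def by (rule sl.vertex_slice_proper_faces[unfolded hyp_eq, OF X_ne])

text \<open>The link of \<open>{v}\<close> in the order complex, read in the vertex figure.\<close>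

definition link :: "'a set set \<Rightarrow> 'a set set" where
  "link C = (\<lambda>F. F \<inter> hyp) ` (C - {{v}})"

context
  fixes C assumes C: "C \<in> chains X" and vC: "{v} \<in> C"
begin

lemma star_face:
  assumes "F \<in> C - {{v}}"
  shows "F \<in> proper_faces X" "F face_of X" "v \<in> F" "F \<noteq> {v}"
proof -
  show "F \<in> proper_faces X" using assms chain_proper[OF C] by blast
  then show "F face_of X" by (simp add: proper_faces_iff)
  show "v \<in> F" using vertex_in_base(1)[OF polX C vC] assms by (auto simp: base_def)
  show "F \<noteq> {v}" using assms by blast
qed

lemma link_chain: "link C \<in> chains (Q X v)"
proof -
  have "link C \<subseteq> proper_faces (Q X v)"
  proof
    fix E assume "E \<in> link C"
    then obtain F where F: "F \<in> C - {{v}}" "E = F \<inter> hyp" unfolding link_def by (rule imageE)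
    then show "E \<in> proper_faces (Q X v)"
      unfolding section_proper_faces using star_face(1,3,4)[OF F(1)] by blast
  qed
  moreover have "E \<subseteq> E' \<or> E' \<subseteq> E" if E: "E \<in> link C" "E' \<in> link C" for E E'
  proof -
    obtain F F' where F: "E = F \<inter> hyp" "F \<in> C" "E' = F' \<inter> hyp" "F' \<in> C"
      using E unfolding link_def by blast
    have "F \<subseteq> F' \<or> F' \<subseteq> F" using F(2,4) C unfolding chains_def by blast
    then show ?thesis using F(1,3) by blast
  qed
  ultimately show ?thesis by (simp add: chains_def)
qed

lemma tface_link: "tface (Q X v) (link C) = tface X C"
proof -
  have eq: "cut_hyperplane (F \<inter> hyp) = cut_hyperplane F" if "F \<in> C - {{v}}" for F
    using sec_hyperplane[OF star_face(1,3,4)[OF that]] .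
  have "(\<Inter>E\<in>link C. cut_hyperplane E) = (\<Inter>F\<in>C - {{v}}. cut_hyperplane F)"
    unfolding link_def using eq by auto
  moreover have "(\<Inter>F\<in>C. cut_hyperplane F) = hyp \<inter> (\<Inter>F\<in>C - {{v}}. cut_hyperplane F)"
    using vC by auto
  ultimately show ?thesis
    unfolding tface_def[of "Q X v"] T_Q tface_def[of X] by auto
qed

lemma base_link: "base (Q X v) (link C) = base X (C - {{v}}) \<inter> hyp"
proof (rule set_eqI)
  fix x
  show "x \<in> base (Q X v) (link C) \<longleftrightarrow> x \<in> base X (C - {{v}}) \<inter> hyp"
    unfolding base_def link_def Q_def Inter_iff Int_iff ball_simps by meson
qed

lemma sub_chain: "C - {{v}} \<in> chains X"
  by (rule chains_subset[OF C Diff_subset])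

lemma v_in_base: "v \<in> base X (C - {{v}})"
  using vertex_in_base(1)[OF polX C vC] by (simp add: base_def)

lemma base_face': "base X (C - {{v}}) face_of X"
  using base_face[OF polX sub_chain] .

text \<open>Sectioning lowers the dimension of every face through \<open>v\<close> by one, which
  shifts its label; the label 0 comes from the cut at \<open>v\<close>.\<close>

lemma \<sigma>_link: "\<sigma> X (tface X C) = insert 0 (Suc ` \<sigma> (Q X v) (tface X C))"
proof -
  have "nat (aff_dim F) = Suc (nat (aff_dim (F \<inter> hyp)))" if "F \<in> C - {{v}}" for F
  proof -
    have "aff_dim (F \<inter> hyp) = aff_dim F - 1" using section_aff_dim star_face[OF that] by blast
    moreover have "F \<inter> hyp \<in> proper_faces (Q X v)"
      unfolding section_proper_faces using star_face[OF that] by blast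
    then have "0 \<le> aff_dim (F \<inter> hyp)" using proper_face_aff_dim(1)[OF st_polytope[OF stY]] by blast
    ultimately show ?thesis by simp
  qed
  then have "(\<lambda>F. nat (aff_dim F)) ` (C - {{v}}) = Suc ` (\<lambda>E. nat (aff_dim E)) ` link C"
    unfolding link_def image_image by (intro image_cong) auto
  moreover have "C = insert {v} (C - {{v}})" using vC by blast
  then have "(\<lambda>F. nat (aff_dim F)) ` C = insert 0 ((\<lambda>F. nat (aff_dim F)) ` (C - {{v}}))"
    by (metis (no_types, lifting) aff_dim_sing image_insert nat_zero_as_int of_nat_0)
  ultimately show ?thesis
    using \<sigma>_tface[OF stX C] \<sigma>_tface[OF stY link_chain] tface_link by simp
qed

text \<open>The segment from \<open>v\<close> to another vertex of the base crosses the cut, and the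
  sign of the increase of \<open>q\<close> over its value at \<open>v\<close> is constant along it.
  Conversely, a strict minimum at \<open>v\<close> among the vertices is one on the whole base,
  hence on the section.\<close>

lemma base_link_above_iff:
  "(\<forall>u\<in>vertices (base (Q X v) (link C)). q \<bullet> v < q \<bullet> u) \<longleftrightarrow>
   (\<forall>w\<in>vertices (base X (C - {{v}})). w \<noteq> v \<longrightarrow> q \<bullet> v < q \<bullet> w)"
proof -
  let ?B = "base X (C - {{v}})"
  have PB: "polytope ?B" using base_polytope[OF polX sub_chain] .
  have vB: "v \<in> vertices ?B" using vertices_face[OF base_face'] vX v_in_base by blast
  have PE: "polytope (?B \<inter> hyp)" using base_polytope[OF st_polytope[OF stY] link_chain] base_link by simp
  show ?thesis
    unfolding base_link
  proof (intro iffI ballI impI)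
    fix w assume *: "\<forall>u\<in>vertices (?B \<inter> hyp). q \<bullet> v < q \<bullet> u" and w: "w \<in> vertices ?B" "w \<noteq> v"
    let ?c = "a (carrier_face {v})" and ?h = "cut_offset (carrier_face {v})"
    have wX: "w \<in> vertices X" "w \<in> ?B" using w(1) vertices_face[OF base_face'] by auto
    have lt: "?c \<bullet> w < ?h" "?h < ?c \<bullet> v" using sec_below[OF wX(1) w(2)] sec_above by auto
    define t where "t = (?c \<bullet> v - ?h) / (?c \<bullet> v - ?c \<bullet> w)"
    have t: "0 < t" "t < 1" using lt by (auto simp: t_def field_simps)
    let ?x = "(1 - t) *\<^sub>R v + t *\<^sub>R w"
    have "t * (?c \<bullet> v - ?c \<bullet> w) = ?c \<bullet> v - ?h" using lt by (simp add: t_def)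
    then have "?x \<in> hyp" by (simp add: cut_hyperplane_def inner_add_right algebra_simps)
    moreover have "?x \<in> ?B"
      using polytope_imp_convex[OF PB] v_in_base wX(2) t by (intro convexD_alt) auto
    ultimately have "q \<bullet> v < q \<bullet> ?x" using polytope_gt[OF PE, of "q \<bullet> v" q ?x] * by blast
    then have "0 < t * (q \<bullet> w - q \<bullet> v)" by (simp add: inner_add_right algebra_simps)
    then show "q \<bullet> v < q \<bullet> w" using t by (simp add: zero_less_mult_iff)
  next
    fix u assume *: "\<forall>w\<in>vertices ?B. w \<noteq> v \<longrightarrow> q \<bullet> v < q \<bullet> w" and u: "u \<in> vertices (?B \<inter> hyp)"
    have "u \<in> ?B" "u \<in> hyp" using u vertices_subset by blast+
    moreover have "u \<noteq> v" using \<open>u \<in> hyp\<close> v_notin_hyp by blast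
    ultimately show "q \<bullet> v < q \<bullet> u" using strict_min_vertex[OF PB vB, of q u] * by blast
  qed
qed

end

lemma chain_from_link:
  assumes D: "D \<in> chains (Q X v)"
  obtains C where "C \<in> chains X" "{v} \<in> C" "D = link C"
proof -
  let ?S = "{F \<in> proper_faces X. v \<in> F \<and> F \<noteq> {v} \<and> F \<inter> hyp \<in> D}"
  let ?C = "insert {v} ?S"
  have chD: "\<forall>E\<in>D. \<forall>F\<in>D. E \<subseteq> F \<or> F \<subseteq> E" using D by (simp add: chains_def)
  have v0: "{v} \<in> proper_faces X" using vertex_proper_face[OF vX] st_dim[OF stX] by simp
  have "E \<subseteq> F \<or> F \<subseteq> E" if "E \<in> ?C" "F \<in> ?C" for E F
  proof (cases "E = {v} \<or> F = {v}")
    case True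
    then show ?thesis using that by auto
  next
    case False
    then have E: "E face_of X" "v \<in> E" "E \<noteq> {v}" "E \<inter> hyp \<in> D"
      and F: "F face_of X" "v \<in> F" "F \<noteq> {v}" "F \<inter> hyp \<in> D"
      using that by (auto simp: proper_faces_iff)
    have "E \<inter> hyp \<subseteq> F \<inter> hyp \<or> F \<inter> hyp \<subseteq> E \<inter> hyp" by (rule bspec[OF bspec[OF chD E(4)] F(4)])
    then show ?thesis
      unfolding section_subset_iff[OF E(1-3) F(1)] section_subset_iff[OF F(1-3) E(1)] .
  qed
  moreover have "?C \<subseteq> proper_faces X" using v0 by blast
  ultimately have 1: "?C \<in> chains X" by (simp add: chains_def)
  have "D = (\<lambda>F. F \<inter> hyp) ` ?S"
    using chain_proper[OF D] unfolding section_proper_faces by blast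
  moreover have "?C - {{v}} = ?S" by blast
  ultimately have 3: "D = link ?C" by (simp add: link_def)
  show ?thesis by (rule that[OF 1 _ 3]) simp
qed

lemma section_face_chain:
  assumes "G \<in> faces (T (Q X v))"
  obtains C where "C \<in> chains X" "{v} \<in> C" "G = tface X C"
proof -
  obtain D where D: "D \<in> chains (Q X v)" "G = tface (Q X v) D" by (rule faces_T[OF stY assms])
  obtain C where C: "C \<in> chains X" "{v} \<in> C" "D = link C" by (rule chain_from_link[OF D(1)])
  show ?thesis by (rule that[OF C(1,2)]) (use D(2) C(3) tface_link[OF C(1,2)] in simp)
qed

lemma section_faces_iff:
  assumes "C \<in> chains X"
  shows "tface X C \<in> faces (T (Q X v)) \<longleftrightarrow> {v} \<in> C"
proof
  assume "tface X C \<in> faces (T (Q X v))"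
  then have "tface X C \<subseteq> tface X {{v}}"
    unfolding T_Q by (auto simp: faces_iff dest: face_of_imp_subset)
  moreover have "{{v}} \<in> chains X"
    using vertex_proper_face[OF vX] st_dim[OF stX] by (simp add: chains_def)
  ultimately show "{v} \<in> C" using tface_subset_iff[OF stX assms] by blast
next
  assume "{v} \<in> C"
  then show "tface X C \<in> faces (T (Q X v))"
    using tface_faces[OF stY link_chain[OF assms]] tface_link[OF assms] by simp
qed

lemma section_faces_subset: "faces (T (Q X v)) \<subseteq> faces (T X)"
proof
  fix G assume G: "G \<in> faces (T (Q X v))"
  obtain C where C: "C \<in> chains X" "{v} \<in> C" "G = tface X C" by (rule section_face_chain[OF G])
  then show "G \<in> faces (T X)" using tface_faces[OF stX C(1)] by simp
qed

text \<open>Label 0 is present, so under the label shift the smallest label missing in the section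
  corresponds to the smallest one missing in \<open>X\<close>. Hence \<tau> may be computed in
  either, which lets Step 2 use the results on the section.\<close>

lemma is_end_face_section_iff:
  assumes G: "G \<in> faces (T (Q X v))"
  shows "is_end_face q X G U \<longleftrightarrow> is_end_face q (Q X v) G U"
proof -
  obtain C where C: "C \<in> chains X" "{v} \<in> C" "G = tface X C" by (rule section_face_chain[OF G])
  have \<sigma>G: "\<sigma> X G = insert 0 (Suc ` \<sigma> (Q X v) G)" using \<sigma>_link[OF C(1,2)] C(3) by simp
  have "finite (\<sigma> (Q X v) G)"
    using \<sigma>_tface[OF stY link_chain[OF C(1,2)]] tface_link[OF C(1,2)] C(3)
      finite_chain[OF st_polytope[OF stY] link_chain[OF C(1,2)]] by simp
  then obtain m where m: "m \<notin> \<sigma> (Q X v) G" using ex_new_if_finite[OF infinite_UNIV_nat] by blast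
  have "(LEAST i. i \<notin> \<sigma> X G) = Suc (LEAST i. Suc i \<notin> \<sigma> X G)"
    by (rule Least_Suc[of _ "Suc m"]) (use \<sigma>G m in auto)
  also have "(\<lambda>i. Suc i \<notin> \<sigma> X G) = (\<lambda>i. i \<notin> \<sigma> (Q X v) G)"
    by (simp add: \<sigma>G inj_image_mem_iff)
  finally have least: "(LEAST i. i \<notin> \<sigma> X G) = Suc (LEAST i. i \<notin> \<sigma> (Q X v) G)" .
  let ?j = "LEAST i. i \<notin> \<sigma> (Q X v) G"
  have labels: "\<sigma> X U = insert (Suc ?j) (\<sigma> X G) \<longleftrightarrow> \<sigma> (Q X v) U = insert ?j (\<sigma> (Q X v) G)"
    if U: "U face_of G" "U \<noteq> {}"
  proof -
    have "G face_of T (Q X v)" using G by (simp add: faces_iff)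
    then have "U face_of T (Q X v)" using U(1) face_of_trans by blast
    then have UF: "U \<in> faces (T (Q X v))" using U(2) by (simp add: faces_iff)
    obtain D where D: "D \<in> chains X" "{v} \<in> D" "U = tface X D" by (rule section_face_chain[OF UF])
    have \<sigma>U: "\<sigma> X U = insert 0 (Suc ` \<sigma> (Q X v) U)" using \<sigma>_link[OF D(1,2)] D(3) by simp
    have "insert (Suc ?j) (\<sigma> X G) = insert 0 (Suc ` insert ?j (\<sigma> (Q X v) G))"
      using \<sigma>G by auto
    then have "\<sigma> X U = insert (Suc ?j) (\<sigma> X G) \<longleftrightarrow>
        insert 0 (Suc ` \<sigma> (Q X v) U) = insert 0 (Suc ` insert ?j (\<sigma> (Q X v) G))"
      using \<sigma>U by simp
    also have "\<dots> \<longleftrightarrow> Suc ` \<sigma> (Q X v) U = Suc ` insert ?j (\<sigma> (Q X v) G)"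
      by (rule insert_ident) auto
    also have "\<dots> \<longleftrightarrow> \<sigma> (Q X v) U = insert ?j (\<sigma> (Q X v) G)"
      by (rule inj_image_eq_iff) simp
    finally show ?thesis .
  qed
  have end_face: "U face_of G \<and> U \<noteq> {}" if h: "is_end_face q Z G U" for Z
  proof -
    have "U face_of G" using h unfolding is_end_face_def by (elim conjE)
    moreover have "\<exists>u\<in>vertices G. (\<forall>w\<in>vertices G. q \<bullet> w \<le> q \<bullet> u) \<and> u \<in> U"
      using h unfolding is_end_face_def by (elim conjE)
    ultimately show ?thesis by auto
  qed
  show ?thesis
  proof (cases "U face_of G \<and> U \<noteq> {}")
    case True
    then show ?thesis unfolding is_end_face_def least by (simp only: labels[OF conjunct1[OF True] conjunct2[OF True]])
  next
    case False
    then show ?thesis using end_face[of X] end_face[of "Q X v"] by argo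
  qed
qed

lemma section_vertex_ne:
  assumes inj: "inj_on (\<lambda>x. q \<bullet> x) (vertices X)" and u: "u \<in> vertices (Q X v)"
  shows "q \<bullet> u \<noteq> q \<bullet> v"
  by (rule sl.vertex_slice_vertex_ne[unfolded hyp_eq, OF inj u[unfolded Q_def]])

end

end

subsection \<open>Upper, middle and lower faces\<close>

context swept_truncation
begin

definition lower_faces :: "nat \<Rightarrow> 'a set \<Rightarrow> 'a \<Rightarrow> 'a set set" where
  "lower_faces r X v = {G \<in> faces (T (Q X v)). G \<subseteq> {x. p r \<bullet> x < p r \<bullet> v}}"

text \<open>The geometric input of the combinatorial argument at \<open>X\<close>. The index is one
  below the dimension of \<open>X\<close>: it is the dimension of the vertex sections.\<close>

definition swept :: "nat \<Rightarrow> nat \<Rightarrow> 'a set \<Rightarrow> bool" where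
  "swept n r X \<longleftrightarrow> simple_truncation (Suc n) X \<and> ordered_near_vertices (p r) X \<and>
     inj_on (\<lambda>x. p r \<bullet> x) (vertices X) \<and>
     (\<forall>v\<in>vertices X. simple_truncation n (Q X v) \<and> vertex_section X v \<and>
        above_near_faces (p r) (p r \<bullet> v) (Q X v) \<and> above_near_faces (- p r) (- (p r \<bullet> v)) (Q X v))"

text \<open>For \<open>p r\<close> this is the vertex that the top face inserts into the chain, for
  \<open>- p r\<close> the one inserted by the bottom face.\<close>

definition apex :: "'a \<Rightarrow> 'a set \<Rightarrow> 'a set set \<Rightarrow> 'a \<Rightarrow> bool" where
  "apex q X C v \<longleftrightarrow> v \<in> vertices X \<and> v \<in> base X C \<and>
     (\<forall>u\<in>vertices X. u \<in> base X C \<longrightarrow> u \<noteq> v \<longrightarrow> q \<bullet> u < q \<bullet> v)"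

lemma ordered_near_vertices_uminus:
  assumes "ordered_near_vertices q X"
  shows "ordered_near_vertices (- q) X"
  unfolding ordered_near_vertices_def
proof (intro ballI impI)
  fix u v y z
  assume *: "u \<in> vertices X" "v \<in> vertices X" "- q \<bullet> u < - q \<bullet> v" "y \<in> tface X {{u}}" "z \<in> tface X {{v}}"
  then have "q \<bullet> v < q \<bullet> u" by simp
  then have "q \<bullet> z < q \<bullet> y" using assms *(1,2,4,5) unfolding ordered_near_vertices_def by blast
  then show "- q \<bullet> y < - q \<bullet> z" by simp
qed

lemma inj_on_uminus_inner: "inj_on (\<lambda>x. q \<bullet> x) A \<Longrightarrow> inj_on (\<lambda>x. - q \<bullet> x) A"
  by (simp add: inj_on_def)

lemma singleton_chain_unique:
  assumes "polytope X" "C \<in> chains X" "{v} \<in> C" "{w} \<in> C"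
  shows "v = w"
proof -
  have "v \<in> \<Inter>C" using vertex_in_base(1)[OF assms(1-3)] unfolding base_def by (rule IntD2)
  then have "v \<in> {w}" using assms(4) by (rule InterD)
  then show ?thesis by simp
qed

context
  fixes n r :: nat and X :: "'a set"
  assumes sw: "swept n r X"
begin

lemma sw_st: "simple_truncation (Suc n) X"
  using sw unfolding swept_def by (elim conjE)

lemma sw_ord: "ordered_near_vertices (p r) X"
  using sw unfolding swept_def by (elim conjE)

lemma sw_inj: "inj_on (\<lambda>x. p r \<bullet> x) (vertices X)"
  using sw unfolding swept_def by (elim conjE)

lemma sw_vertex:
  assumes "v \<in> vertices X"
  shows "simple_truncation n (Q X v)" "vertex_section X v"
    "above_near_faces (p r) (p r \<bullet> v) (Q X v)" "above_near_faces (- p r) (- (p r \<bullet> v)) (Q X v)"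
proof -
  have "\<forall>v\<in>vertices X. simple_truncation n (Q X v) \<and> vertex_section X v \<and>
        above_near_faces (p r) (p r \<bullet> v) (Q X v) \<and> above_near_faces (- p r) (- (p r \<bullet> v)) (Q X v)"
    using sw unfolding swept_def by (elim conjE)
  then have *: "simple_truncation n (Q X v) \<and> vertex_section X v \<and>
        above_near_faces (p r) (p r \<bullet> v) (Q X v) \<and> above_near_faces (- p r) (- (p r \<bullet> v)) (Q X v)"
    using assms by (rule bspec)
  from * show "simple_truncation n (Q X v)" by (elim conjE)
  from * show "vertex_section X v" by (elim conjE)
  from * show "above_near_faces (p r) (p r \<bullet> v) (Q X v)" by (elim conjE)
  from * show "above_near_faces (- p r) (- (p r \<bullet> v)) (Q X v)" by (elim conjE)
qed

lemma sw_polytope: "polytope X"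
  using st_polytope[OF sw_st] .

lemma apex_exists:
  assumes inj: "inj_on (\<lambda>x. q \<bullet> x) (vertices X)" and C: "C \<in> chains X"
  obtains v where "apex q X C v"
proof -
  let ?B = "base X C"
  have v: "vertices ?B = vertices X \<inter> ?B" using vertices_face[OF base_face[OF sw_polytope C]] .
  have "finite (vertices ?B)" "vertices ?B \<noteq> {}"
    using finite_vertices vertices_nonempty base_polytope[OF sw_polytope C]
      base_nonempty[OF sw_polytope st_nonempty[OF sw_st] C] by auto
  then obtain u where u: "u \<in> vertices ?B" "\<And>w. w \<in> vertices ?B \<Longrightarrow> q \<bullet> w \<le> q \<bullet> u"
    using finite_arg_max[of "vertices ?B" "\<lambda>x. q \<bullet> x"] by blast
  have "q \<bullet> w < q \<bullet> u" if w: "w \<in> vertices X" "w \<in> ?B" "w \<noteq> u" for w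
  proof -
    have "q \<bullet> w \<noteq> q \<bullet> u" using inj_onD[OF inj, of w u] w u(1) v by blast
    moreover have "q \<bullet> w \<le> q \<bullet> u" using u(2) w v by blast
    ultimately show ?thesis by simp
  qed
  then have "apex q X C u" using u(1) v by (simp add: apex_def)
  then show ?thesis by (rule that)
qed

lemma apex_end_face_iff:
  assumes "ordered_near_vertices q X" "C \<in> chains X" "0 \<notin> \<sigma> X (tface X C)" "apex q X C v"
  shows "is_end_face q X (tface X C) U \<longleftrightarrow> U = tface X (insert {v} C)"
  by (rule is_end_face_iff[OF sw_st _ assms(1-3)]) (use assms(4) in \<open>auto simp: apex_def\<close>)

lemma apex_chain:
  assumes "C \<in> chains X" "apex q X C v"
  shows "insert {v} C \<in> chains X"
  by (rule insert_vertex_chain[OF sw_polytope assms(1)])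
    (use assms(2) st_dim[OF sw_st] in \<open>auto simp: apex_def\<close>)

lemma top_iff:
  assumes "C \<in> chains X" "0 \<notin> \<sigma> X (tface X C)" "apex (p r) X C v"
  shows "is_top r X (tface X C) U \<longleftrightarrow> U = tface X (insert {v} C)"
  unfolding is_top_def by (rule apex_end_face_iff[OF sw_ord assms])

lemma bottom_iff:
  assumes "C \<in> chains X" "0 \<notin> \<sigma> X (tface X C)" "apex (- p r) X C v"
  shows "is_bottom r X (tface X C) U \<longleftrightarrow> U = tface X (insert {v} C)"
  unfolding is_bottom_def by (rule apex_end_face_iff[OF ordered_near_vertices_uminus[OF sw_ord] assms])

lemma \<tau>_tface:
  assumes "C \<in> chains X" "0 \<notin> \<sigma> X (tface X C)" "apex (p r) X C v"
  shows "\<tau> r X (tface X C) = tface X (insert {v} C)"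
  unfolding \<tau>_def top_iff[OF assms] by simp

lemma \<beta>_tface:
  assumes "C \<in> chains X" "0 \<notin> \<sigma> X (tface X C)" "apex (- p r) X C v"
  shows "\<beta> r X (tface X C) = tface X (insert {v} C)"
  unfolding \<beta>_def bottom_iff[OF assms] by simp

lemma top_exists:
  assumes G: "G \<in> faces (T X)" "0 \<notin> \<sigma> X G"
  obtains C v where "C \<in> chains X" "G = tface X C" "apex (p r) X C v" "\<tau> r X G = tface X (insert {v} C)"
    "\<exists>!U. is_top r X G U"
proof -
  obtain C where C: "C \<in> chains X" "G = tface X C" by (rule faces_T[OF sw_st G(1)])
  obtain v where v: "apex (p r) X C v" by (rule apex_exists[OF sw_inj C(1)])
  have 0: "0 \<notin> \<sigma> X (tface X C)" using G(2) C(2) by simp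
  show ?thesis
  proof (rule that[OF C v])
    show "\<tau> r X G = tface X (insert {v} C)" using \<tau>_tface[OF C(1) 0 v] C(2) by simp
    show "\<exists>!U. is_top r X G U" unfolding C(2) top_iff[OF C(1) 0 v] by simp
  qed
qed

lemma bottom_exists:
  assumes G: "G \<in> faces (T X)" "0 \<notin> \<sigma> X G"
  obtains C v where "C \<in> chains X" "G = tface X C" "apex (- p r) X C v" "\<beta> r X G = tface X (insert {v} C)"
    "\<exists>!U. is_bottom r X G U"
proof -
  obtain C where C: "C \<in> chains X" "G = tface X C" by (rule faces_T[OF sw_st G(1)])
  obtain v where v: "apex (- p r) X C v" by (rule apex_exists[OF inj_on_uminus_inner[OF sw_inj] C(1)])
  have 0: "0 \<notin> \<sigma> X (tface X C)" using G(2) C(2) by simp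
  show ?thesis
  proof (rule that[OF C v])
    show "\<beta> r X G = tface X (insert {v} C)" using \<beta>_tface[OF C(1) 0 v] C(2) by simp
    show "\<exists>!U. is_bottom r X G U" unfolding C(2) bottom_iff[OF C(1) 0 v] by simp
  qed
qed

lemma no_vertex_in_chain:
  assumes "C \<in> chains X" "0 \<notin> \<sigma> X (tface X C)"
  shows "{w} \<notin> C"
proof
  assume w: "{w} \<in> C"
  then have "w \<in> vertices X" by (rule vertex_in_base(2)[OF sw_polytope assms(1)])
  with w have "\<exists>v\<in>vertices X. {v} \<in> C" by (rule bexI)
  then show False using assms(2) zero_label_iff[OF sw_st assms(1)] by simp
qed

context
  fixes v assumes v: "v \<in> vertices X"
begin

lemmas sec_prems = sw_st v sw_vertex(2)[OF v] sw_vertex(1)[OF v]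

lemma sec_ne: "u \<in> vertices (Q X v) \<Longrightarrow> p r \<bullet> u \<noteq> p r \<bullet> v"
  by (rule section_vertex_ne[OF sec_prems sw_inj])

lemmas sides_prems = sw_vertex(1)[OF v] sw_vertex(3)[OF v] sw_vertex(4)[OF v] sec_ne

text \<open>By convexity, a face with points on both closed sides meets the level.\<close>

lemma face_sides:
  assumes G: "G \<in> faces (T (Q X v))"
  shows "G \<in> upper_faces r X v \<or> G \<in> middle_faces r X v \<or> G \<in> lower_faces r X v"
proof (rule ccontr)
  assume n: "\<not> ?thesis"
  have cG: "convex G" using G face_of_imp_convex by (auto simp: faces_iff)
  have "\<not> G \<subseteq> Hplus r v" using n G by (auto simp: upper_faces_def)
  then obtain x where "x \<in> G" "x \<notin> Hplus r v" by blast
  then have x: "x \<in> G" "p r \<bullet> x \<le> p r \<bullet> v" by (simp_all add: Hplus_def)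
  have "\<not> G \<subseteq> {x. p r \<bullet> x < p r \<bullet> v}" using n G by (auto simp: lower_faces_def)
  then obtain y where "y \<in> G" "\<not> p r \<bullet> y < p r \<bullet> v" by blast
  then have y: "y \<in> G" "p r \<bullet> v \<le> p r \<bullet> y" by simp_all
  obtain z where z: "z \<in> G" "p r \<bullet> z = p r \<bullet> v"
  proof (cases "p r \<bullet> x = p r \<bullet> v")
    case True
    then show ?thesis using that[OF x(1)] by simp
  next
    case False
    define t where "t = (p r \<bullet> v - p r \<bullet> x) / (p r \<bullet> y - p r \<bullet> x)"
    have lt: "p r \<bullet> x < p r \<bullet> v" "p r \<bullet> x < p r \<bullet> y" using False x(2) y(2) by auto
    have t: "0 \<le> t" "t \<le> 1" using lt y(2) by (auto simp: t_def field_simps)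
    have "(1 - t) *\<^sub>R x + t *\<^sub>R y \<in> G" using cG x(1) y(1) t by (rule convexD_alt)
    moreover have "t * (p r \<bullet> y - p r \<bullet> x) = p r \<bullet> v - p r \<bullet> x" using lt by (simp add: t_def)
    then have "p r \<bullet> ((1 - t) *\<^sub>R x + t *\<^sub>R y) = p r \<bullet> v" by (simp add: inner_add_right algebra_simps)
    ultimately show ?thesis by (rule that)
  qed
  then have "G \<in> middle_faces r X v" using G by (auto simp: middle_faces_def H_def)
  then show False using n by blast
qed

lemma upper_middle_disjoint: "upper_faces r X v \<inter> middle_faces r X v = {}"
proof -
  have "Hplus r v \<inter> H r v = {}" by (auto simp: Hplus_def H_def)
  then show ?thesis unfolding upper_faces_def middle_faces_def by blast
qed

lemma upper_lower_disjoint: "upper_faces r X v \<inter> lower_faces r X v = {}"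
proof -
  have "x \<in> G \<Longrightarrow> G \<in> upper_faces r X v \<Longrightarrow> G \<notin> lower_faces r X v" for G x
    unfolding upper_faces_def lower_faces_def Hplus_def by fastforce
  moreover have "G \<noteq> {}" if "G \<in> upper_faces r X v" for G
    using that by (simp add: upper_faces_def faces_iff)
  ultimately show ?thesis by blast
qed

lemma middle_lower_disjoint: "middle_faces r X v \<inter> lower_faces r X v = {}"
proof -
  have "{x. p r \<bullet> x < p r \<bullet> v} \<inter> H r v = {}" by (auto simp: H_def)
  then show ?thesis unfolding lower_faces_def middle_faces_def by blast
qed

context
  fixes C assumes C: "C \<in> chains X" and vC: "{v} \<in> C"
begin

lemma base_vertices: "vertices (base X (C - {{v}})) = vertices X \<inter> base X (C - {{v}})"
  by (rule vertices_face[OF base_face'[OF sec_prems C vC]])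

text \<open>The position relative to the level is decided on the vertex figure of the base, and that
  lies above \<open>v\<close> iff \<open>v\<close> is the lowest vertex of the base. So the upper
  faces at \<open>v\<close> are the bottom faces that arise by inserting \<open>v\<close>.\<close>

lemma tface_upper_iff: "tface X C \<in> upper_faces r X v \<longleftrightarrow> apex (- p r) X (C - {{v}}) v"
proof -
  have "tface X C \<in> upper_faces r X v \<longleftrightarrow> (\<forall>y\<in>tface X C. p r \<bullet> v < p r \<bullet> y)"
    using section_faces_iff[OF sec_prems C] vC by (auto simp: upper_faces_def Hplus_def)
  also have "\<dots> \<longleftrightarrow> (\<forall>u\<in>vertices (base (Q X v) (link v C)). p r \<bullet> v < p r \<bullet> u)"
    using tface_above_iff[OF sides_prems link_chain[OF sec_prems C vC]] tface_link[OF sec_prems C vC] by simp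
  also have "\<dots> \<longleftrightarrow> (\<forall>w\<in>vertices (base X (C - {{v}})). w \<noteq> v \<longrightarrow> p r \<bullet> v < p r \<bullet> w)"
    by (rule base_link_above_iff[OF sec_prems C vC])
  also have "\<dots> \<longleftrightarrow> apex (- p r) X (C - {{v}}) v"
    using v v_in_base[OF sec_prems C vC] by (simp add: base_vertices apex_def) blast
  finally show ?thesis .
qed

lemma tface_lower_iff: "tface X C \<in> lower_faces r X v \<longleftrightarrow> apex (p r) X (C - {{v}}) v"
proof -
  have "tface X C \<in> lower_faces r X v \<longleftrightarrow> (\<forall>y\<in>tface X C. p r \<bullet> y < p r \<bullet> v)"
    using section_faces_iff[OF sec_prems C] vC by (auto simp: lower_faces_def)
  also have "\<dots> \<longleftrightarrow> (\<forall>u\<in>vertices (base (Q X v) (link v C)). p r \<bullet> u < p r \<bullet> v)"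
    using tface_below_iff[OF sides_prems link_chain[OF sec_prems C vC]] tface_link[OF sec_prems C vC] by simp
  also have "\<dots> \<longleftrightarrow> (\<forall>u\<in>vertices (base (Q X v) (link v C)). (- p r) \<bullet> v < (- p r) \<bullet> u)"
    by simp
  also have "\<dots> \<longleftrightarrow> (\<forall>w\<in>vertices (base X (C - {{v}})). w \<noteq> v \<longrightarrow> (- p r) \<bullet> v < (- p r) \<bullet> w)"
    by (rule base_link_above_iff[OF sec_prems C vC])
  also have "\<dots> \<longleftrightarrow> apex (p r) X (C - {{v}}) v"
    using v v_in_base[OF sec_prems C vC] by (simp add: base_vertices apex_def) blast
  finally show ?thesis .
qed

lemma star_zero_free: "0 \<notin> \<sigma> X (tface X (C - {{v}}))"
proof
  assume "0 \<in> \<sigma> X (tface X (C - {{v}}))"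
  then obtain w where "{w} \<in> C - {{v}}"
    using zero_label_iff[OF sw_st sub_chain[OF sec_prems C vC]] by blast
  then show False using singleton_chain_unique[OF sw_polytope C vC, of w] by blast
qed

end

lemma upper_is_bottom:
  assumes U: "U \<in> upper_faces r X v"
  obtains G where "G \<in> faces (T X)" "0 \<notin> \<sigma> X G" "\<beta> r X G = U"
proof -
  have "U \<in> faces (T (Q X v))" using U by (simp add: upper_faces_def)
  from section_face_chain[OF sec_prems this]
  obtain C where C: "C \<in> chains X" "{v} \<in> C" "U = tface X C" .
  have ap: "apex (- p r) X (C - {{v}}) v" using tface_upper_iff[OF C(1,2)] U C(3) by simp
  have sub: "C - {{v}} \<in> chains X" by (rule sub_chain[OF sec_prems C(1,2)])
  have "insert {v} (C - {{v}}) = C" using C(2) by blast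
  then have "\<beta> r X (tface X (C - {{v}})) = U"
    using \<beta>_tface[OF sub star_zero_free[OF C(1,2)] ap] C(3) by simp
  then show ?thesis using tface_faces[OF sw_st sub] star_zero_free[OF C(1,2)] that by metis
qed

lemma lower_is_top:
  assumes U: "U \<in> lower_faces r X v"
  obtains G where "G \<in> faces (T X)" "0 \<notin> \<sigma> X G" "\<tau> r X G = U"
proof -
  have "U \<in> faces (T (Q X v))" using U by (simp add: lower_faces_def)
  from section_face_chain[OF sec_prems this]
  obtain C where C: "C \<in> chains X" "{v} \<in> C" "U = tface X C" .
  have ap: "apex (p r) X (C - {{v}}) v" using tface_lower_iff[OF C(1,2)] U C(3) by simp
  have sub: "C - {{v}} \<in> chains X" by (rule sub_chain[OF sec_prems C(1,2)])
  have "insert {v} (C - {{v}}) = C" using C(2) by blast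
  then have "\<tau> r X (tface X (C - {{v}})) = U"
    using \<tau>_tface[OF sub star_zero_free[OF C(1,2)] ap] C(3) by simp
  then show ?thesis using tface_faces[OF sw_st sub] star_zero_free[OF C(1,2)] that by metis
qed

text \<open>A middle face meets both sides of the sweep hyperplane, hence so does its base in \<open>Q X v\<close>.\<close>

lemma middle_base:
  assumes G: "G \<in> middle_faces r X v"
  obtains D u u' where "D \<in> chains (Q X v)" "G = tface (Q X v) D"
    "u \<in> vertices (base (Q X v) D)" "p r \<bullet> u < p r \<bullet> v"
    "u' \<in> vertices (base (Q X v) D)" "p r \<bullet> v < p r \<bullet> u'"
proof -
  have GF: "G \<in> faces (T (Q X v))" using G by (simp add: middle_faces_def)
  obtain D where D: "D \<in> chains (Q X v)" "G = tface (Q X v) D" by (rule faces_T[OF sw_vertex(1)[OF v] GF])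
  obtain x where x: "x \<in> G" "p r \<bullet> x = p r \<bullet> v" using G by (auto simp: middle_faces_def H_def)
  have ne: "p r \<bullet> u \<noteq> p r \<bullet> v" if "u \<in> vertices (base (Q X v) D)" for u
    using sec_ne vertices_face[OF base_face[OF st_polytope[OF sw_vertex(1)[OF v]] D(1)]] that by blast
  have "\<not> (\<forall>y\<in>tface (Q X v) D. p r \<bullet> v < p r \<bullet> y)" using x D(2) by force
  then have "\<exists>u\<in>vertices (base (Q X v) D). \<not> p r \<bullet> v < p r \<bullet> u"
    using tface_above_iff[OF sides_prems D(1)] by meson
  then obtain u where u: "u \<in> vertices (base (Q X v) D)" "\<not> p r \<bullet> v < p r \<bullet> u" by (rule bexE)
  have "\<not> (\<forall>y\<in>tface (Q X v) D. p r \<bullet> y < p r \<bullet> v)" using x D(2) by force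
  then have "\<exists>u\<in>vertices (base (Q X v) D). \<not> p r \<bullet> u < p r \<bullet> v"
    using tface_below_iff[OF sides_prems D(1)] by meson
  then obtain u' where u': "u' \<in> vertices (base (Q X v) D)" "\<not> p r \<bullet> u' < p r \<bullet> v" by (rule bexE)
  have "p r \<bullet> u < p r \<bullet> v" using ne[OF u(1)] u(2) by simp
  moreover have "p r \<bullet> v < p r \<bullet> u'" using ne[OF u'(1)] u'(2) by simp
  ultimately show ?thesis by (rule that[OF D u(1) _ u'(1)])
qed

text \<open>Vertices of the base on both sides of the level give it at least two points. This
  excludes a section that is a point and a chain that contains a vertex.\<close>

lemma middle_zero_free:
  assumes G: "G \<in> middle_faces r X v"
  shows "0 < n" "0 \<notin> \<sigma> (Q X v) G"
proof -
  obtain D u u' where D: "D \<in> chains (Q X v)" "G = tface (Q X v) D"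
    "u \<in> vertices (base (Q X v) D)" "p r \<bullet> u < p r \<bullet> v"
    "u' \<in> vertices (base (Q X v) D)" "p r \<bullet> v < p r \<bullet> u'"
    by (rule middle_base[OF G])
  have uu: "u \<in> base (Q X v) D" "u' \<in> base (Q X v) D" "u \<noteq> u'"
    using D(3-6) vertices_subset by force+
  show "0 < n"
  proof (rule ccontr)
    assume "\<not> 0 < n"
    then have "aff_dim (Q X v) = 0" using st_dim[OF sw_vertex(1)[OF v]] by simp
    then obtain x where "Q X v = {x}" using aff_dim_eq_0 by blast
    then show False using uu by (simp add: base_def)
  qed
  show "0 \<notin> \<sigma> (Q X v) G"
  proof
    assume "0 \<in> \<sigma> (Q X v) G"
    then obtain w where "{w} \<in> D" unfolding D(2) zero_label_iff[OF sw_vertex(1)[OF v] D(1)] by blast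
    then have "base (Q X v) D \<subseteq> {w}" by (auto simp: base_def)
    then show False using uu by blast
  qed
qed

lemma top_section_iff: "G \<in> faces (T (Q X v)) \<Longrightarrow> is_top r X G U \<longleftrightarrow> is_top r (Q X v) G U"
  unfolding is_top_def by (rule is_end_face_section_iff[OF sec_prems])

lemma \<tau>_section:
  assumes "G \<in> faces (T (Q X v))"
  shows "\<tau> r X G = \<tau> r (Q X v) G"
proof -
  have "is_top r X G = is_top r (Q X v) G" by (rule ext) (rule top_section_iff[OF assms])
  then show ?thesis by (simp add: \<tau>_def)
qed

interpretation slT: transversal_slice "T (Q X v)" "p r" "p r \<bullet> v"
proof
  show "polytope (T (Q X v))" by (rule T_polytope[OF sw_vertex(1)[OF v]])
  show "p r \<bullet> u \<noteq> p r \<bullet> v" if "u \<in> vertices (T (Q X v))" for u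
    by (rule T_vertex_ne[OF sides_prems that])
qed

lemma H_eq: "{x. p r \<bullet> x = p r \<bullet> v} = H r v"
  by (simp add: H_def)

lemma T_R: "T (R r X v) = T (Q X v) \<inter> H r v"
  by (auto simp: T_def R_def)

lemma middle_section_faces: "G \<in> middle_faces r X v \<Longrightarrow> G \<inter> H r v \<in> faces (T (R r X v))"
  unfolding T_R slT.slice_faces[unfolded H_eq] middle_faces_def by (auto simp: faces_iff)

text \<open>The sweep hyperplane is transversal to the truncated section, so a face is determined by
  its nonempty slice.\<close>

lemma section_face_middle:
  assumes "F \<in> faces (T (R r X v))"
  shows "\<exists>!G. G \<in> middle_faces r X v \<and> G \<inter> H r v = F"
proof -
  obtain G where G: "F = G \<inter> H r v" "G face_of T (Q X v)" "G \<inter> H r v \<noteq> {}"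
    using assms unfolding T_R slT.slice_faces[unfolded H_eq] by blast
  then have Gm: "G \<in> middle_faces r X v" by (auto simp: middle_faces_def faces_iff)
  show ?thesis
  proof (rule ex1I[of _ G])
    show "G \<in> middle_faces r X v \<and> G \<inter> H r v = F" using Gm G(1) by simp
    fix G' assume G': "G' \<in> middle_faces r X v \<and> G' \<inter> H r v = F"
    then have "G' face_of T (Q X v)" by (simp add: middle_faces_def faces_iff)
    then show "G' = G"
      using slT.slice_eq_iff[unfolded H_eq, OF G(2,3), of G'] G' G(1) by simp
  qed
qed

end

lemma top_lower:
  assumes G: "G \<in> faces (T X)" "0 \<notin> \<sigma> X G"
  obtains v where "v \<in> vertices X" "\<tau> r X G \<in> lower_faces r X v"
proof -
  obtain C v where C: "C \<in> chains X" "G = tface X C" "apex (p r) X C v" "\<tau> r X G = tface X (insert {v} C)"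
    by (rule top_exists[OF G])
  have v: "v \<in> vertices X" using C(3) by (simp add: apex_def)
  have "{v} \<notin> C" using no_vertex_in_chain[OF C(1)] G(2) C(2) by simp
  then have "insert {v} C - {{v}} = C" by blast
  then have "\<tau> r X G \<in> lower_faces r X v"
    using tface_lower_iff[OF v apex_chain[OF C(1,3)]] C(3,4) by simp
  with v show ?thesis by (rule that)
qed

lemma bottom_upper:
  assumes G: "G \<in> faces (T X)" "0 \<notin> \<sigma> X G"
  obtains v where "v \<in> vertices X" "\<beta> r X G \<in> upper_faces r X v"
proof -
  obtain C v where C: "C \<in> chains X" "G = tface X C" "apex (- p r) X C v" "\<beta> r X G = tface X (insert {v} C)"
    by (rule bottom_exists[OF G])
  have v: "v \<in> vertices X" using C(3) by (simp add: apex_def)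
  have "{v} \<notin> C" using no_vertex_in_chain[OF C(1)] G(2) C(2) by simp
  then have "insert {v} C - {{v}} = C" by blast
  then have "\<beta> r X G \<in> upper_faces r X v"
    using tface_upper_iff[OF v apex_chain[OF C(1,3)]] C(3,4) by simp
  with v show ?thesis by (rule that)
qed

text \<open>The inserted vertex is the only singleton in the result, so deleting it recovers the
  chain. This makes \<tau> and \<beta> injective on faces without label 0.\<close>

lemma insert_vertex_eq:
  assumes "C \<in> chains X" "C' \<in> chains X" "0 \<notin> \<sigma> X (tface X C)" "0 \<notin> \<sigma> X (tface X C')"
    "insert {v} C = insert {v'} C'"
  shows "C = C'"
proof -
  have sub: "D \<subseteq> D'" if D: "\<And>w. {w} \<notin> D" "insert {x} D = insert {y} D'" for D D' :: "'a set set" and x y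
  proof
    fix E assume E: "E \<in> D"
    then have "E \<in> insert {y} D'" unfolding D(2)[symmetric] by simp
    moreover have "E \<noteq> {y}" using E D(1)[of y] by metis
    ultimately show "E \<in> D'" by simp
  qed
  show ?thesis
  proof (rule equalityI)
    show "C \<subseteq> C'" by (rule sub[OF no_vertex_in_chain[OF assms(1,3)] assms(5)])
    show "C' \<subseteq> C" by (rule sub[OF no_vertex_in_chain[OF assms(2,4)] assms(5)[symmetric]])
  qed
qed

lemma \<tau>_inj:
  assumes G: "G \<in> faces (T X)" "0 \<notin> \<sigma> X G" and G': "G' \<in> faces (T X)" "0 \<notin> \<sigma> X G'"
    and eq: "\<tau> r X G = \<tau> r X G'"
  shows "G = G'"
proof -
  obtain C v where C: "C \<in> chains X" "G = tface X C" "apex (p r) X C v" "\<tau> r X G = tface X (insert {v} C)"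
    by (rule top_exists[OF G])
  obtain C' v' where C': "C' \<in> chains X" "G' = tface X C'" "apex (p r) X C' v'" "\<tau> r X G' = tface X (insert {v'} C')"
    by (rule top_exists[OF G'])
  have vC: "insert {v} C = insert {v'} C'"
    using tface_eq_iff[OF sw_st apex_chain[OF C(1,3)] apex_chain[OF C'(1,3)]] eq C(4) C'(4) by simp
  have "C = C'"
    by (rule insert_vertex_eq[OF C(1) C'(1) _ _ vC]) (use G(2) G'(2) C(2) C'(2) in simp_all)
  then show ?thesis using C(2) C'(2) by simp
qed

lemma \<beta>_inj:
  assumes G: "G \<in> faces (T X)" "0 \<notin> \<sigma> X G" and G': "G' \<in> faces (T X)" "0 \<notin> \<sigma> X G'"
    and eq: "\<beta> r X G = \<beta> r X G'"
  shows "G = G'"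
proof -
  obtain C v where C: "C \<in> chains X" "G = tface X C" "apex (- p r) X C v" "\<beta> r X G = tface X (insert {v} C)"
    by (rule bottom_exists[OF G])
  obtain C' v' where C': "C' \<in> chains X" "G' = tface X C'" "apex (- p r) X C' v'" "\<beta> r X G' = tface X (insert {v'} C')"
    by (rule bottom_exists[OF G'])
  have vC: "insert {v} C = insert {v'} C'"
    using tface_eq_iff[OF sw_st apex_chain[OF C(1,3)] apex_chain[OF C'(1,3)]] eq C(4) C'(4) by simp
  have "C = C'"
    by (rule insert_vertex_eq[OF C(1) C'(1) _ _ vC]) (use G(2) G'(2) C(2) C'(2) in simp_all)
  then show ?thesis using C(2) C'(2) by simp
qed

text \<open>A chain contains at most one vertex; hence a face with label 0 determines the vertex at
  which it is treated.\<close>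

lemma section_faces_unique:
  assumes v: "v \<in> vertices X" and w: "w \<in> vertices X"
    and G: "G \<in> faces (T (Q X v))" "G \<in> faces (T (Q X w))"
  shows "v = w"
proof -
  from section_face_chain[OF sec_prems[OF v] G(1)]
  obtain C where C: "C \<in> chains X" "{v} \<in> C" "G = tface X C" .
  have "{w} \<in> C" using section_faces_iff[OF sec_prems[OF w] C(1)] G(2) C(3) by simp
  then show ?thesis using singleton_chain_unique[OF sw_polytope C(1,2)] by blast
qed

lemma zero_label_section_iff:
  assumes G: "G \<in> faces (T X)"
  shows "0 \<in> \<sigma> X G \<longleftrightarrow> (\<exists>v\<in>vertices X. G \<in> faces (T (Q X v)))"
proof -
  obtain C where C: "C \<in> chains X" "G = tface X C" by (rule faces_T[OF sw_st G])
  show ?thesis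
    unfolding C(2) zero_label_iff[OF sw_st C(1)]
    using section_faces_iff[OF sec_prems C(1)] by (intro bex_cong refl) simp
qed

lemma section_faces_T: "v \<in> vertices X \<Longrightarrow> faces (T (Q X v)) \<subseteq> faces (T X)"
  by (rule section_faces_subset[OF sec_prems])

end

section \<open>Sections at vertices of a section\<close>

context
  fixes n r :: nat and X :: "'a set" and v :: 'a
  assumes sw: "swept (Suc n) r X" and v: "v \<in> vertices X" and swY: "swept n r (Q X v)"
begin

text \<open>The top inserts the highest vertex \<open>w\<close> of the base of \<open>G\<close> in
  the section. The base of a middle face has a vertex above the level, so \<open>w\<close> is above
  it, and with \<open>w\<close> the whole face near it.\<close>

lemma middle_top:
  assumes G: "G \<in> middle_faces r X v"
  shows "\<exists>!U. is_top r X G U" "\<tau> r X G \<in> upper_faces r X v" "\<tau> r X G = \<tau> r (Q X v) G"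
proof -
  note stY = sw_vertex(1)[OF sw v]
  have GF: "G \<in> faces (T (Q X v))" using G by (simp add: middle_faces_def)
  have z: "0 \<notin> \<sigma> (Q X v) G" by (rule middle_zero_free(2)[OF sw v G])
  obtain D u u' where D: "D \<in> chains (Q X v)" "G = tface (Q X v) D"
    "u \<in> vertices (base (Q X v) D)" "p r \<bullet> u < p r \<bullet> v"
    "u' \<in> vertices (base (Q X v) D)" "p r \<bullet> v < p r \<bullet> u'"
    by (rule middle_base[OF sw v G])
  have z': "0 \<notin> \<sigma> (Q X v) (tface (Q X v) D)" using z D(2) by simp
  obtain w where w: "apex (p r) (Q X v) D w" by (rule apex_exists[OF swY sw_inj[OF swY] D(1)])
  have top: "is_top r (Q X v) G U \<longleftrightarrow> U = tface (Q X v) (insert {w} D)" for U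
    unfolding D(2) by (rule top_iff[OF swY D(1) z' w])
  show "\<exists>!U. is_top r X G U" unfolding top_section_iff[OF sw v GF] top by simp
  show eq: "\<tau> r X G = \<tau> r (Q X v) G" by (rule \<tau>_section[OF sw v GF])
  have W: "insert {w} D \<in> chains (Q X v)" by (rule apex_chain[OF swY D(1) w])
  have \<tau>: "\<tau> r X G = tface (Q X v) (insert {w} D)"
    using eq \<tau>_tface[OF swY D(1) z' w] D(2) by simp
  have "u' \<in> vertices (Q X v)" "u' \<in> base (Q X v) D"
    using D(5) vertices_face[OF base_face[OF st_polytope[OF stY] D(1)]] by auto
  then have "p r \<bullet> u' \<le> p r \<bullet> w" using w by (cases "u' = w") (auto simp: apex_def less_imp_le)
  then have wv: "p r \<bullet> v < p r \<bullet> w" using D(6) by simp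
  have "base (Q X v) (insert {w} D) = {w}" using w by (auto simp: apex_def base_def)
  then have "p r \<bullet> v < p r \<bullet> y" if "y \<in> tface (Q X v) (insert {w} D)" for y
    using tface_above[OF stY sw_vertex(3)[OF sw v] W _ that] wv by simp
  then show "\<tau> r X G \<in> upper_faces r X v"
    using tface_faces[OF stY W] by (auto simp: upper_faces_def \<tau> Hplus_def)
qed

context
  fixes w assumes w: "w \<in> vertices (Q X v)"
begin

lemma vertex_chain: "{{w}} \<in> chains (Q X v)"
  using vertex_proper_face[OF w] st_dim[OF sw_vertex(1)[OF sw v]] by (simp add: chains_def)

lemma vertex_base: "base (Q X v) {{w}} = {w}"
  using w vertices_subset by (auto simp: base_def)

lemma near_upper_vertex:
  assumes "w \<in> Hplus r v"
  shows "T (Q (Q X v) w) \<subseteq> Hplus r v"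
proof
  fix y assume y: "y \<in> T (Q (Q X v) w)"
  have "p r \<bullet> v < p r \<bullet> y"
    using tface_above[OF sw_vertex(1)[OF sw v] sw_vertex(3)[OF sw v] vertex_chain _ y[unfolded T_Q]] assms
    by (simp add: vertex_base Hplus_def)
  then show "y \<in> Hplus r v" by (simp add: Hplus_def)
qed

lemma near_lower_vertex:
  assumes "w \<notin> Hplus r v"
  shows "T (Q (Q X v) w) \<inter> Hplus r v = {}"
proof -
  have "p r \<bullet> w < p r \<bullet> v" using assms sec_ne[OF sw v w] by (simp add: Hplus_def)
  then have "- (p r \<bullet> v) < - p r \<bullet> y" if "y \<in> T (Q (Q X v) w)" for y
    using tface_above[OF sw_vertex(1)[OF sw v] sw_vertex(4)[OF sw v] vertex_chain _ that[unfolded T_Q]]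
    by (simp add: vertex_base)
  then show ?thesis by (force simp: Hplus_def)
qed

text \<open>The vertex inserted by the bottom face is the lowest one of the base; if it is above the
  level, so is all of \<open>G\<close>.\<close>

lemma bottom_upper_vertex:
  assumes G: "G \<in> faces (T (Q X v))" "0 \<notin> \<sigma> (Q X v) G"
    and \<beta>: "\<beta> r (Q X v) G \<in> faces (T (Q (Q X v) w))" and up: "w \<in> Hplus r v"
  shows "G \<in> upper_faces r X v"
proof -
  note stY = sw_vertex(1)[OF sw v]
  obtain D u where D: "D \<in> chains (Q X v)" "G = tface (Q X v) D" "apex (- p r) (Q X v) D u"
    "\<beta> r (Q X v) G = tface (Q X v) (insert {u} D)"
    by (rule bottom_exists[OF swY G])
  have "{w} \<in> insert {u} D"
    using section_faces_iff[OF sec_prems[OF swY w] apex_chain[OF swY D(1,3)]] \<beta> D(4) by simp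
  moreover have "{w} \<notin> D" using no_vertex_in_chain[OF swY D(1)] G(2) D(2) by simp
  ultimately have "w = u" by simp
  then have min: "p r \<bullet> w \<le> p r \<bullet> x" if "x \<in> vertices (base (Q X v) D)" for x
    using D(3) that vertices_face[OF base_face[OF st_polytope[OF stY] D(1)]]
    by (cases "x = u") (auto simp: apex_def less_imp_le)
  have "p r \<bullet> v < p r \<bullet> y" if "y \<in> G" for y
  proof (rule tface_above[OF stY sw_vertex(3)[OF sw v] D(1)])
    show "y \<in> tface (Q X v) D" using that D(2) by simp
    show "p r \<bullet> v < p r \<bullet> x" if "x \<in> vertices (base (Q X v) D)" for x
      using min[OF that] up by (simp add: Hplus_def)
  qed
  then show ?thesis using G(1) by (auto simp: upper_faces_def Hplus_def)
qed

end

end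

end

subsection \<open>Merging pre-blocks\<close>

lemma ex1_unique: "\<exists>!x. P x \<Longrightarrow> P a \<Longrightarrow> P b \<Longrightarrow> a = b"
  by blast

text \<open>The abstract form of Steps 3 and 4. A pre-block is fused into the union belonging to the
  one merging set that it meets, so no pre-block is lost or used twice.\<close>

lemma merge_partition:
  assumes PB: "partition_on F PB"
    and I: "\<And>S. S \<in> I \<Longrightarrow> S \<noteq> {} \<and> S \<subseteq> F"
    and ex1: "\<And>A. A \<in> PB \<Longrightarrow> \<exists>!S. S \<in> I \<and> A \<inter> S \<noteq> {}"
  shows "partition_on F ((\<lambda>S. \<Union>{A \<in> PB. A \<inter> S \<noteq> {}}) ` I)"
proof (rule partition_onI)
  let ?m = "\<lambda>S. \<Union>{A \<in> PB. A \<inter> S \<noteq> {}}"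
  have UF: "\<Union>PB = F" using PB by (simp add: partition_on_def)
  show "\<Union>(?m ` I) = F"
  proof (intro equalityI subsetI)
    fix x assume "x \<in> F"
    then obtain A where A: "A \<in> PB" "x \<in> A" using UF by blast
    obtain S where "S \<in> I" "A \<inter> S \<noteq> {}" using ex1[OF A(1)] by (elim ex1E conjE)
    then show "x \<in> \<Union>(?m ` I)" using A by blast
  qed (use UF in blast)
  show "{} \<notin> ?m ` I"
  proof
    assume "{} \<in> ?m ` I"
    then obtain S where S: "S \<in> I" "?m S = {}" by (metis (no_types, lifting) imageE)
    obtain x where x: "x \<in> S" "x \<in> F" using I[OF S(1)] by blast
    then obtain A where "A \<in> PB" "x \<in> A" using UF by blast
    then show False using S(2) x(1) by blast
  qed
  show "disjnt B B'" if B: "B \<in> ?m ` I" and B': "B' \<in> ?m ` I" and ne: "B \<noteq> B'" for B B'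
  proof (rule ccontr)
    assume "\<not> disjnt B B'"
    then obtain x where x: "x \<in> B" "x \<in> B'" by (auto simp: disjnt_def)
    obtain S S' where S: "S \<in> I" "B = ?m S" and S': "S' \<in> I" "B' = ?m S'" using B B' by blast
    obtain A where A: "A \<in> PB" "A \<inter> S \<noteq> {}" "x \<in> A" using x(1) S(2) by blast
    obtain A' where A': "A' \<in> PB" "A' \<inter> S' \<noteq> {}" "x \<in> A'" using x(2) S'(2) by blast
    have "A = A'"
      using partition_onD2[OF PB] A(1,3) A'(1,3) unfolding disjoint_def by blast
    then have "S = S'" using ex1[OF A(1)] A(2) A'(2) S(1) S'(1) by auto
    then show False using S(2) S'(2) ne by simp
  qed
qed

section \<open>Pre-blocks and their owners without label 0\<close>

context swept_truncation
begin

text \<open>The recursion follows vertex sections: Step 4 depends on the inner structure of the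
  blocks of \<open>Q X v\<close>, whereas the blocks of \<open>R r X v\<close> enter as an abstract
  partition.\<close>

fun swept_rec :: "nat \<Rightarrow> nat \<Rightarrow> 'a set \<Rightarrow> bool" where
  "swept_rec 0 r X \<longleftrightarrow> swept 0 r X"
| "swept_rec (Suc n) r X \<longleftrightarrow> swept (Suc n) r X \<and> (\<forall>v\<in>vertices X. swept_rec n r (Q X v))"

text \<open>Indexing a pre-block by its face without label 0 turns questions of membership into
  equations between values of \<tau> and \<beta>.\<close>

definition preblock :: "nat \<Rightarrow> 'a set \<Rightarrow> 'a set \<Rightarrow> 'a set set" where
  "preblock r X G = {G, \<tau> r X G, \<beta> r X G} \<union>
     {M. \<exists>v\<in>vertices X. M \<in> middle_faces r X v \<and> \<tau> r X M \<in> {G, \<tau> r X G, \<beta> r X G}}"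

definition zero_free :: "'a set \<Rightarrow> 'a set set" where
  "zero_free X = {G \<in> faces (T X). 0 \<notin> \<sigma> X G}"

lemma preblocks_eq: "preblocks r X = preblock r X ` zero_free X"
proof -
  have init: "initial_preblocks r X = (\<lambda>G. {G, \<tau> r X G, \<beta> r X G}) ` zero_free X"
    unfolding initial_preblocks_def zero_free_def by auto
  show ?thesis unfolding preblocks_def init preblock_def[abs_def] image_image ..
qed

lemma swept_rec_swept: "swept_rec n r X \<Longrightarrow> swept n r X"
  by (cases n) simp_all

lemma middle_faces_subset: "middle_faces r X v \<subseteq> faces (T (Q X v))"
  by (auto simp: middle_faces_def)

lemma upper_faces_subset: "upper_faces r X v \<subseteq> faces (T (Q X v))"
  by (auto simp: upper_faces_def)

lemma lower_faces_subset: "lower_faces r X v \<subseteq> faces (T (Q X v))"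
  by (auto simp: lower_faces_def)

context
  fixes n r :: nat and X :: "'a set"
  assumes swr: "swept_rec n r X"
begin

lemmas sw = swept_rec_swept[OF swr]

lemma middle_top':
  assumes v: "v \<in> vertices X" and G: "G \<in> middle_faces r X v"
  shows "\<exists>!U. is_top r X G U" "\<tau> r X G \<in> upper_faces r X v" "\<tau> r X G = \<tau> r (Q X v) G"
proof -
  have "0 < n" by (rule middle_zero_free(1)[OF sw v G])
  then obtain m where m: "n = Suc m" by (cases n) auto
  have 1: "swept (Suc m) r X" using sw m by simp
  have 2: "swept m r (Q X v)" using swr v m swept_rec_swept by simp
  show "\<exists>!U. is_top r X G U" "\<tau> r X G \<in> upper_faces r X v" "\<tau> r X G = \<tau> r (Q X v) G"
    by (rule middle_top[OF 1 v 2 G])+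
qed

lemma zero_free_not_section:
  assumes "G \<in> zero_free X" "v \<in> vertices X"
  shows "G \<notin> faces (T (Q X v))"
proof
  assume "G \<in> faces (T (Q X v))"
  then have "0 \<in> \<sigma> X G"
    using zero_label_section_iff[OF sw] assms by (auto simp: zero_free_def)
  then show False using assms(1) by (simp add: zero_free_def)
qed

lemma \<tau>_lower:
  assumes "G \<in> zero_free X"
  obtains v where "v \<in> vertices X" "\<tau> r X G \<in> lower_faces r X v"
  by (rule top_lower[OF sw]) (use assms that in \<open>auto simp: zero_free_def\<close>)

lemma \<beta>_upper:
  assumes "G \<in> zero_free X"
  obtains v where "v \<in> vertices X" "\<beta> r X G \<in> upper_faces r X v"
  by (rule bottom_upper[OF sw]) (use assms that in \<open>auto simp: zero_free_def\<close>)

text \<open>A top is a lower face at some vertex, and a face belongs to the section at one vertex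
  only.\<close>

lemma upper_not_\<tau>:
  assumes v: "v \<in> vertices X" and U: "U \<in> upper_faces r X v" and G: "G \<in> zero_free X"
  shows "U \<noteq> \<tau> r X G"
proof
  assume eq: "U = \<tau> r X G"
  obtain w where w: "w \<in> vertices X" "\<tau> r X G \<in> lower_faces r X w" by (rule \<tau>_lower[OF G])
  have "v = w"
    by (rule section_faces_unique[OF sw v w(1), of U])
      (use U w(2) eq upper_faces_subset lower_faces_subset in blast)+
  then show False using upper_lower_disjoint[OF sw v] U w(2) eq by blast
qed

lemma upper_in_triple_iff:
  assumes v: "v \<in> vertices X" and U: "U \<in> upper_faces r X v" and G: "G \<in> zero_free X"
  shows "U \<in> {G, \<tau> r X G, \<beta> r X G} \<longleftrightarrow> U = \<beta> r X G"
  using upper_not_\<tau>[OF assms] zero_free_not_section[OF G v] upper_faces_subset U by blast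

text \<open>The top of a middle face is an upper face, and the only upper face among
  \<open>G\<close>, its top and its bottom is the bottom.\<close>

lemma middle_in_preblock_iff:
  assumes v: "v \<in> vertices X" and M: "M \<in> middle_faces r X v" and G: "G \<in> zero_free X"
  shows "M \<in> preblock r X G \<longleftrightarrow> \<tau> r X M = \<beta> r X G"
proof -
  have MF: "M \<in> faces (T (Q X v))" using M middle_faces_subset by blast
  have 1: "M \<noteq> G" using zero_free_not_section[OF G v] MF by blast
  obtain w where w: "w \<in> vertices X" "\<tau> r X G \<in> lower_faces r X w" by (rule \<tau>_lower[OF G])
  have 2: "M \<noteq> \<tau> r X G"
  proof
    assume eq: "M = \<tau> r X G"
    have "v = w"
      by (rule section_faces_unique[OF sw v w(1) MF]) (use w(2) eq lower_faces_subset in blast)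
    then show False using middle_lower_disjoint[OF sw v] M w(2) eq by blast
  qed
  obtain w' where w': "w' \<in> vertices X" "\<beta> r X G \<in> upper_faces r X w'" by (rule \<beta>_upper[OF G])
  have 3: "M \<noteq> \<beta> r X G"
  proof
    assume eq: "M = \<beta> r X G"
    have "v = w'"
      by (rule section_faces_unique[OF sw v w'(1) MF]) (use w'(2) eq upper_faces_subset in blast)
    then show False using upper_middle_disjoint[OF sw v] M w'(2) eq by blast
  qed
  have "M \<in> preblock r X G \<longleftrightarrow> \<tau> r X M \<in> {G, \<tau> r X G, \<beta> r X G}"
    using 1 2 3 v M unfolding preblock_def by blast
  then show ?thesis using upper_in_triple_iff[OF v middle_top'(2)[OF v M] G] by simp
qed

lemma preblock_cases:
  assumes G: "G \<in> zero_free X" and J: "J \<in> preblock r X G"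
  obtains "J = G" | "J = \<tau> r X G" | "J = \<beta> r X G"
  | v where "v \<in> vertices X" "J \<in> middle_faces r X v" "\<tau> r X J = \<beta> r X G"
proof -
  have "J = G \<or> J = \<tau> r X G \<or> J = \<beta> r X G \<or> (\<exists>v\<in>vertices X. J \<in> middle_faces r X v)"
    using J unfolding preblock_def by blast
  then show ?thesis
    using that middle_in_preblock_iff[OF _ _ G, of _ J] J by metis
qed

lemma not_middle_in_preblock:
  assumes "J \<in> preblock r X G" "\<And>v. v \<in> vertices X \<Longrightarrow> J \<notin> middle_faces r X v"
  shows "J \<in> {G, \<tau> r X G, \<beta> r X G}"
  using assms unfolding preblock_def by blast

lemma zero_free_in_preblock_iff:
  assumes J: "J \<in> zero_free X" and G: "G \<in> zero_free X"
  shows "J \<in> preblock r X G \<longleftrightarrow> J = G"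
proof
  assume "J \<in> preblock r X G"
  then have mem: "J \<in> {G, \<tau> r X G, \<beta> r X G}"
    by (rule not_middle_in_preblock) (use zero_free_not_section[OF J] middle_faces_subset in blast)
  obtain w where w: "w \<in> vertices X" "\<tau> r X G \<in> lower_faces r X w" by (rule \<tau>_lower[OF G])
  obtain w' where w': "w' \<in> vertices X" "\<beta> r X G \<in> upper_faces r X w'" by (rule \<beta>_upper[OF G])
  have "\<tau> r X G \<in> faces (T (Q X w))" "\<beta> r X G \<in> faces (T (Q X w'))"
    using w(2) w'(2) lower_faces_subset upper_faces_subset by blast+
  then show "J = G"
    using zero_free_not_section[OF J w(1)] zero_free_not_section[OF J w'(1)] mem by auto
qed (simp add: preblock_def)

lemma upper_in_preblock_iff:
  assumes v: "v \<in> vertices X" and U: "U \<in> upper_faces r X v" and G: "G \<in> zero_free X"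
  shows "U \<in> preblock r X G \<longleftrightarrow> U = \<beta> r X G"
proof
  assume "U \<in> preblock r X G"
  then have "U \<in> {G, \<tau> r X G, \<beta> r X G}"
  proof (rule not_middle_in_preblock)
    fix w assume w: "w \<in> vertices X"
    show "U \<notin> middle_faces r X w"
    proof
      assume m: "U \<in> middle_faces r X w"
      have "v = w"
        by (rule section_faces_unique[OF sw v w, of U])
          (use U m upper_faces_subset middle_faces_subset in blast)+
      then show False using upper_middle_disjoint[OF sw v] U m by blast
    qed
  qed
  then show "U = \<beta> r X G" using upper_in_triple_iff[OF assms] by simp
qed (simp add: preblock_def)

lemma lower_in_preblock_iff:
  assumes v: "v \<in> vertices X" and U: "U \<in> lower_faces r X v" and G: "G \<in> zero_free X"
  shows "U \<in> preblock r X G \<longleftrightarrow> U = \<tau> r X G"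
proof
  have UF: "U \<in> faces (T (Q X v))" using U lower_faces_subset by blast
  assume "U \<in> preblock r X G"
  then have mem: "U \<in> {G, \<tau> r X G, \<beta> r X G}"
  proof (rule not_middle_in_preblock)
    fix w assume w: "w \<in> vertices X"
    show "U \<notin> middle_faces r X w"
    proof
      assume m: "U \<in> middle_faces r X w"
      have "v = w"
        by (rule section_faces_unique[OF sw v w UF]) (use m middle_faces_subset in blast)
      then show False using middle_lower_disjoint[OF sw v] U m by blast
    qed
  qed
  have "U \<noteq> G" using zero_free_not_section[OF G v] UF by blast
  moreover have "U \<noteq> \<beta> r X G"
  proof
    assume eq: "U = \<beta> r X G"
    obtain w' where w': "w' \<in> vertices X" "\<beta> r X G \<in> upper_faces r X w'" by (rule \<beta>_upper[OF G])
    have "v = w'"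
      by (rule section_faces_unique[OF sw v w'(1) UF]) (use w'(2) eq upper_faces_subset in blast)
    then show False using upper_lower_disjoint[OF sw v] U w'(2) eq by blast
  qed
  ultimately show "U = \<tau> r X G" using mem by blast
qed (simp add: preblock_def)

lemma preblock_subset:
  assumes G: "G \<in> zero_free X"
  shows "preblock r X G \<subseteq> faces (T X)"
proof
  fix J assume J: "J \<in> preblock r X G"
  have *: "faces (T (Q X v)) \<subseteq> faces (T X)" if "v \<in> vertices X" for v
    by (rule section_faces_T[OF sw that])
  obtain w where w: "w \<in> vertices X" "\<tau> r X G \<in> lower_faces r X w" by (rule \<tau>_lower[OF G])
  obtain w' where w': "w' \<in> vertices X" "\<beta> r X G \<in> upper_faces r X w'" by (rule \<beta>_upper[OF G])
  have tb: "\<tau> r X G \<in> faces (T X)" "\<beta> r X G \<in> faces (T X)"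
    using *[OF w(1)] *[OF w'(1)] w(2) w'(2) lower_faces_subset upper_faces_subset by blast+
  show "J \<in> faces (T X)"
  proof (cases rule: preblock_cases[OF G J])
    case 1
    then show ?thesis using G by (simp add: zero_free_def)
  next
    case (4 v)
    then show ?thesis using *[of v] middle_faces_subset by blast
  qed (use tb in simp_all)
qed

lemma zero_freeE:
  assumes "G \<in> zero_free X" "G' \<in> zero_free X"
  shows "\<beta> r X G = \<beta> r X G' \<longleftrightarrow> G = G'" "\<tau> r X G = \<tau> r X G' \<longleftrightarrow> G = G'"
  using \<beta>_inj[OF sw, of G G'] \<tau>_inj[OF sw, of G G'] assms by (auto simp: zero_free_def)

lemma upper_\<beta>:
  assumes "v \<in> vertices X" "U \<in> upper_faces r X v"
  obtains G where "G \<in> zero_free X" "\<beta> r X G = U"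
proof (rule upper_is_bottom[OF sw assms])
  fix G assume "G \<in> faces (T X)" "0 \<notin> \<sigma> X G" "\<beta> r X G = U"
  then show thesis using that[of G] by (simp add: zero_free_def)
qed

lemma lower_\<tau>:
  assumes "v \<in> vertices X" "U \<in> lower_faces r X v"
  obtains G where "G \<in> zero_free X" "\<tau> r X G = U"
proof (rule lower_is_top[OF sw assms])
  fix G assume "G \<in> faces (T X)" "0 \<notin> \<sigma> X G" "\<tau> r X G = U"
  then show thesis using that[of G] by (simp add: zero_free_def)
qed

text \<open>A face without label 0 owns its pre-block. An upper face is the bottom of its owner, a
  lower face the top, and for a middle face the bottom of the owner is the top of the middle face.
  Injectivity of \<tau> and \<beta> gives uniqueness.\<close>

lemma face_owner:
  assumes J: "J \<in> faces (T X)"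
  shows "\<exists>!G. G \<in> zero_free X \<and> J \<in> preblock r X G"
proof (cases "0 \<in> \<sigma> X J")
  case False
  then have "J \<in> zero_free X" using J by (simp add: zero_free_def)
  then show ?thesis using zero_free_in_preblock_iff by (intro ex1I[of _ J]) auto
next
  case True
  then obtain v where v: "v \<in> vertices X" "J \<in> faces (T (Q X v))"
    using zero_label_section_iff[OF sw J] by auto
  consider "J \<in> upper_faces r X v" | "J \<in> middle_faces r X v" | "J \<in> lower_faces r X v"
    using face_sides[OF sw v] by blast
  then show ?thesis
  proof cases
    case 1
    obtain G where G: "G \<in> zero_free X" "\<beta> r X G = J" by (rule upper_\<beta>[OF v(1) 1])
    show ?thesis
    proof (rule ex1I[of _ G])
      show "G \<in> zero_free X \<and> J \<in> preblock r X G" using G upper_in_preblock_iff[OF v(1) 1 G(1)] by simp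
      fix G' assume G': "G' \<in> zero_free X \<and> J \<in> preblock r X G'"
      then have "\<beta> r X G' = \<beta> r X G" using upper_in_preblock_iff[OF v(1) 1, of G'] G(2) by simp
      then show "G' = G" using zero_freeE(1)[of G' G] G' G(1) by simp
    qed
  next
    case 2
    obtain G where G: "G \<in> zero_free X" "\<beta> r X G = \<tau> r X J"
      by (rule upper_\<beta>[OF v(1) middle_top'(2)[OF v(1) 2]])
    show ?thesis
    proof (rule ex1I[of _ G])
      show "G \<in> zero_free X \<and> J \<in> preblock r X G" using G middle_in_preblock_iff[OF v(1) 2 G(1)] by simp
      fix G' assume G': "G' \<in> zero_free X \<and> J \<in> preblock r X G'"
      then have "\<beta> r X G' = \<beta> r X G" using middle_in_preblock_iff[OF v(1) 2, of G'] G(2) by simp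
      then show "G' = G" using zero_freeE(1)[of G' G] G' G(1) by simp
    qed
  next
    case 3
    obtain G where G: "G \<in> zero_free X" "\<tau> r X G = J" by (rule lower_\<tau>[OF v(1) 3])
    show ?thesis
    proof (rule ex1I[of _ G])
      show "G \<in> zero_free X \<and> J \<in> preblock r X G" using G lower_in_preblock_iff[OF v(1) 3 G(1)] by simp
      fix G' assume G': "G' \<in> zero_free X \<and> J \<in> preblock r X G'"
      then have "\<tau> r X G' = \<tau> r X G" using lower_in_preblock_iff[OF v(1) 3, of G'] G(2) by simp
      then show "G' = G" using zero_freeE(2)[of G' G] G' G(1) by simp
    qed
  qed
qed

lemma ex1_preblock:
  assumes J: "J \<in> faces (T X)"
  shows "\<exists>!A. A \<in> preblocks r X \<and> J \<in> A"
proof -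
  obtain G where G: "G \<in> zero_free X" "J \<in> preblock r X G"
    and uniq: "\<And>G'. G' \<in> zero_free X \<Longrightarrow> J \<in> preblock r X G' \<Longrightarrow> G' = G"
    using face_owner[OF J] by auto
  show ?thesis
  proof (rule ex1I[of _ "preblock r X G"])
    show "preblock r X G \<in> preblocks r X \<and> J \<in> preblock r X G" using G by (simp add: preblocks_eq)
    fix A assume "A \<in> preblocks r X \<and> J \<in> A"
    then show "A = preblock r X G" using uniq unfolding preblocks_eq by auto
  qed
qed

lemma preblocks_partition: "partition_on (faces (T X)) (preblocks r X)"
proof (rule partition_onI)
  show "\<Union>(preblocks r X) = faces (T X)"
  proof
    show "\<Union>(preblocks r X) \<subseteq> faces (T X)" unfolding preblocks_eq using preblock_subset by blast
    show "faces (T X) \<subseteq> \<Union>(preblocks r X)" using ex1_preblock by blast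
  qed
  then show "disjnt A B" if "A \<in> preblocks r X" "B \<in> preblocks r X" "A \<noteq> B" for A B
    using ex1_preblock that unfolding disjnt_def by blast
  show "{} \<notin> preblocks r X" unfolding preblocks_eq preblock_def by auto
qed

lemma steps12: "steps12_well_defined r X"
  unfolding steps12_well_defined_def
proof (intro conjI ballI impI)
  fix G assume G: "G \<in> faces (T X)" "0 \<notin> \<sigma> X G"
  show "\<exists>!U. is_top r X G U" by (rule top_exists[OF sw G])
  show "\<exists>!U. is_bottom r X G U" by (rule bottom_exists[OF sw G])
next
  fix v G assume v: "v \<in> vertices X" and G: "G \<in> middle_faces r X v"
  show "\<exists>!U. is_top r X G U" "\<tau> r X G \<in> upper_faces r X v" by (rule middle_top'[OF v G])+
  note up = middle_top'(2)[OF v G]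
  obtain G' where G': "G' \<in> zero_free X" "\<beta> r X G' = \<tau> r X G" by (rule upper_\<beta>[OF v up])
  have init: "initial_preblocks r X = (\<lambda>G. {G, \<tau> r X G, \<beta> r X G}) ` zero_free X"
    unfolding initial_preblocks_def zero_free_def by auto
  show "\<exists>!A. A \<in> initial_preblocks r X \<and> \<tau> r X G \<in> A"
  proof (rule ex1I[of _ "{G', \<tau> r X G', \<beta> r X G'}"])
    have "{G', \<tau> r X G', \<beta> r X G'} \<in> initial_preblocks r X"
      unfolding init by (rule imageI[OF G'(1)])
    moreover have "\<tau> r X G \<in> {G', \<tau> r X G', \<beta> r X G'}" using G'(2) by simp
    ultimately show "{G', \<tau> r X G', \<beta> r X G'} \<in> initial_preblocks r X \<and> \<tau> r X G \<in> {G', \<tau> r X G', \<beta> r X G'}"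
      by (rule conjI)
    fix A assume A: "A \<in> initial_preblocks r X \<and> \<tau> r X G \<in> A"
    then obtain K where K: "K \<in> zero_free X" "A = {K, \<tau> r X K, \<beta> r X K}" unfolding init by blast
    then have "\<tau> r X G = \<beta> r X K" using upper_in_triple_iff[OF v up K(1)] A by blast
    then have "K = G'" using zero_freeE(1)[OF K(1) G'(1)] G'(2) by simp
    then show "A = {G', \<tau> r X G', \<beta> r X G'}" using K(2) by simp
  qed
qed

text \<open>A merging at \<open>v\<close> touches only pre-blocks whose bottom face is an upper face at \<open>v\<close>.\<close>

lemma preblock_bottom:
  assumes v: "v \<in> vertices X" and G: "G \<in> zero_free X"
    and J: "J \<in> preblock r X G" "J \<in> upper_faces r X v \<union> middle_faces r X v"
  shows "\<beta> r X G \<in> upper_faces r X v" "J = \<beta> r X G \<or> J \<in> middle_faces r X v \<and> \<tau> r X J = \<beta> r X G"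
proof -
  show eq: "J = \<beta> r X G \<or> J \<in> middle_faces r X v \<and> \<tau> r X J = \<beta> r X G"
    using J upper_in_preblock_iff[OF v _ G] middle_in_preblock_iff[OF v _ G] by blast
  show "\<beta> r X G \<in> upper_faces r X v"
  proof (cases "J \<in> middle_faces r X v")
    case True
    then have "\<tau> r X J = \<beta> r X G" using J(1) middle_in_preblock_iff[OF v True G] by simp
    then show ?thesis using middle_top'(2)[OF v True] by simp
  next
    case False
    then show ?thesis using eq J(2) by auto
  qed
qed

lemma \<tau>_subset: "G \<in> zero_free X \<Longrightarrow> \<tau> r X G \<subseteq> G"
  by (rule top_exists[OF sw, of G]) (auto simp: zero_free_def tface_def)

lemma \<beta>_subset: "G \<in> zero_free X \<Longrightarrow> \<beta> r X G \<subseteq> G"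
  by (rule bottom_exists[OF sw, of G]) (auto simp: zero_free_def tface_def)

end

section \<open>The mergings at a single vertex\<close>

context
  fixes n r :: nat and X :: "'a set" and v :: 'a
  assumes swr: "swept_rec n r X" and v: "v \<in> vertices X"
    and wdQ: "well_defined n r (Q X v)"
    and partQ: "partition_on (faces (T (Q X v))) (blocks n r (Q X v))"
    and partR: "R r X v \<noteq> {} \<Longrightarrow>
      partition_on (faces (T (R r X v))) (blocks (n - 1) (Suc r) (R r X v))"
begin

lemma swv: "swept n r X"
  using swr by (rule swept_rec_swept)

text \<open>Opens up a block of the section: it is a union of pre-blocks of the section, and as
  mergings at \<open>w\<close> consist of upper and middle faces at \<open>w\<close>, they only
  touch pre-blocks whose bottom is an upper face at \<open>w\<close>.\<close>

lemma Q_merge: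
  assumes n: "n = Suc m" and w: "w \<in> vertices (Q X v)" and B: "B \<in> blocks_at n r (Q X v) w"
    and J: "J \<in> B"
  obtains G where "G \<in> zero_free (Q X v)" "J \<in> preblock r (Q X v) G" "preblock r (Q X v) G \<subseteq> B"
    "\<beta> r (Q X v) G \<in> upper_faces r (Q X v) w"
proof -
  have swY: "swept_rec m r (Q X v)" using swr v n by simp
  have B': "B \<in> merge_preblocks r (Q X v) ` merges m r (Q X v) w"
    using B by (simp add: n merges_def)
  then obtain S where S: "S \<in> merges m r (Q X v) w" "B = merge_preblocks r (Q X v) S" by blast
  obtain A where A: "A \<in> preblocks r (Q X v)" "A \<inter> S \<noteq> {}" "J \<in> A"
    using J unfolding S(2) merge_preblocks_def by blast
  obtain G where G: "G \<in> zero_free (Q X v)" "A = preblock r (Q X v) G"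
    using A(1) unfolding preblocks_eq by blast
  obtain K where K: "K \<in> A" "K \<in> S" using A(2) by blast
  have "steps34_well_defined m r (Q X v)" using wdQ n by simp
  then have up: "\<forall>u \<in> vertices (Q (Q X v) w) \<inter> Hplus r w. \<forall>B\<in>blocks_at m r (Q (Q X v) w) u.
      B \<subseteq> upper_faces r (Q X v) w"
    using w unfolding steps34_well_defined_def by blast
  have "K \<in> upper_faces r (Q X v) w \<union> middle_faces r (Q X v) w"
    using S(1) K(2) up unfolding merges_def merges_middle_def merges_upper_def by blast
  then have "\<beta> r (Q X v) G \<in> upper_faces r (Q X v) w"
    using preblock_bottom(1)[OF swY w G(1)] K(1) G(2) by blast
  moreover have "preblock r (Q X v) G \<subseteq> B"
    using A(1,2) G(2) unfolding S(2) merge_preblocks_def by blast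
  ultimately show ?thesis using that G A(3) by blast
qed

text \<open>A middle face in the pre-block has the bottom of \<open>G\<close> as its top. That
  bottom is an upper face at \<open>w\<close> and at no other vertex, so the middle face belongs to
  \<open>w\<close> too.\<close>

lemma preblock_near:
  assumes n: "n = Suc m" and w: "w \<in> vertices (Q X v)" and G: "G \<in> zero_free (Q X v)"
    and \<beta>: "\<beta> r (Q X v) G \<in> upper_faces r (Q X v) w" and J: "J \<in> preblock r (Q X v) G"
  shows "J = G \<or> J = \<tau> r (Q X v) G \<or> J \<in> faces (T (Q (Q X v) w))"
proof -
  have swY: "swept_rec m r (Q X v)" using swr v n by simp
  note sY = swept_rec_swept[OF swY]
  have \<beta>F: "\<beta> r (Q X v) G \<in> faces (T (Q (Q X v) w))" using \<beta> upper_faces_subset by blast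
  show ?thesis
  proof (cases rule: preblock_cases[OF swY G J])
    case (4 u)
    have "\<beta> r (Q X v) G \<in> upper_faces r (Q X v) u" using middle_top'(2)[OF swY 4(1,2)] 4(3) by simp
    then have "\<beta> r (Q X v) G \<in> faces (T (Q (Q X v) u))" using upper_faces_subset by blast
    then have "u = w" by (rule section_faces_unique[OF sY 4(1) w _ \<beta>F])
    then show ?thesis using 4(2) middle_faces_subset by blast
  qed (use \<beta>F in simp_all)
qed

lemma n0_point:
  assumes "n = 0" "w \<in> vertices (Q X v)"
  shows "T (Q X v) = {w}"
proof -
  obtain y where "Q X v = {y}" "T (Q X v) = {y}" using wdQ assms(1) by auto
  then show ?thesis using assms(2) by simp
qed

text \<open>With its bottom at a vertex above the level, \<open>G\<close> is upper; so is its top,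
  being a subset, and the remaining members of the pre-block lie near \<open>w\<close>. For
  \<open>n = 0\<close> the block consists of the point \<open>w\<close>.\<close>

lemma upper_block_subset:
  assumes w: "w \<in> vertices (Q X v)" "w \<in> Hplus r v" and B: "B \<in> blocks_at n r (Q X v) w"
  shows "B \<subseteq> upper_faces r X v"
proof
  fix J assume J: "J \<in> B"
  show "J \<in> upper_faces r X v"
  proof (cases n)
    case 0
    then have "J = {w}" using B J by simp
    moreover have "{w} \<in> faces (T (Q X v))"
      unfolding n0_point[OF 0 w(1)] by (simp add: faces_iff face_of_refl)
    ultimately show ?thesis using w(2) by (simp add: upper_faces_def)
  next
    case (Suc m)
    have swX: "swept (Suc m) r X" using swv Suc by simp
    have swY: "swept_rec m r (Q X v)" using swr v Suc by simp
    note sY = swept_rec_swept[OF swY]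
    obtain G where G: "G \<in> zero_free (Q X v)" "J \<in> preblock r (Q X v) G"
      "\<beta> r (Q X v) G \<in> upper_faces r (Q X v) w"
      by (rule Q_merge[OF Suc w(1) B J])
    have \<beta>F: "\<beta> r (Q X v) G \<in> faces (T (Q (Q X v) w))" using G(3) upper_faces_subset by blast
    have Gup: "G \<in> upper_faces r X v"
      by (rule bottom_upper_vertex[OF swX v sY w(1) _ _ \<beta>F w(2)]) (use G(1) in \<open>auto simp: zero_free_def\<close>)
    have HF: "J \<in> faces (T (Q X v))" using preblock_subset[OF swY G(1)] G(2) by blast
    have "J \<subseteq> Hplus r v"
      using preblock_near[OF Suc w(1) G(1,3,2)]
    proof (elim disjE)
      assume "J = G"
      then show ?thesis using Gup by (simp add: upper_faces_def)
    next
      assume "J = \<tau> r (Q X v) G"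
      then show ?thesis using Gup \<tau>_subset[OF swY G(1)] by (auto simp: upper_faces_def)
    next
      assume "J \<in> faces (T (Q (Q X v) w))"
      then have "J \<subseteq> T (Q (Q X v) w)" by (simp add: faces_iff face_of_imp_subset)
      then show ?thesis using near_upper_vertex[OF swX v sY w] by blast
    qed
    then show ?thesis using HF by (simp add: upper_faces_def)
  qed
qed

text \<open>Members near \<open>w\<close> lie below the level, and \<open>G\<close> is not upper
  because it contains its bottom, which is near \<open>w\<close>. So \<open>U\<close> must be the
  top of \<open>G\<close>. As it contains \<open>U\<close>, \<open>G\<close> is not lower either,
  hence middle.\<close>

lemma lower_block_upper_face:
  assumes w: "w \<in> vertices (Q X v)" "w \<notin> Hplus r v" and B: "B \<in> blocks_at n r (Q X v) w"
    and U: "U \<in> B" "U \<in> upper_faces r X v"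
  obtains M where "M \<in> middle_faces r X v" "\<tau> r X M = U"
proof (cases n)
  case 0
  then have "U = {w}" using B U(1) by simp
  then show ?thesis using U(2) w(2) by (simp add: upper_faces_def)
next
  case (Suc m)
  have swX: "swept (Suc m) r X" using swv Suc by simp
  have swY: "swept_rec m r (Q X v)" using swr v Suc by simp
  note sY = swept_rec_swept[OF swY]
  obtain G where G: "G \<in> zero_free (Q X v)" "U \<in> preblock r (Q X v) G"
    "\<beta> r (Q X v) G \<in> upper_faces r (Q X v) w"
    by (rule Q_merge[OF Suc w(1) B U(1)])
  have Un: "U \<noteq> {}" "U \<subseteq> Hplus r v" using U(2) by (auto simp: upper_faces_def faces_iff)
  have far: "K \<inter> Hplus r v = {}" "K \<noteq> {}" if "K \<in> faces (T (Q (Q X v) w))" for K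
  proof -
    have "K \<subseteq> T (Q (Q X v) w)" using that by (simp add: faces_iff face_of_imp_subset)
    then show "K \<inter> Hplus r v = {}" using near_lower_vertex[OF swX v sY w] by blast
    show "K \<noteq> {}" using that by (simp add: faces_iff)
  qed
  have \<beta>F: "\<beta> r (Q X v) G \<in> faces (T (Q (Q X v) w))" using G(3) upper_faces_subset by blast
  have Gnu: "G \<notin> upper_faces r X v"
  proof
    assume "G \<in> upper_faces r X v"
    then have "\<beta> r (Q X v) G \<subseteq> Hplus r v"
      using \<beta>_subset[OF swY G(1)] by (auto simp: upper_faces_def)
    then show False using far[OF \<beta>F] by blast
  qed
  have "U \<notin> faces (T (Q (Q X v) w))" using far[of U] Un by blast
  moreover have "U \<noteq> G" using Gnu U(2) by blast
  ultimately have U\<tau>: "U = \<tau> r (Q X v) G" using preblock_near[OF Suc w(1) G(1,3,2)] by blast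
  have GF: "G \<in> faces (T (Q X v))" using G(1) by (simp add: zero_free_def)
  have "G \<notin> lower_faces r X v"
  proof
    assume "G \<in> lower_faces r X v"
    then have "U \<subseteq> {x. p r \<bullet> x < p r \<bullet> v}"
      using \<tau>_subset[OF swY G(1)] U\<tau> by (auto simp: lower_faces_def)
    then show False using Un by (force simp: Hplus_def)
  qed
  then have Gm: "G \<in> middle_faces r X v" using face_sides[OF swv v GF] Gnu by blast
  have "\<tau> r X G = U" using \<tau>_section[OF swv v GF] U\<tau> by simp
  with Gm show ?thesis by (rule that)
qed

text \<open>In the section, the top of \<open>M\<close> is owned by \<open>M\<close>. A block
  containing this top contains \<open>M\<close> as well, and then it does not consist of upper
  faces.\<close>

lemma middle_top_not_in_upper_block:
  assumes M: "M \<in> middle_faces r X v" and w: "w \<in> vertices (Q X v)" "w \<in> Hplus r v"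
    and B: "B \<in> blocks_at n r (Q X v) w"
  shows "\<tau> r X M \<notin> B"
proof
  assume U: "\<tau> r X M \<in> B"
  have "0 < n" by (rule middle_zero_free(1)[OF swv v M])
  then obtain m where n: "n = Suc m" by (cases n) auto
  have swY: "swept_rec m r (Q X v)" using swr v n by simp
  have MF: "M \<in> faces (T (Q X v))" using M middle_faces_subset by blast
  have Mz: "M \<in> zero_free (Q X v)"
    using MF middle_zero_free(2)[OF swv v M] by (simp add: zero_free_def)
  obtain G where G: "G \<in> zero_free (Q X v)" "\<tau> r X M \<in> preblock r (Q X v) G" "preblock r (Q X v) G \<subseteq> B"
    by (rule Q_merge[OF n w(1) B U])
  have inM: "\<tau> r X M \<in> preblock r (Q X v) M"
    using \<tau>_section[OF swv v MF] by (simp add: preblock_def)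
  have "\<tau> r X M \<in> faces (T (Q X v))" using preblock_subset[OF swY G(1)] G(2) by blast
  then have "G = M" using face_owner[OF swY] G(1,2) Mz inM by blast
  then have "M \<in> B" using G(3) by (auto simp: preblock_def)
  then have "M \<in> upper_faces r X v" using upper_block_subset[OF w B] by blast
  then show False using upper_middle_disjoint[OF swv v] M by blast
qed

lemma middle_top_inj:
  assumes M: "M \<in> middle_faces r X v" "M' \<in> middle_faces r X v" and eq: "\<tau> r X M = \<tau> r X M'"
  shows "M = M'"
proof -
  have "0 < n" by (rule middle_zero_free(1)[OF swv v M(1)])
  then obtain m where n: "n = Suc m" by (cases n) auto
  have swY: "swept_rec m r (Q X v)" using swr v n by simp
  have F: "M \<in> faces (T (Q X v))" "M' \<in> faces (T (Q X v))" using M middle_faces_subset by blast+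
  show ?thesis
    by (rule \<tau>_inj[OF swept_rec_swept[OF swY] F(1) _ F(2)])
      (use middle_zero_free(2)[OF swv v] M eq \<tau>_section[OF swv v] F in simp_all)
qed

lemma blocks_R_empty: "R r X v = {} \<Longrightarrow> blocks k s (R r X v) = {}"
  by (simp add: blocks_def)

lemma blocks_R_face:
  assumes B: "B \<in> blocks (n - 1) (Suc r) (R r X v)"
  shows "B \<subseteq> faces (T (R r X v))" "B \<noteq> {}"
proof -
  have "R r X v \<noteq> {}" using B blocks_R_empty by force
  then have "partition_on (faces (T (R r X v))) (blocks (n - 1) (Suc r) (R r X v))" by (rule partR)
  then show "B \<subseteq> faces (T (R r X v))" "B \<noteq> {}" using B by (auto simp: partition_on_def)
qed

lemma merges_middle_eq:
  "merges_middle (blocks_at (n - 1) (Suc r) (R r X v)) r X v =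
     (\<lambda>B. {G \<in> middle_faces r X v. G \<inter> H r v \<in> B}) ` blocks (n - 1) (Suc r) (R r X v)"
  unfolding merges_middle_def blocks_def by blast

lemma merges_cases:
  assumes "S \<in> merges n r X v"
  obtains B where "B \<in> blocks (n - 1) (Suc r) (R r X v)" "S = {G \<in> middle_faces r X v. G \<inter> H r v \<in> B}"
  | w where "w \<in> vertices (Q X v)" "w \<in> Hplus r v" "S \<in> blocks_at n r (Q X v) w"
proof -
  consider "S \<in> merges_middle (blocks_at (n - 1) (Suc r) (R r X v)) r X v"
    | "S \<in> merges_upper (blocks_at n r (Q X v)) r X v"
    using assms unfolding merges_def by blast
  then show ?thesis
  proof cases
    case 1
    then show ?thesis using that(1) unfolding merges_middle_eq by blast
  next
    case 2
    then show ?thesis using that(2) unfolding merges_upper_def by blast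
  qed
qed

lemma merges_props:
  assumes S: "S \<in> merges n r X v"
  shows "S \<subseteq> upper_faces r X v \<union> middle_faces r X v" "S \<noteq> {}"
proof -
  have "S \<subseteq> upper_faces r X v \<union> middle_faces r X v \<and> S \<noteq> {}"
  proof (cases rule: merges_cases[OF S])
    case (1 B)
    obtain F where F: "F \<in> B" "F \<in> faces (T (R r X v))" using blocks_R_face[OF 1(1)] by blast
    obtain G where "G \<in> middle_faces r X v" "G \<inter> H r v = F"
      using section_face_middle[OF swv v F(2)] by (elim ex1E conjE)
    then show ?thesis using 1(2) F(1) by blast
  next
    case (2 w)
    have "S \<in> blocks n r (Q X v)" using 2 by (auto simp: blocks_def)
    then have "S \<noteq> {}" using partQ by (auto simp: partition_on_def)
    then show ?thesis using upper_block_subset[OF 2] by blast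
  qed
  then show "S \<subseteq> upper_faces r X v \<union> middle_faces r X v" "S \<noteq> {}" by simp_all
qed

text \<open>The set intersected with \<open>S\<close> is the part at \<open>v\<close> of the
  pre-block with bottom \<open>U\<close>. If \<open>U\<close> is the top of a middle face
  \<open>M\<close>, the block of \<open>R r X v\<close> through \<open>M \<inter> H r v\<close>
  takes it, and no block attached to a vertex above the level contains \<open>U\<close>. Otherwise
  the block of the section through \<open>U\<close> cannot be attached to a vertex below the level,
  so Step 4 takes it.\<close>

lemma ex1_merge:
  assumes U: "U \<in> upper_faces r X v"
  shows "\<exists>!S. S \<in> merges n r X v \<and> ({U} \<union> {M \<in> middle_faces r X v. \<tau> r X M = U}) \<inter> S \<noteq> {}"
proof (cases "\<exists>M\<in>middle_faces r X v. \<tau> r X M = U")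
  case True
  then obtain M where M: "M \<in> middle_faces r X v" "\<tau> r X M = U" by (rule bexE)
  have "M' = M" if "M' \<in> middle_faces r X v" "\<tau> r X M' = U" for M'
    by (rule middle_top_inj[OF that(1) M(1)]) (simp add: that M)
  then have set: "{U} \<union> {M \<in> middle_faces r X v. \<tau> r X M = U} = {U, M}" using M by blast
  have Unm: "U \<notin> middle_faces r X v" using U upper_middle_disjoint[OF swv v] by blast
  have MR: "M \<inter> H r v \<in> faces (T (R r X v))" by (rule middle_section_faces[OF swv v M(1)])
  have ne: "R r X v \<noteq> {}"
  proof
    assume "R r X v = {}"
    then have "T (R r X v) = {}" using T_subset[of "R r X v"] by simp
    then show False using MR by (auto simp: faces_iff)
  qed
  note part = partR[OF ne]
  obtain B where B: "B \<in> blocks (n - 1) (Suc r) (R r X v)" "M \<inter> H r v \<in> B"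
    using part MR by (auto simp: partition_on_def)
  let ?S = "{G \<in> middle_faces r X v. G \<inter> H r v \<in> B}"
  show ?thesis unfolding set
  proof (rule ex1I[of _ ?S])
    have "?S \<in> merges n r X v" unfolding merges_def merges_middle_eq using B(1) by blast
    moreover have "M \<in> ?S" using M(1) B(2) by simp
    ultimately show "?S \<in> merges n r X v \<and> {U, M} \<inter> ?S \<noteq> {}" by blast
  next
    fix S assume S: "S \<in> merges n r X v \<and> {U, M} \<inter> S \<noteq> {}"
    then have S1: "S \<in> merges n r X v" and S2: "U \<in> S \<or> M \<in> S" by auto
    show "S = ?S"
    proof (cases rule: merges_cases[OF S1])
      case (1 B')
      then have "M \<in> S" using S2 Unm by blast
      then have "M \<inter> H r v \<in> B'" using 1(2) by blast
      then have "B' = B"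
        using partition_onD2[OF part] B 1(1) unfolding disjoint_def by blast
      then show ?thesis using 1(2) by simp
    next
      case (2 w)
      have "M \<notin> S" using upper_block_subset[OF 2] M(1) upper_middle_disjoint[OF swv v] by blast
      then have "U \<in> S" using S2 by blast
      then show ?thesis using middle_top_not_in_upper_block[OF M(1) 2] M(2) by blast
    qed
  qed
next
  case False
  then have set: "{U} \<union> {M \<in> middle_faces r X v. \<tau> r X M = U} = {U}" by blast
  have UF: "U \<in> faces (T (Q X v))" using U upper_faces_subset by blast
  then have "U \<in> \<Union>(blocks n r (Q X v))" using partQ by (simp add: partition_on_def)
  then obtain B w where B: "w \<in> vertices (Q X v)" "B \<in> blocks_at n r (Q X v) w" "U \<in> B"
    unfolding blocks_def by blast
  have w: "w \<in> Hplus r v"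
  proof (rule ccontr)
    assume "w \<notin> Hplus r v"
    then obtain M where "M \<in> middle_faces r X v" "\<tau> r X M = U"
      by (rule lower_block_upper_face[OF B(1) _ B(2,3) U])
    then show False using False by blast
  qed
  show ?thesis unfolding set
  proof (rule ex1I[of _ B])
    show "B \<in> merges n r X v \<and> {U} \<inter> B \<noteq> {}"
      using B w unfolding merges_def merges_upper_def by blast
  next
    fix S assume S: "S \<in> merges n r X v \<and> {U} \<inter> S \<noteq> {}"
    then have S1: "S \<in> merges n r X v" and S2: "U \<in> S" by auto
    show "S = B"
    proof (cases rule: merges_cases[OF S1])
      case (1 B')
      then have "U \<in> middle_faces r X v" using S2 by blast
      then show ?thesis using U upper_middle_disjoint[OF swv v] by blast
    next
      case (2 w')
      have "S \<in> blocks n r (Q X v)" "B \<in> blocks n r (Q X v)"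
        using 2 B by (auto simp: blocks_def)
      then show ?thesis
        using partition_onD2[OF partQ] S2 B(3) unfolding disjoint_def by blast
    qed
  qed
qed

text \<open>A merging set at \<open>v\<close> consists of upper and middle faces at
  \<open>v\<close>; in a pre-block these can only be the bottom and the middle faces having it as
  top.\<close>

lemma preblock_meets_merge:
  assumes S: "S \<in> merges n r X v" and G: "G \<in> zero_free X"
  shows "preblock r X G \<inter> S \<noteq> {} \<longleftrightarrow> \<beta> r X G \<in> upper_faces r X v \<and>
    ({\<beta> r X G} \<union> {M \<in> middle_faces r X v. \<tau> r X M = \<beta> r X G}) \<inter> S \<noteq> {}"
proof
  assume "preblock r X G \<inter> S \<noteq> {}"
  then obtain K where K: "K \<in> preblock r X G" "K \<in> S" by blast
  have "K \<in> upper_faces r X v \<union> middle_faces r X v" using merges_props(1)[OF S] K(2) by blast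
  note bot = preblock_bottom[OF swr v G K(1) this]
  show "\<beta> r X G \<in> upper_faces r X v \<and>
    ({\<beta> r X G} \<union> {M \<in> middle_faces r X v. \<tau> r X M = \<beta> r X G}) \<inter> S \<noteq> {}"
    using bot K(2) by blast
next
  assume *: "\<beta> r X G \<in> upper_faces r X v \<and>
    ({\<beta> r X G} \<union> {M \<in> middle_faces r X v. \<tau> r X M = \<beta> r X G}) \<inter> S \<noteq> {}"
  have "{\<beta> r X G} \<union> {M \<in> middle_faces r X v. \<tau> r X M = \<beta> r X G} \<subseteq> preblock r X G"
    using v by (auto simp: preblock_def)
  then show "preblock r X G \<inter> S \<noteq> {}" using * by blast
qed

end

theorem swept_rec_partition:
  assumes swr: "swept_rec n r X"
    and wdQ: "\<And>v. v \<in> vertices X \<Longrightarrow> well_defined n r (Q X v)"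
    and partQ: "\<And>v. v \<in> vertices X \<Longrightarrow> partition_on (faces (T (Q X v))) (blocks n r (Q X v))"
    and wdR: "\<And>v. v \<in> vertices X \<Longrightarrow> R r X v \<noteq> {} \<Longrightarrow> well_defined (n - 1) (Suc r) (R r X v)"
    and partR: "\<And>v. v \<in> vertices X \<Longrightarrow> R r X v \<noteq> {} \<Longrightarrow>
      partition_on (faces (T (R r X v))) (blocks (n - 1) (Suc r) (R r X v))"
  shows "well_defined (Suc n) r X" "partition_on (faces (T X)) (blocks (Suc n) r X)"
proof -
  note sw = swept_rec_swept[OF swr]
  have ex1m: "\<exists>!S. S \<in> merges n r X v \<and> ({U} \<union> {M \<in> middle_faces r X v. \<tau> r X M = U}) \<inter> S \<noteq> {}"
    if v: "v \<in> vertices X" and U: "U \<in> upper_faces r X v" for v U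
    by (rule ex1_merge[OF swr v wdQ[OF v] partQ[OF v] _ U]) (rule partR[OF v])
  have meets: "preblock r X G \<inter> S \<noteq> {} \<longleftrightarrow> \<beta> r X G \<in> upper_faces r X v \<and>
      ({\<beta> r X G} \<union> {M \<in> middle_faces r X v. \<tau> r X M = \<beta> r X G}) \<inter> S \<noteq> {}"
    if v: "v \<in> vertices X" and S: "S \<in> merges n r X v" and G: "G \<in> zero_free X" for v S G
    by (rule preblock_meets_merge[OF swr v wdQ[OF v] partQ[OF v] _ S G]) (rule partR[OF v])
  have merges_faces: "S \<subseteq> faces (T X)" "S \<noteq> {}"
    if v: "v \<in> vertices X" and S: "S \<in> merges n r X v" for v S
  proof -
    have "S \<subseteq> upper_faces r X v \<union> middle_faces r X v"
      by (rule merges_props(1)[OF swr v wdQ[OF v] partQ[OF v] _ S]) (rule partR[OF v])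
    then show "S \<subseteq> faces (T X)"
      using section_faces_T[OF sw v] upper_faces_subset[of r X v] middle_faces_subset[of r X v] by blast
    show "S \<noteq> {}"
      by (rule merges_props(2)[OF swr v wdQ[OF v] partQ[OF v] _ S]) (rule partR[OF v])
  qed
  have unique: "v = v' \<and> S = S'"
    if v: "v \<in> vertices X" and v': "v' \<in> vertices X" and S: "S \<in> merges n r X v" and S': "S' \<in> merges n r X v'"
      and A: "A \<in> preblocks r X" "A \<inter> S \<noteq> {}" "A \<inter> S' \<noteq> {}" for v v' S S' A
  proof -
    obtain G where G: "G \<in> zero_free X" "A = preblock r X G" using A(1) unfolding preblocks_eq by blast
    have 1: "\<beta> r X G \<in> upper_faces r X v \<and>
        ({\<beta> r X G} \<union> {M \<in> middle_faces r X v. \<tau> r X M = \<beta> r X G}) \<inter> S \<noteq> {}"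
      using meets[OF v S G(1)] A(2) G(2) by simp
    have 2: "\<beta> r X G \<in> upper_faces r X v' \<and>
        ({\<beta> r X G} \<union> {M \<in> middle_faces r X v'. \<tau> r X M = \<beta> r X G}) \<inter> S' \<noteq> {}"
      using meets[OF v' S' G(1)] A(3) G(2) by simp
    \<comment> \<open>The bottom of the pre-block is an upper face at both vertices, hence a face of
      both sections.\<close>
    have eq: "v' = v"
      by (rule section_faces_unique[OF sw v' v, of "\<beta> r X G"]) (use 1 2 upper_faces_subset in blast)+
    have "S = S'"
      by (rule ex1_unique[OF ex1m[OF v conjunct1[OF 1]] conjI[OF S conjunct2[OF 1]]
            conjI[OF S'[unfolded eq] conjunct2[OF 2[unfolded eq]]]])
    then show ?thesis using eq by simp
  qed
  have exists: "\<exists>v\<in>vertices X. \<exists>S\<in>merges n r X v. A \<inter> S \<noteq> {}" if A: "A \<in> preblocks r X" for A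
  proof -
    obtain G where G: "G \<in> zero_free X" "A = preblock r X G" using A unfolding preblocks_eq by blast
    obtain v where v: "v \<in> vertices X" "\<beta> r X G \<in> upper_faces r X v" by (rule \<beta>_upper[OF swr G(1)])
    obtain S where S: "S \<in> merges n r X v"
      "({\<beta> r X G} \<union> {M \<in> middle_faces r X v. \<tau> r X M = \<beta> r X G}) \<inter> S \<noteq> {}"
      using ex1m[OF v] by (elim ex1E conjE)
    have "A \<inter> S \<noteq> {}"
      using meets[OF v(1) S(1) G(1)] v(2) S(2) G(2) by simp
    then show ?thesis using v(1) S(1) by blast
  qed
  have "steps34_well_defined n r X"
    unfolding steps34_well_defined_def
  proof (intro conjI ballI impI)
    fix v B F assume v: "v \<in> vertices X" and B: "B \<in> blocks (n - 1) (Suc r) (R r X v)" "F \<in> B"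
    have "F \<in> faces (T (R r X v))"
      by (rule subsetD[OF blocks_R_face(1)[OF swr v wdQ[OF v] partQ[OF v] _ B(1)] B(2)]) (rule partR[OF v])
    then show "\<exists>!G. G \<in> middle_faces r X v \<and> G \<inter> H r v = F" by (rule section_face_middle[OF sw v])
  next
    fix v w B assume v: "v \<in> vertices X" and w: "w \<in> vertices (Q X v) \<inter> Hplus r v"
      and B: "B \<in> blocks_at n r (Q X v) w"
    show "B \<subseteq> upper_faces r X v"
      by (rule upper_block_subset[OF swr v wdQ[OF v] partQ[OF v] _ _ _ B]) (use w partR[OF v] in simp_all)
  next
    fix v S G assume "v \<in> vertices X" "S \<in> merges n r X v" "G \<in> S"
    then have "G \<in> faces (T X)" using merges_faces(1) by blast
    then show "\<exists>!A. A \<in> preblocks r X \<and> G \<in> A" by (rule ex1_preblock[OF swr])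
  next
    fix v v' S S'
    assume vs: "v \<in> vertices X" "v' \<in> vertices X" "S \<in> merges n r X v" "S' \<in> merges n r X v'"
      and "\<exists>A\<in>preblocks r X. A \<inter> S \<noteq> {} \<and> A \<inter> S' \<noteq> {}"
    then obtain A where "A \<in> preblocks r X" "A \<inter> S \<noteq> {}" "A \<inter> S' \<noteq> {}" by blast
    then have "v = v' \<and> S = S'" by (rule unique[OF vs])
    then show "v = v'" "S = S'" by simp_all
  qed
  then show "well_defined (Suc n) r X"
    using steps12[OF swr] wdQ partQ wdR partR by simp
  let ?I = "\<Union>v\<in>vertices X. merges n r X v"
  have "partition_on (faces (T X)) ((\<lambda>S. \<Union>{A \<in> preblocks r X. A \<inter> S \<noteq> {}}) ` ?I)"
  proof (rule merge_partition[OF preblocks_partition[OF swr]])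
    show "S \<noteq> {} \<and> S \<subseteq> faces (T X)" if "S \<in> ?I" for S
      using that merges_faces by blast
    fix A assume A: "A \<in> preblocks r X"
    obtain v S where S: "v \<in> vertices X" "S \<in> merges n r X v" "A \<inter> S \<noteq> {}" using exists[OF A] by blast
    show "\<exists>!S. S \<in> ?I \<and> A \<inter> S \<noteq> {}"
    proof (rule ex1I[of _ S])
      show "S \<in> ?I \<and> A \<inter> S \<noteq> {}" using S by blast
      fix S' assume S': "S' \<in> ?I \<and> A \<inter> S' \<noteq> {}"
      then obtain v' where v': "v' \<in> vertices X" "S' \<in> merges n r X v'" by blast
      show "S' = S" using unique[OF v'(1) S(1) v'(2) S(2) A] S' S(3) by blast
    qed
  qed
  moreover have "blocks (Suc n) r X = (\<lambda>S. \<Union>{A \<in> preblocks r X. A \<inter> S \<noteq> {}}) ` ?I"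
    unfolding blocks_def image_UN by (simp add: merges_def merge_preblocks_def[abs_def])
  ultimately show "partition_on (faces (T X)) (blocks (Suc n) r X)" by simp
qed

end

subsection \<open>Similarities\<close>

text \<open>There is no rotation, so for positive \<open>s\<close> normals and sweep directions can
  be used unchanged on both sides.\<close>

definition sim :: "'a::euclidean_space \<Rightarrow> real \<Rightarrow> 'a \<Rightarrow> 'a" where
  "sim x s y = x + s *\<^sub>R y"

lemma sim_image: "sim x s ` A = (+) x ` (\<lambda>y. s *\<^sub>R y) ` A"
  by (simp add: image_image sim_def)

lemma linear_scaling: "linear (\<lambda>y. s *\<^sub>R y :: 'a::euclidean_space)"
  by (intro linearI) (simp_all add: algebra_simps)

lemma sim_sim: "sim x s (sim y t z) = sim (sim x s y) (s * t) z"
  by (simp add: sim_def algebra_simps)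

lemma inner_sim: "q \<bullet> sim x s y = q \<bullet> x + s * (q \<bullet> y)"
  by (simp add: sim_def inner_add_right)

context
  fixes x :: "'a::euclidean_space" and s :: real
  assumes s: "s \<noteq> 0"
begin

lemma inj_scaling: "inj (\<lambda>y. s *\<^sub>R y :: 'a)"
  using s by (auto intro: injI)

lemma sim_inj: "inj (sim x s)"
  using s by (auto intro: injI simp: sim_def)

lemma sim_eq_iff [simp]: "sim x s y = sim x s z \<longleftrightarrow> y = z"
  using sim_inj by (simp add: inj_eq)

lemma sim_image_eq_iff: "sim x s ` A = sim x s ` B \<longleftrightarrow> A = B"
  using sim_inj by (rule inj_image_eq_iff)

lemma sim_surj: "\<exists>A. B = sim x s ` A"
proof -
  have "sim x s ((1 / s) *\<^sub>R (y - x)) = y" for y using s by (simp add: sim_def)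
  then have "B = sim x s ` ((\<lambda>y. (1 / s) *\<^sub>R (y - x)) ` B)" by (simp add: image_image)
  then show ?thesis by (rule exI)
qed

lemma sim_face_iff: "sim x s ` F face_of sim x s ` S \<longleftrightarrow> F face_of S"
  unfolding sim_image face_of_translation_eq by (rule face_of_linear_image[OF linear_scaling inj_scaling])

lemma sim_aff_dim: "aff_dim (sim x s ` S) = aff_dim S"
  unfolding sim_image aff_dim_translation_eq by (rule aff_dim_injective_linear_image[OF linear_scaling inj_scaling])

lemma sim_polytope: "polytope S \<Longrightarrow> polytope (sim x s ` S)"
  unfolding sim_image polytope_translation_eq by (rule polytope_linear_image[OF linear_scaling])

lemma sim_rel_interior: "rel_interior (sim x s ` S) = sim x s ` rel_interior S"
  unfolding sim_image rel_interior_translation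
  by (simp add: rel_interior_injective_linear_image[OF bounded_linear_scaleR_right inj_scaling])

lemma sim_faces: "faces (sim x s ` S) = (\<lambda>F. sim x s ` F) ` faces S"
proof (intro equalityI subsetI)
  fix G assume G: "G \<in> faces (sim x s ` S)"
  obtain F where F: "G = sim x s ` F" using sim_surj by blast
  then have "F \<in> faces S" using G sim_face_iff by (auto simp: faces_iff)
  then show "G \<in> (\<lambda>F. sim x s ` F) ` faces S" using F by blast
qed (auto simp: faces_iff sim_face_iff)

lemma sim_proper_faces: "proper_faces (sim x s ` S) = (\<lambda>F. sim x s ` F) ` proper_faces S"
proof -
  have "inj ((`) (sim x s))" using sim_inj by (simp add: inj_image_eq_iff inj_def)
  then show ?thesis unfolding proper_faces_def sim_faces by (simp add: image_set_diff)
qed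

lemma sim_vertices: "vertices (sim x s ` S) = sim x s ` vertices S"
proof -
  have "sim x s u \<in> vertices (sim x s ` S) \<longleftrightarrow> u \<in> vertices S" for u
    using sim_face_iff[of "{u}" S] by (simp add: singleton_face_iff)
  then show ?thesis using vertices_subset[of "sim x s ` S"] by blast
qed

lemma sim_chains:
  assumes "C \<in> chains (sim x s ` S)"
  obtains D where "D \<in> chains S" "C = (\<lambda>F. sim x s ` F) ` D"
proof -
  have "C \<subseteq> (\<lambda>F. sim x s ` F) ` proper_faces S"
    using chain_proper[OF assms] by (simp add: sim_proper_faces)
  then obtain D where D: "D \<subseteq> proper_faces S" "C = (\<lambda>F. sim x s ` F) ` D"
    by (auto simp: subset_image_iff)
  have "E \<subseteq> F \<or> F \<subseteq> E" if "E \<in> D" "F \<in> D" for E F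
  proof -
    have "sim x s ` E \<in> C" "sim x s ` F \<in> C" using that D(2) by blast+
    then have "sim x s ` E \<subseteq> sim x s ` F \<or> sim x s ` F \<subseteq> sim x s ` E"
      using assms by (simp add: chains_def)
    then show ?thesis unfolding inj_image_subset_iff[OF sim_inj] .
  qed
  then have "D \<in> chains S" using D(1) by (simp add: chains_def)
  then show ?thesis using D(2) by (rule that)
qed

end

subsection \<open>Sections modelled on fixed polytopes\<close>

definition separated :: "real \<Rightarrow> nat \<Rightarrow> 'a::euclidean_space set \<Rightarrow> ('a set \<Rightarrow> 'a) \<Rightarrow> ('a set \<Rightarrow> real) \<Rightarrow> 'a \<Rightarrow> bool" where
  "separated \<epsilon> k S \<alpha> \<gamma> q \<longleftrightarrow> (\<forall>u\<in>vertices S. \<forall>v\<in>vertices S. q \<bullet> u < q \<bullet> v \<longrightarrow>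
     (\<forall>y\<in>S. \<forall>z\<in>S. \<alpha> {u} \<bullet> y = \<gamma> {u} - depth \<epsilon> k {u} \<longrightarrow> \<alpha> {v} \<bullet> z = \<gamma> {v} - depth \<epsilon> k {v} \<longrightarrow>
        q \<bullet> y < q \<bullet> z))"

text \<open>The level is 0 because the model of a vertex section has the vertex at the origin; a
  placement turns 0 into the level of the vertex.\<close>

definition one_sided :: "real \<Rightarrow> nat \<Rightarrow> 'a::euclidean_space set \<Rightarrow> ('a set \<Rightarrow> 'a) \<Rightarrow> ('a set \<Rightarrow> real) \<Rightarrow> 'a \<Rightarrow> bool" where
  "one_sided \<epsilon> k S \<alpha> \<gamma> q \<longleftrightarrow> (\<forall>E\<in>insert S (proper_faces S). (\<forall>u\<in>vertices E. 0 < q \<bullet> u) \<longrightarrow>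
     (\<forall>y\<in>S. E = S \<or> \<alpha> E \<bullet> y = \<gamma> E - depth \<epsilon> k E \<longrightarrow> 0 < q \<bullet> y))"

definition combinatorial :: "real \<Rightarrow> nat \<Rightarrow> 'a::euclidean_space set \<Rightarrow> ('a set \<Rightarrow> 'a) \<Rightarrow> ('a set \<Rightarrow> real) \<Rightarrow> bool" where
  "combinatorial \<epsilon> k S \<alpha> \<gamma> \<longleftrightarrow>
    (\<forall>E\<in>proper_faces S. \<forall>F\<in>proper_faces S. \<forall>y\<in>S.
      (\<forall>G\<in>proper_faces S. \<alpha> G \<bullet> y \<le> \<gamma> G - depth \<epsilon> k G) \<longrightarrow>
      \<alpha> E \<bullet> y = \<gamma> E - depth \<epsilon> k E \<longrightarrow> \<alpha> F \<bullet> y = \<gamma> F - depth \<epsilon> k F \<longrightarrow> E \<subseteq> F \<or> F \<subseteq> E) \<and>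
    (\<forall>C\<in>chains S. \<exists>y\<in>S.
      (\<forall>E\<in>C. \<alpha> E \<bullet> y = \<gamma> E - depth \<epsilon> k E) \<and> (\<forall>E\<in>proper_faces S - C. \<alpha> E \<bullet> y < \<gamma> E - depth \<epsilon> k E))"

lemma eventually_combinatorial:
  assumes "polytope S" "aff_dim S = int n" "supports S \<alpha> \<gamma>"
  shows "\<forall>\<^sub>F \<epsilon> in at_right 0. combinatorial \<epsilon> k S \<alpha> \<gamma>"
  unfolding combinatorial_def
  by (rule eventually_conj[OF eventually_tight_nested[OF assms(1,3)] eventually_chain_point[OF assms]])

lemma eventually_one_sided:
  assumes S: "polytope S" and sup: "supports S \<alpha> \<gamma>"
  shows "\<forall>\<^sub>F \<epsilon> in at_right 0. one_sided \<epsilon> k S \<alpha> \<gamma> q"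
  unfolding one_sided_def
proof (rule eventually_ball_finite)
  show "finite (insert S (proper_faces S))" using S by (simp add: finite_proper_faces)
  show "\<forall>E\<in>insert S (proper_faces S). \<forall>\<^sub>F \<epsilon> in at_right 0. (\<forall>u\<in>vertices E. 0 < q \<bullet> u) \<longrightarrow>
      (\<forall>y\<in>S. E = S \<or> \<alpha> E \<bullet> y = \<gamma> E - depth \<epsilon> k E \<longrightarrow> 0 < q \<bullet> y)"
  proof
    fix E assume E: "E \<in> insert S (proper_faces S)"
    show "\<forall>\<^sub>F \<epsilon> in at_right 0. (\<forall>u\<in>vertices E. 0 < q \<bullet> u) \<longrightarrow>
      (\<forall>y\<in>S. E = S \<or> \<alpha> E \<bullet> y = \<gamma> E - depth \<epsilon> k E \<longrightarrow> 0 < q \<bullet> y)"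
    proof (cases "\<forall>u\<in>vertices E. 0 < q \<bullet> u")
      case True
      then have "\<forall>\<^sub>F \<epsilon> in at_right 0. \<forall>y\<in>S. E = S \<or> \<alpha> E \<bullet> y = \<gamma> E - depth \<epsilon> k E \<longrightarrow> 0 < q \<bullet> y"
        by (intro eventually_tight_gt[OF S sup E]) simp
      then show ?thesis by (rule eventually_mono) simp
    next
      case False
      then show ?thesis by (intro always_eventually allI impI) blast
    qed
  qed
qed

text \<open>The midpoint \<theta> of the two values separates: the cut at \<open>u\<close>
  eventually stays below it and the cut at \<open>v\<close> above it.\<close>

lemma eventually_separated:
  assumes S: "polytope S" and sup: "supports S \<alpha> \<gamma>" and dim: "aff_dim S \<noteq> 0"
  shows "\<forall>\<^sub>F \<epsilon> in at_right 0. separated \<epsilon> k S \<alpha> \<gamma> q"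
  unfolding separated_def
proof (intro eventually_ball_finite ballI finite_vertices S)
  fix u v assume u: "u \<in> vertices S" and v: "v \<in> vertices S"
  let ?P = "\<lambda>\<epsilon>. \<forall>y\<in>S. \<forall>z\<in>S. \<alpha> {u} \<bullet> y = \<gamma> {u} - depth \<epsilon> k {u} \<longrightarrow>
      \<alpha> {v} \<bullet> z = \<gamma> {v} - depth \<epsilon> k {v} \<longrightarrow> q \<bullet> y < q \<bullet> z"
  show "\<forall>\<^sub>F \<epsilon> in at_right 0. q \<bullet> u < q \<bullet> v \<longrightarrow> ?P \<epsilon>"
  proof (cases "q \<bullet> u < q \<bullet> v")
    case True
    define \<theta> where "\<theta> = (q \<bullet> u + q \<bullet> v) / 2"
    have \<theta>: "- \<theta> < (- q) \<bullet> u" "\<theta> < q \<bullet> v" using True by (auto simp: \<theta>_def)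
    have "\<forall>\<^sub>F \<epsilon> in at_right 0. \<forall>y\<in>S. {u} = S \<or> \<alpha> {u} \<bullet> y = \<gamma> {u} - depth \<epsilon> k {u} \<longrightarrow> - \<theta> < (- q) \<bullet> y"
      using vertex_proper_face[OF u dim] \<theta> by (intro eventually_tight_gt[OF S sup]) auto
    moreover have "\<forall>\<^sub>F \<epsilon> in at_right 0. \<forall>z\<in>S. {v} = S \<or> \<alpha> {v} \<bullet> z = \<gamma> {v} - depth \<epsilon> k {v} \<longrightarrow> \<theta> < q \<bullet> z"
      using vertex_proper_face[OF v dim] \<theta> by (intro eventually_tight_gt[OF S sup]) auto
    ultimately have "\<forall>\<^sub>F \<epsilon> in at_right 0. ?P \<epsilon>"
    proof eventually_elim
      case (elim \<epsilon>)
      show ?case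
      proof (intro ballI impI)
        fix y z assume "y \<in> S" "z \<in> S" "\<alpha> {u} \<bullet> y = \<gamma> {u} - depth \<epsilon> k {u}" "\<alpha> {v} \<bullet> z = \<gamma> {v} - depth \<epsilon> k {v}"
        then have "- \<theta> < (- q) \<bullet> y" "\<theta> < q \<bullet> z" using elim by blast+
        then show "q \<bullet> y < q \<bullet> z" by simp
      qed
    qed
    then show ?thesis by (rule eventually_mono) simp
  next
    case False
    then show ?thesis by simp
  qed
qed

section \<open>Transfer from a model to its placements\<close>

context swept_truncation
begin

text \<open>A placement carries the actual cuts back to cuts of \<open>S\<close> in which \<epsilon>
  appears through the depth alone. The last condition is needed because \<open>T\<close> is defined
  by the cuts of \<open>P\<close>: which points of the section survive must be decided by the cuts
  of its own faces.\<close>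

definition modelled :: "'a set \<Rightarrow> ('a set \<Rightarrow> 'a) \<Rightarrow> ('a set \<Rightarrow> real) \<Rightarrow> nat \<Rightarrow> 'a \<Rightarrow> real \<Rightarrow> bool" where
  "modelled S \<alpha> \<gamma> k x s \<longleftrightarrow> 0 < s \<and> sim x s ` S \<subseteq> P \<and>
     (\<forall>E\<in>proper_faces S. \<forall>y. sim x s y \<in> cut_halfspace (sim x s ` E) \<longleftrightarrow> \<alpha> E \<bullet> y \<le> \<gamma> E - depth \<epsilon> k E) \<and>
     (\<forall>E\<in>proper_faces S. \<forall>y. sim x s y \<in> cut_hyperplane (sim x s ` E) \<longleftrightarrow> \<alpha> E \<bullet> y = \<gamma> E - depth \<epsilon> k E) \<and>
     (\<forall>y\<in>S. sim x s y \<in> stage (nat (aff_dim P)) P \<longleftrightarrow> (\<forall>E\<in>proper_faces S. \<alpha> E \<bullet> y \<le> \<gamma> E - depth \<epsilon> k E))"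

text \<open>A face of \<open>P\<close> containing \<open>A\<close> meets the relative interior of
  \<open>B\<close> and therefore contains \<open>B\<close>. This is how a section of a face inherits
  the cut of the face.\<close>

lemma carrier_face_eq:
  assumes A: "A \<subseteq> B" "B \<subseteq> P" "A \<inter> rel_interior B \<noteq> {}"
  shows "carrier_face A = carrier_face B"
proof -
  have "A \<subseteq> F \<longleftrightarrow> B \<subseteq> F" if F: "F face_of P" for F
  proof
    assume "A \<subseteq> F"
    then have "F \<inter> rel_interior B \<noteq> {}" using A(3) by blast
    then show "B \<subseteq> F" using subset_of_face_of[OF F A(2)] by blast
  qed (use A(1) in blast)
  then have "{F. F face_of P \<and> A \<subseteq> F} = {F. F face_of P \<and> B \<subseteq> F}" by blast
  then show ?thesis by (simp add: carrier_face_def)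
qed

lemma carrier_face_cut:
  assumes "carrier_face A = carrier_face B"
  shows "cut_halfspace A = cut_halfspace B" "cut_hyperplane A = cut_hyperplane B"
  using assms by (simp_all add: cut_halfspace_def cut_hyperplane_def)

context
  fixes S :: "'a set" and \<alpha> :: "'a set \<Rightarrow> 'a" and \<gamma> :: "'a set \<Rightarrow> real" and k :: nat and x :: 'a and s :: real
  assumes mo: "modelled S \<alpha> \<gamma> k x s"
begin

lemma mo_pos: "0 < s"
  using mo unfolding modelled_def by (elim conjE)

lemma mo_sub: "sim x s ` S \<subseteq> P"
  using mo unfolding modelled_def by (elim conjE)

lemma mo_halfspace:
  assumes "E \<in> proper_faces S"
  shows "sim x s y \<in> cut_halfspace (sim x s ` E) \<longleftrightarrow> \<alpha> E \<bullet> y \<le> \<gamma> E - depth \<epsilon> k E"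
proof -
  have "\<forall>E\<in>proper_faces S. \<forall>y. sim x s y \<in> cut_halfspace (sim x s ` E) \<longleftrightarrow> \<alpha> E \<bullet> y \<le> \<gamma> E - depth \<epsilon> k E"
    using mo unfolding modelled_def by (elim conjE)
  then have "\<forall>y. sim x s y \<in> cut_halfspace (sim x s ` E) \<longleftrightarrow> \<alpha> E \<bullet> y \<le> \<gamma> E - depth \<epsilon> k E"
    using assms by (rule bspec)
  then show ?thesis by (rule spec)
qed

lemma mo_hyperplane:
  assumes "E \<in> proper_faces S"
  shows "sim x s y \<in> cut_hyperplane (sim x s ` E) \<longleftrightarrow> \<alpha> E \<bullet> y = \<gamma> E - depth \<epsilon> k E"
proof -
  have "\<forall>E\<in>proper_faces S. \<forall>y. sim x s y \<in> cut_hyperplane (sim x s ` E) \<longleftrightarrow> \<alpha> E \<bullet> y = \<gamma> E - depth \<epsilon> k E"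
    using mo unfolding modelled_def by (elim conjE)
  then have "\<forall>y. sim x s y \<in> cut_hyperplane (sim x s ` E) \<longleftrightarrow> \<alpha> E \<bullet> y = \<gamma> E - depth \<epsilon> k E"
    using assms by (rule bspec)
  then show ?thesis by (rule spec)
qed

lemma mo_stage:
  assumes "y \<in> S"
  shows "sim x s y \<in> stage (nat (aff_dim P)) P \<longleftrightarrow> (\<forall>E\<in>proper_faces S. \<alpha> E \<bullet> y \<le> \<gamma> E - depth \<epsilon> k E)"
proof -
  have "\<forall>y\<in>S. sim x s y \<in> stage (nat (aff_dim P)) P \<longleftrightarrow> (\<forall>E\<in>proper_faces S. \<alpha> E \<bullet> y \<le> \<gamma> E - depth \<epsilon> k E)"
    using mo unfolding modelled_def by (elim conjE)
  then show ?thesis using assms by (rule bspec)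
qed

lemma mo_ne: "s \<noteq> 0"
  using mo_pos by simp

lemma mo_T:
  "sim x s y \<in> T (sim x s ` S) \<longleftrightarrow> y \<in> S \<and> (\<forall>E\<in>proper_faces S. \<alpha> E \<bullet> y \<le> \<gamma> E - depth \<epsilon> k E)"
  using mo_stage[of y] sim_eq_iff[where x=x, OF mo_ne] by (auto simp: T_def)

lemma T_sim: "z \<in> T (sim x s ` S) \<Longrightarrow> \<exists>y\<in>S. z = sim x s y"
  by (auto simp: T_def)

context
  assumes S: "polytope S" and sup: "supports S \<alpha> \<gamma>" and \<epsilon>: "0 < \<epsilon>"
begin

lemma modelled_simple_truncation:
  assumes dim: "aff_dim S = int n" and comb: "combinatorial \<epsilon> k S \<alpha> \<gamma>"
  shows "simple_truncation n (sim x s ` S)"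
  unfolding simple_truncation_def
proof (intro conjI ballI impI)
  let ?X = "sim x s ` S"
  show "polytope ?X" by (rule sim_polytope[where x=x, OF mo_ne S])
  show "aff_dim ?X = int n" using sim_aff_dim[where x=x, OF mo_ne] dim by simp
  show "T ?X = ?X \<inter> (\<Inter>E\<in>proper_faces ?X. cut_halfspace E)"
  proof (rule set_eqI)
    fix z
    show "z \<in> T ?X \<longleftrightarrow> z \<in> ?X \<inter> (\<Inter>E\<in>proper_faces ?X. cut_halfspace E)"
    proof (cases "z \<in> ?X")
      case True
      then obtain y where y: "y \<in> S" "z = sim x s y" by blast
      have "z \<in> (\<Inter>E\<in>proper_faces ?X. cut_halfspace E) \<longleftrightarrow>
          (\<forall>E\<in>proper_faces S. sim x s y \<in> cut_halfspace (sim x s ` E))"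
        unfolding sim_proper_faces[where x=x, OF mo_ne] y(2) by blast
      also have "\<dots> \<longleftrightarrow> (\<forall>E\<in>proper_faces S. \<alpha> E \<bullet> y \<le> \<gamma> E - depth \<epsilon> k E)"
        using mo_halfspace by (intro ball_cong refl) simp
      finally show ?thesis using True mo_T[of y] y by simp
    next
      case False
      then show ?thesis by (auto simp: T_def)
    qed
  qed
  show "T ?X \<inter> E = {}" if EX: "E \<in> proper_faces ?X" for E
  proof (rule ccontr)
    assume "T ?X \<inter> E \<noteq> {}"
    then obtain z where z: "z \<in> T ?X" "z \<in> E" by blast
    obtain F where F: "F \<in> proper_faces S" "E = sim x s ` F"
      using EX sim_proper_faces[where x=x, OF mo_ne] by auto
    then obtain y where y: "y \<in> F" "z = sim x s y" using z(2) by blast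
    have yS: "y \<in> S" "\<alpha> F \<bullet> y \<le> \<gamma> F - depth \<epsilon> k F" using z(1) y(2) F(1) mo_T[of y] by auto
    have "\<alpha> F \<bullet> y = \<gamma> F" using supports_eq_iff[OF sup F(1) yS(1)] y(1) by simp
    then show False using yS(2) depth_pos[OF \<epsilon>, of k F] by simp
  qed
  show "E \<subseteq> F \<or> F \<subseteq> E"
    if EF: "E \<in> proper_faces ?X" "F \<in> proper_faces ?X" "T ?X \<inter> cut_hyperplane E \<inter> cut_hyperplane F \<noteq> {}" for E F
  proof -
    obtain z where z: "z \<in> T ?X" "z \<in> cut_hyperplane E" "z \<in> cut_hyperplane F" using EF(3) by blast
    obtain E' where E': "E' \<in> proper_faces S" "E = sim x s ` E'"
      using EF(1) sim_proper_faces[where x=x, OF mo_ne] by auto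
    obtain F' where F': "F' \<in> proper_faces S" "F = sim x s ` F'"
      using EF(2) sim_proper_faces[where x=x, OF mo_ne] by auto
    obtain y where y: "y \<in> S" "z = sim x s y" using T_sim[OF z(1)] by blast
    have 1: "\<forall>G\<in>proper_faces S. \<alpha> G \<bullet> y \<le> \<gamma> G - depth \<epsilon> k G" using z(1) y mo_T[of y] by simp
    have 2: "\<alpha> E' \<bullet> y = \<gamma> E' - depth \<epsilon> k E'" "\<alpha> F' \<bullet> y = \<gamma> F' - depth \<epsilon> k F'"
      using z(2,3) y(2) E' F' mo_hyperplane by auto
    have nested: "\<forall>E\<in>proper_faces S. \<forall>F\<in>proper_faces S. \<forall>y\<in>S.
      (\<forall>G\<in>proper_faces S. \<alpha> G \<bullet> y \<le> \<gamma> G - depth \<epsilon> k G) \<longrightarrow>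
      \<alpha> E \<bullet> y = \<gamma> E - depth \<epsilon> k E \<longrightarrow> \<alpha> F \<bullet> y = \<gamma> F - depth \<epsilon> k F \<longrightarrow> E \<subseteq> F \<or> F \<subseteq> E"
      using comb unfolding combinatorial_def by (rule conjunct1)
    have "E' \<subseteq> F' \<or> F' \<subseteq> E'"
      by (rule bspec[OF bspec[OF bspec[OF nested E'(1)] F'(1)] y(1), rule_format, OF _ 2]) (use 1 in blast)
    then show ?thesis using E'(2) F'(2) by blast
  qed
  show "\<exists>y\<in>T ?X. \<forall>E\<in>proper_faces ?X. y \<in> cut_hyperplane E \<longleftrightarrow> E \<in> C" if C: "C \<in> chains ?X" for C
  proof -
    obtain D where D: "D \<in> chains S" "C = (\<lambda>F. sim x s ` F) ` D" by (rule sim_chains[where x=x, OF mo_ne C])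
    have "\<forall>C\<in>chains S. \<exists>y\<in>S. (\<forall>E\<in>C. \<alpha> E \<bullet> y = \<gamma> E - depth \<epsilon> k E) \<and>
        (\<forall>E\<in>proper_faces S - C. \<alpha> E \<bullet> y < \<gamma> E - depth \<epsilon> k E)"
      using comb unfolding combinatorial_def by (rule conjunct2)
    then obtain y where y: "y \<in> S" "\<forall>E\<in>D. \<alpha> E \<bullet> y = \<gamma> E - depth \<epsilon> k E"
        "\<forall>E\<in>proper_faces S - D. \<alpha> E \<bullet> y < \<gamma> E - depth \<epsilon> k E"
      using D(1) by blast
    have iff: "\<alpha> E \<bullet> y = \<gamma> E - depth \<epsilon> k E \<longleftrightarrow> E \<in> D" "\<alpha> E \<bullet> y \<le> \<gamma> E - depth \<epsilon> k E"
      if "E \<in> proper_faces S" for E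
      using y(2,3) that by (cases "E \<in> D"; force)+
    have "sim x s y \<in> T ?X" using mo_T[of y] y(1) iff(2) by simp
    moreover have "sim x s y \<in> cut_hyperplane E \<longleftrightarrow> E \<in> C" if EX: "E \<in> proper_faces ?X" for E
    proof -
      obtain F where F: "F \<in> proper_faces S" "E = sim x s ` F"
        using EX sim_proper_faces[where x=x, OF mo_ne] by auto
      have "E \<in> C \<longleftrightarrow> F \<in> D" unfolding D(2) F(2) image_iff sim_image_eq_iff[where x=x, OF mo_ne] by simp
      then show ?thesis using mo_hyperplane[OF F(1), of y] iff(1)[OF F(1)] F(2) by simp
    qed
    ultimately show ?thesis by blast
  qed
qed

lemma modelled_ordered:
  assumes dim: "aff_dim S \<noteq> 0" and sep: "separated \<epsilon> k S \<alpha> \<gamma> q"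
  shows "ordered_near_vertices q (sim x s ` S)"
  unfolding ordered_near_vertices_def
proof (intro ballI impI)
  fix u v y z
  assume u: "u \<in> vertices (sim x s ` S)" and v: "v \<in> vertices (sim x s ` S)" and lt: "q \<bullet> u < q \<bullet> v"
    and y: "y \<in> tface (sim x s ` S) {{u}}" and z: "z \<in> tface (sim x s ` S) {{v}}"
  obtain u' v' where u': "u' \<in> vertices S" "u = sim x s u'" and v': "v' \<in> vertices S" "v = sim x s v'"
    using u v sim_vertices[where x=x, OF mo_ne] by auto
  obtain y' z' where y': "y' \<in> S" "y = sim x s y'" and z': "z' \<in> S" "z = sim x s z'"
    using T_sim[of y] T_sim[of z] y z by (auto simp: tface_def)
  have "q \<bullet> u' < q \<bullet> v'" using lt mo_pos by (simp add: u'(2) v'(2) inner_sim)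
  moreover have "\<alpha> {u'} \<bullet> y' = \<gamma> {u'} - depth \<epsilon> k {u'}"
    using mo_hyperplane[OF vertex_proper_face[OF u'(1) dim], of y'] y y'(2) u'(2) by (simp add: tface_def)
  moreover have "\<alpha> {v'} \<bullet> z' = \<gamma> {v'} - depth \<epsilon> k {v'}"
    using mo_hyperplane[OF vertex_proper_face[OF v'(1) dim], of z'] z z'(2) v'(2) by (simp add: tface_def)
  ultimately have "q \<bullet> y' < q \<bullet> z'"
    using sep u'(1) v'(1) y'(1) z'(1) unfolding separated_def by blast
  then show "q \<bullet> y < q \<bullet> z" using mo_pos by (simp add: y'(2) z'(2) inner_sim)
qed

lemma modelled_above:
  assumes os: "one_sided \<epsilon> k S \<alpha> \<gamma> q"
  shows "above_near_faces q (q \<bullet> x) (sim x s ` S)"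
  unfolding above_near_faces_def
proof (intro ballI impI)
  fix E z
  assume E: "E \<in> insert (sim x s ` S) (proper_faces (sim x s ` S))" and up: "\<forall>u\<in>vertices E. q \<bullet> x < q \<bullet> u"
    and z: "z \<in> T (sim x s ` S)" "E = sim x s ` S \<or> z \<in> cut_hyperplane E"
  obtain F where F: "F \<in> insert S (proper_faces S)" "E = sim x s ` F"
    using E sim_proper_faces[where x=x, OF mo_ne] by auto
  obtain y where y: "y \<in> S" "z = sim x s y" using T_sim[OF z(1)] by blast
  have "\<forall>u\<in>vertices F. 0 < q \<bullet> u"
    using up mo_pos by (simp add: F(2) sim_vertices[where x=x, OF mo_ne] inner_sim zero_less_mult_iff)
  moreover have "F = S \<or> \<alpha> F \<bullet> y = \<gamma> F - depth \<epsilon> k F"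
    using z(2) F sim_image_eq_iff[where x=x, OF mo_ne] mo_hyperplane[of F y] y(2) by blast
  ultimately have "0 < q \<bullet> y" using os F(1) y(1) unfolding one_sided_def by blast
  then show "q \<bullet> x < q \<bullet> z" using mo_pos by (simp add: y(2) inner_sim)
qed

end

end

end

subsection \<open>Sections of modelled polytopes\<close>

context swept_truncation
begin

lemma modelled_carrier:
  assumes mo: "modelled S \<alpha> \<gamma> k x s" and F: "F face_of S" and A: "A \<subseteq> F" "A \<inter> rel_interior F \<noteq> {}"
  shows "carrier_face (sim x s ` A) = carrier_face (sim x s ` F)"
proof (rule carrier_face_eq)
  have s: "s \<noteq> 0" using mo_pos[OF mo] by simp
  show "sim x s ` A \<subseteq> sim x s ` F" using A(1) by blast
  show "sim x s ` F \<subseteq> P" using face_of_imp_subset[OF F] mo_sub[OF mo] by blast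
  show "sim x s ` A \<inter> rel_interior (sim x s ` F) \<noteq> {}"
    unfolding sim_rel_interior[where x=x, OF s] using A(2) by blast
qed

lemmas modelled_cut = carrier_face_cut[OF modelled_carrier]

end

text \<open>On the vertices of \<open>W\<close> the slack of such a face has a positive minimum,
  which the depth eventually undercuts.\<close>

lemma eventually_far_slice:
  fixes S W :: "'a::euclidean_space set"
  assumes S: "polytope S" and sup: "supports S \<alpha> \<gamma>" and W: "polytope W" "W \<subseteq> S"
  shows "\<forall>\<^sub>F \<epsilon> in at_right 0. \<forall>F\<in>proper_faces S. F \<inter> W = {} \<longrightarrow>
    (\<forall>y\<in>W. \<alpha> F \<bullet> y \<le> \<gamma> F - depth \<epsilon> k F)"
proof (intro eventually_ball_finite ballI finite_proper_faces S)
  fix F assume F: "F \<in> proper_faces S"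
  show "\<forall>\<^sub>F \<epsilon> in at_right 0. F \<inter> W = {} \<longrightarrow> (\<forall>y\<in>W. \<alpha> F \<bullet> y \<le> \<gamma> F - depth \<epsilon> k F)"
  proof (cases "F \<inter> W = {}")
    case True
    have pos: "0 < \<gamma> F - \<alpha> F \<bullet> u" if "u \<in> vertices W" for u
    proof -
      have "u \<in> W" using that vertices_subset by blast
      then have "u \<in> S" "u \<notin> F" using W(2) True by auto
      then show ?thesis using supports_le[OF sup F, of u] supports_eq_iff[OF sup F, of u] by simp
    qed
    obtain c where c: "0 < c" "\<forall>u\<in>vertices W. c \<le> \<gamma> F - \<alpha> F \<bullet> u"
      using finite_pos_lower_bound[OF finite_vertices[OF W(1)], of "\<lambda>u. \<gamma> F - \<alpha> F \<bullet> u"] pos by auto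
    have "0 < min 1 c" using c(1) by simp
    from eventually_small[OF this] show ?thesis
    proof eventually_elim
      case (elim \<epsilon>)
      show ?case
      proof (intro impI ballI)
        fix y assume "y \<in> W"
        then obtain u where "u \<in> vertices W" "\<alpha> F \<bullet> y \<le> \<alpha> F \<bullet> u" using polytope_vertex_ge[OF W(1)] by blast
        moreover have "depth \<epsilon> k F \<le> \<epsilon>" using elim by (intro depth_le) auto
        ultimately show "\<alpha> F \<bullet> y \<le> \<gamma> F - depth \<epsilon> k F" using c(2) elim by force
      qed
    qed
  next
    case False
    then show ?thesis by (intro always_eventually allI impI) simp
  qed
qed

text \<open>Slicing does not rescale: a proper face of the slice is cut by the hyperplane of the
  face of \<open>S\<close> that it comes from, whose dimension is one higher; hence
  \<open>Suc k\<close>. The threshold comes from the model, and placements are quantified inside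
  because they will vary with \<epsilon>.\<close>

lemma slice_model:
  fixes S :: "'a::euclidean_space set"
  assumes sl: "transversal_slice S q h" and sup: "supports S \<alpha> \<gamma>"
  shows "\<exists>\<alpha>' \<gamma>'. supports (S \<inter> {x. q \<bullet> x = h}) \<alpha>' \<gamma>' \<and>
    (\<forall>\<^sub>F \<epsilon> in at_right 0. \<forall>P a b x s. swept_truncation.modelled P a b \<epsilon> S \<alpha> \<gamma> k x s \<longrightarrow>
       swept_truncation.modelled P a b \<epsilon> (S \<inter> {x. q \<bullet> x = h}) \<alpha>' \<gamma>' (Suc k) x s)"
proof -
  interpret ts: transversal_slice S q h by (rule sl)
  let ?W = "S \<inter> ts.hyp"
  have SS: "S face_of S" using ts.K by (simp add: face_of_refl polytope_imp_convex)
  have "\<exists>F. F \<in> proper_faces S \<and> E = F \<inter> ts.hyp" if E: "E \<in> proper_faces ?W" for E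
  proof -
    have "E \<in> faces ?W" "E \<noteq> ?W" using E by (auto simp: proper_faces_def)
    then obtain F where F: "E = F \<inter> ts.hyp" "F face_of S" "F \<inter> ts.hyp \<noteq> {}" unfolding ts.slice_faces by blast
    moreover have "F \<noteq> S" using F(1) \<open>E \<noteq> ?W\<close> by auto
    ultimately show ?thesis by (auto simp: proper_faces_iff)
  qed
  then obtain up where up: "\<And>E. E \<in> proper_faces ?W \<Longrightarrow> up E \<in> proper_faces S \<and> E = up E \<inter> ts.hyp" by metis
  have upE: "up E \<in> proper_faces S" "E = up E \<inter> ts.hyp" "up E face_of S" "up E \<inter> ts.hyp \<noteq> {}"
    if E: "E \<in> proper_faces ?W" for E
  proof -
    show 1: "up E \<in> proper_faces S" using up[OF E] by (rule conjunct1)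
    show 2: "E = up E \<inter> ts.hyp" using up[OF E] by (rule conjunct2)
    show "up E face_of S" using 1 by (simp add: proper_faces_iff)
    show "up E \<inter> ts.hyp \<noteq> {}" using E unfolding 2[symmetric] by (simp add: proper_faces_iff)
  qed
  define \<alpha>' where "\<alpha>' = (\<lambda>E. \<alpha> (up E))"
  define \<gamma>' where "\<gamma>' = (\<lambda>E. \<gamma> (up E))"
  have "supports ?W \<alpha>' \<gamma>'"
    unfolding supports_def
  proof (intro ballI conjI)
    fix E assume E: "E \<in> proper_faces ?W"
    show "?W \<subseteq> {x. \<alpha>' E \<bullet> x \<le> \<gamma>' E}"
      using supports_le[OF sup upE(1)[OF E]] by (auto simp: \<alpha>'_def \<gamma>'_def)
    show "E = ?W \<inter> {x. \<alpha>' E \<bullet> x = \<gamma>' E}"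
    proof (rule set_eqI)
      fix y
      have "y \<in> E \<longleftrightarrow> y \<in> up E \<and> y \<in> ts.hyp" using upE(2)[OF E] by blast
      also have "\<dots> \<longleftrightarrow> y \<in> ?W \<inter> {x. \<alpha>' E \<bullet> x = \<gamma>' E}"
        using supports_eq_iff[OF sup upE(1)[OF E], of y] face_of_imp_subset[OF upE(3)[OF E]]
        by (auto simp: \<alpha>'_def \<gamma>'_def)
      finally show "y \<in> E \<longleftrightarrow> y \<in> ?W \<inter> {x. \<alpha>' E \<bullet> x = \<gamma>' E}" .
    qed
  qed
  moreover have "\<forall>\<^sub>F \<epsilon> in at_right 0. \<forall>P a b x s. swept_truncation.modelled P a b \<epsilon> S \<alpha> \<gamma> k x s \<longrightarrow>
       swept_truncation.modelled P a b \<epsilon> ?W \<alpha>' \<gamma>' (Suc k) x s"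
    using eventually_far_slice[OF ts.K sup ts.slice_polytope Int_lower1, of k]
  proof eventually_elim
    case (elim \<epsilon>)
    show ?case
    proof (intro allI impI)
      fix P :: "'a set" and a b x s
      assume mo: "swept_truncation.modelled P a b \<epsilon> S \<alpha> \<gamma> k x s"
      interpret swept_truncation P a b \<epsilon> .
      have dep: "depth \<epsilon> (Suc k) E = depth \<epsilon> k (up E)" if E: "E \<in> proper_faces ?W" for E
      proof -
        have "aff_dim E = aff_dim (up E) - 1"
          using ts.slice_aff_dim[OF upE(3,4)[OF E]] upE(2)[OF E] by simp
        moreover have "0 \<le> aff_dim E" using proper_face_aff_dim(1)[OF ts.slice_polytope E] .
        ultimately have "nat (aff_dim (up E)) = Suc (nat (aff_dim E))" by simp
        then show ?thesis by (simp add: depth_def)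
      qed
      have meets: "E \<inter> rel_interior (up E) \<noteq> {}" "E \<subseteq> up E" if E: "E \<in> proper_faces ?W" for E
      proof -
        show "E \<subseteq> up E" using upE(2)[OF E] by blast
        have "rel_interior (up E) \<inter> ts.hyp \<noteq> {}" by (rule ts.slice_rel_interior[OF upE(3,4)[OF E]])
        then show "E \<inter> rel_interior (up E) \<noteq> {}" using upE(2)[OF E] rel_interior_subset by blast
      qed
      show "modelled ?W \<alpha>' \<gamma>' (Suc k) x s"
        unfolding modelled_def
      proof (intro conjI ballI allI)
        show "0 < s" by (rule mo_pos[OF mo])
        show "sim x s ` ?W \<subseteq> P" using mo_sub[OF mo] by blast
      next
        fix E y assume E: "E \<in> proper_faces ?W"
        show "sim x s y \<in> cut_halfspace (sim x s ` E) \<longleftrightarrow> \<alpha>' E \<bullet> y \<le> \<gamma>' E - depth \<epsilon> (Suc k) E"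
          unfolding modelled_cut(1)[OF mo upE(3)[OF E] meets(2,1)[OF E]] \<alpha>'_def \<gamma>'_def dep[OF E]
          by (rule mo_halfspace[OF mo upE(1)[OF E]])
        show "sim x s y \<in> cut_hyperplane (sim x s ` E) \<longleftrightarrow> \<alpha>' E \<bullet> y = \<gamma>' E - depth \<epsilon> (Suc k) E"
          unfolding modelled_cut(2)[OF mo upE(3)[OF E] meets(2,1)[OF E]] \<alpha>'_def \<gamma>'_def dep[OF E]
          by (rule mo_hyperplane[OF mo upE(1)[OF E]])
      next
        fix y assume y: "y \<in> ?W"
        have "(\<forall>F\<in>proper_faces S. \<alpha> F \<bullet> y \<le> \<gamma> F - depth \<epsilon> k F) \<longleftrightarrow>
            (\<forall>E\<in>proper_faces ?W. \<alpha>' E \<bullet> y \<le> \<gamma>' E - depth \<epsilon> (Suc k) E)"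
        proof (intro iffI ballI)
          fix E assume *: "\<forall>F\<in>proper_faces S. \<alpha> F \<bullet> y \<le> \<gamma> F - depth \<epsilon> k F" and E: "E \<in> proper_faces ?W"
          show "\<alpha>' E \<bullet> y \<le> \<gamma>' E - depth \<epsilon> (Suc k) E"
            unfolding \<alpha>'_def \<gamma>'_def dep[OF E] using * upE(1)[OF E] by (rule bspec)
        next
          fix F assume *: "\<forall>E\<in>proper_faces ?W. \<alpha>' E \<bullet> y \<le> \<gamma>' E - depth \<epsilon> (Suc k) E" and F: "F \<in> proper_faces S"
          have FS: "F face_of S" "F \<noteq> S" using F by (auto simp: proper_faces_iff)
          have FW: "F \<inter> ?W = F \<inter> ts.hyp" using face_of_imp_subset[OF FS(1)] by blast
          show "\<alpha> F \<bullet> y \<le> \<gamma> F - depth \<epsilon> k F"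
          proof (cases "F \<inter> ts.hyp = {}")
            case True
            then have "F \<inter> ?W = {}" using FW by simp
            then show ?thesis using elim F y by blast
          next
            case False
            have "F \<inter> ts.hyp \<in> faces ?W" unfolding ts.slice_faces using FS(1) False by blast
            moreover have "F \<inter> ts.hyp \<noteq> ?W" using ts.slice_eq_iff[OF FS(1) False SS] FS(2) by simp
            ultimately have E: "F \<inter> ts.hyp \<in> proper_faces ?W" by (simp add: proper_faces_def)
            have "up (F \<inter> ts.hyp) = F"
              using ts.slice_eq_iff[OF FS(1) False upE(3)[OF E]] upE(2)[OF E] by simp
            then show ?thesis using bspec[OF * E] dep[OF E] by (simp add: \<alpha>'_def \<gamma>'_def)
          qed
        qed
        then show "sim x s y \<in> stage (nat (aff_dim P)) P \<longleftrightarrow>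
            (\<forall>E\<in>proper_faces ?W. \<alpha>' E \<bullet> y \<le> \<gamma>' E - depth \<epsilon> (Suc k) E)"
          using mo_stage[OF mo, of y] y by simp
      qed
    qed
  qed
  ultimately show ?thesis by blast
qed

text \<open>The section shrinks to \<open>v\<close>, where a face missing \<open>v\<close> has
  positive slack. \<open>M\<close> bounds the increase of the functional of \<open>F\<close> over
  \<open>Y\<close>, and the 1 in \<open>M + 1\<close> pays for the depth of the cut along
  \<open>F\<close>.\<close>

lemma eventually_far_vertex:
  fixes S Y :: "'a::euclidean_space set"
  assumes S: "polytope S" and sup: "supports S \<alpha> \<gamma>" and Y: "polytope Y" and v: "v \<in> S"
  shows "\<forall>\<^sub>F \<epsilon> in at_right 0. \<forall>F\<in>proper_faces S. v \<notin> F \<longrightarrow>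
    (\<forall>y\<in>Y. \<alpha> F \<bullet> (v + depth \<epsilon> k {v} *\<^sub>R y) \<le> \<gamma> F - depth \<epsilon> k F)"
proof (intro eventually_ball_finite ballI finite_proper_faces S)
  fix F assume F: "F \<in> proper_faces S"
  show "\<forall>\<^sub>F \<epsilon> in at_right 0. v \<notin> F \<longrightarrow> (\<forall>y\<in>Y. \<alpha> F \<bullet> (v + depth \<epsilon> k {v} *\<^sub>R y) \<le> \<gamma> F - depth \<epsilon> k F)"
  proof (cases "v \<in> F")
    case False
    have g: "0 < \<gamma> F - \<alpha> F \<bullet> v"
      using supports_le[OF sup F v] supports_eq_iff[OF sup F v] False by simp
    obtain M where M: "0 < M" "\<forall>u\<in>vertices Y. \<alpha> F \<bullet> u \<le> M"
      using finite_upper_bound[OF finite_vertices[OF Y], of "\<lambda>u. \<alpha> F \<bullet> u"] by auto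
    have "0 < min 1 ((\<gamma> F - \<alpha> F \<bullet> v) / (M + 1))" using g M(1) by simp
    from eventually_small[OF this] show ?thesis
    proof eventually_elim
      case (elim \<epsilon>)
      then have e: "0 < \<epsilon>" "\<epsilon> < 1" "\<epsilon> * (M + 1) < \<gamma> F - \<alpha> F \<bullet> v"
        using M(1) by (auto simp: pos_less_divide_eq)
      show ?case
      proof (intro impI ballI)
        fix y assume "y \<in> Y"
        then obtain u where u: "u \<in> vertices Y" "\<alpha> F \<bullet> y \<le> \<alpha> F \<bullet> u" using polytope_vertex_ge[OF Y] by blast
        have "\<alpha> F \<bullet> y \<le> M" using u M(2) by force
        then have "depth \<epsilon> k {v} * (\<alpha> F \<bullet> y) \<le> depth \<epsilon> k {v} * M"
          using depth_pos[OF e(1), of k "{v}"] by (intro mult_left_mono) auto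
        also have "\<dots> \<le> \<epsilon> * M" using depth_le[OF e(1,2), of k "{v}"] M(1) by (intro mult_right_mono) auto
        finally have 1: "depth \<epsilon> k {v} * (\<alpha> F \<bullet> y) \<le> \<epsilon> * M" .
        have "\<alpha> F \<bullet> (v + depth \<epsilon> k {v} *\<^sub>R y) = \<alpha> F \<bullet> v + depth \<epsilon> k {v} * (\<alpha> F \<bullet> y)"
          by (simp add: inner_add_right)
        moreover have "\<epsilon> * (M + 1) = \<epsilon> * M + \<epsilon>" by (simp add: algebra_simps)
        ultimately show "\<alpha> F \<bullet> (v + depth \<epsilon> k {v} *\<^sub>R y) \<le> \<gamma> F - depth \<epsilon> k F"
          using 1 e(3) depth_le[OF e(1,2), of k F] by linarith
      qed
    qed
  next
    case True
    then show ?thesis by (intro always_eventually allI impI) simp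
  qed
qed

text \<open>
  Below a vertex \<open>v\<close>, all shallow sections are homothetic to one fixed polytope, and rescaling by
  the depth of the cut at \<open>v\<close> turns the cuts of the faces through \<open>v\<close> into cuts of the section.
\<close>

lemma vertex_model:
  fixes S :: "'a::euclidean_space set"
  assumes S: "polytope S" "aff_dim S = int (Suc m)" and sup: "supports S \<alpha> \<gamma>" and v: "v \<in> vertices S"
  shows "\<exists>Y \<alpha>'. polytope Y \<and> aff_dim Y = int m \<and> supports Y \<alpha>' (\<lambda>_. 0) \<and>
    (\<forall>q. inj_on (\<lambda>x. q \<bullet> x) (vertices S) \<longrightarrow> (\<forall>u\<in>vertices Y. q \<bullet> u \<noteq> 0)) \<and>
    (\<forall>\<^sub>F \<epsilon> in at_right 0. \<forall>P a b x s. swept_truncation.modelled P a b \<epsilon> S \<alpha> \<gamma> k x s \<longrightarrow>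
       swept_truncation.Q P a b \<epsilon> (sim x s ` S) (sim x s v) = sim (sim x s v) (s * depth \<epsilon> k {v}) ` Y \<and>
       swept_truncation.modelled P a b \<epsilon> Y \<alpha>' (\<lambda>_. 0) 0 (sim x s v) (s * depth \<epsilon> k {v}) \<and>
       swept_truncation.vertex_section P a b \<epsilon> (sim x s ` S) (sim x s v))"
proof -
  let ?c = "\<alpha> {v}" and ?h = "\<gamma> {v}"
  have vS: "v \<in> S" using v vertices_subset by blast
  have vP: "{v} \<in> proper_faces S" using vertex_proper_face[OF v] S(2) by simp
  have SS: "S face_of S" using S by (simp add: face_of_refl polytope_imp_convex)
  have Sv: "S \<noteq> {v}"
  proof
    assume "S = {v}"
    then have "aff_dim S = 0" by simp
    then show False using S(2) by simp
  qed
  have cv: "?c \<bullet> v = ?h" using supports_eq_iff[OF sup vP vS] by simp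
  have gap: "0 < ?h - ?c \<bullet> u" if "u \<in> vertices S - {v}" for u
  proof -
    have u: "u \<in> S" "u \<notin> {v}" using that vertices_subset by auto
    then show ?thesis using supports_le[OF sup vP u(1)] supports_eq_iff[OF sup vP u(1)] by simp
  qed
  obtain c0 where c0: "0 < c0" "\<forall>u\<in>vertices S - {v}. c0 \<le> ?h - ?c \<bullet> u"
    using finite_pos_lower_bound[of "vertices S - {v}" "\<lambda>u. ?h - ?c \<bullet> u"] finite_vertices[OF S(1)] gap by auto
  \<comment> \<open>Half the smallest gap, so that the other vertices lie strictly deeper than
    \<open>t0\<close>.\<close>
  define t0 where "t0 = c0 / 2"
  have t0: "0 < t0" "\<And>u. u \<in> vertices S \<Longrightarrow> u \<noteq> v \<Longrightarrow> ?c \<bullet> u < ?h - t0"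
    using c0 by (force simp: t0_def)+
  have slice: "vertex_slice S v ?c (?h - t)" if "0 < t" "t \<le> t0" for t
  proof
    show "?h - t < ?c \<bullet> v" using cv that by simp
    show "?c \<bullet> u < ?h - t" if "u \<in> vertices S" "u \<noteq> v" for u
      using t0(2)[OF that] \<open>t \<le> t0\<close> by simp
  qed (use S v in simp_all)
  interpret vs: vertex_slice S v ?c "?h - t0" by (rule slice) (use t0 in simp_all)
  \<comment> \<open>Moves \<open>v\<close> to the origin and scales depth \<open>t0\<close> to depth
    1; this normalisation does not depend on \<epsilon>.\<close>
  define \<psi> where "\<psi> = sim (- (1 / t0) *\<^sub>R v) (1 / t0)"
  have \<psi>: "\<psi> y = (1 / t0) *\<^sub>R (y - v)" for y by (simp add: \<psi>_def sim_def algebra_simps)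
  have t0': "1 / t0 \<noteq> 0" using t0 by simp
  have level: "F \<inter> {x. ?c \<bullet> x = ?h - t} = sim v t ` \<psi> ` (F \<inter> {x. ?c \<bullet> x = ?h - t0})"
    if F: "F face_of S" "v \<in> F" and t: "0 < t" "t \<le> t0" for F t
  proof -
    have "polytope F" "vertices F = vertices S \<inter> F"
      using F S face_of_polytope_polytope vertices_face by blast+
    then show ?thesis
      using vertex_section_homothetic[of F v ?c ?h t0 t] F(2) v cv t0(2) t
      by (simp add: sim_def[abs_def] \<psi>[abs_def])
  qed
  define Y where "Y = \<psi> ` (S \<inter> vs.hyp)"
  have polY: "polytope Y"
    unfolding Y_def \<psi>_def by (rule sim_polytope[OF t0' vs.slice_polytope])
  have ne: "F \<inter> vs.hyp \<noteq> {}" if "F face_of S" "v \<in> F" "F \<noteq> {v}" for F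
    using vs.vertex_slice_nonempty_iff[OF that(1)] that(2,3) by simp
  have dims: "aff_dim (\<psi> ` (F \<inter> vs.hyp)) = aff_dim F - 1" if "F face_of S" "v \<in> F" "F \<noteq> {v}" for F
    unfolding \<psi>_def sim_aff_dim[OF t0'] by (rule vs.slice_aff_dim[OF that(1) ne[OF that]])
  have dimY: "aff_dim Y = int m"
    unfolding Y_def using dims[OF SS vS Sv] S(2) by simp
  have PFY: "proper_faces Y = {\<psi> ` (F \<inter> vs.hyp) | F. F \<in> proper_faces S \<and> v \<in> F \<and> F \<noteq> {v}}"
    unfolding Y_def \<psi>_def sim_proper_faces[OF t0'] vs.vertex_slice_proper_faces[OF Sv] by blast
  have "\<exists>F. F \<in> proper_faces S \<and> v \<in> F \<and> F \<noteq> {v} \<and> E = \<psi> ` (F \<inter> vs.hyp)" if "E \<in> proper_faces Y" for E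
    using that unfolding PFY by blast
  then obtain up where up: "\<And>E. E \<in> proper_faces Y \<Longrightarrow>
      up E \<in> proper_faces S \<and> v \<in> up E \<and> up E \<noteq> {v} \<and> E = \<psi> ` (up E \<inter> vs.hyp)"
    by metis
  have upE: "up E \<in> proper_faces S" "v \<in> up E" "up E \<noteq> {v}" "E = \<psi> ` (up E \<inter> vs.hyp)" "up E face_of S"
    if E: "E \<in> proper_faces Y" for E
    using up[OF E] by (simp_all add: proper_faces_iff)
  have up_eq: "up (\<psi> ` (F \<inter> vs.hyp)) = F" if F: "F \<in> proper_faces S" "v \<in> F" "F \<noteq> {v}" for F
  proof -
    have E: "\<psi> ` (F \<inter> vs.hyp) \<in> proper_faces Y" unfolding PFY using F by blast
    have FS: "F face_of S" using F(1) by (simp add: proper_faces_iff)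
    have "F \<inter> vs.hyp = up (\<psi> ` (F \<inter> vs.hyp)) \<inter> vs.hyp"
      using upE(4)[OF E] unfolding \<psi>_def sim_image_eq_iff[OF t0'] .
    then show ?thesis using vs.slice_eq_iff[OF FS ne[OF FS F(2,3)] upE(5)[OF E]] by simp
  qed
  \<comment> \<open>The offsets of the model are 0: hyperplanes supporting faces through
    \<open>v\<close> pass through the origin once \<open>v\<close> is moved there.\<close>
  define \<alpha>' where "\<alpha>' = (\<lambda>E. \<alpha> (up E))"
  have \<alpha>v: "\<alpha> F \<bullet> v = \<gamma> F" if "F \<in> proper_faces S" "v \<in> F" for F
    using supports_eq_iff[OF sup that(1) vS] that(2) by simp
  have supY: "supports Y \<alpha>' (\<lambda>_. 0)"
    unfolding supports_def
  proof (intro ballI conjI)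
    fix E assume E: "E \<in> proper_faces Y"
    let ?F = "up E"
    have val: "\<alpha>' E \<bullet> \<psi> y = (\<alpha> ?F \<bullet> y - \<gamma> ?F) / t0" for y
      using \<alpha>v[OF upE(1,2)[OF E]] by (simp add: \<alpha>'_def \<psi> inner_diff_right)
    show "Y \<subseteq> {x. \<alpha>' E \<bullet> x \<le> 0}"
    proof
      fix z assume "z \<in> Y"
      then obtain y where y: "y \<in> S" "z = \<psi> y" unfolding Y_def by blast
      then show "z \<in> {x. \<alpha>' E \<bullet> x \<le> 0}"
        using supports_le[OF sup upE(1)[OF E] y(1)] t0(1) by (simp add: val divide_le_0_iff)
    qed
    show "E = Y \<inter> {x. \<alpha>' E \<bullet> x = 0}"
    proof -
      have "\<alpha>' E \<bullet> \<psi> y = 0 \<longleftrightarrow> y \<in> ?F" if "y \<in> S" for y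
        using supports_eq_iff[OF sup upE(1)[OF E] that] t0(1) by (simp add: val)
      then have "Y \<inter> {x. \<alpha>' E \<bullet> x = 0} = \<psi> ` (?F \<inter> vs.hyp)"
        using face_of_imp_subset[OF upE(5)[OF E]] unfolding Y_def by blast
      then show ?thesis using upE(4)[OF E] by simp
    qed
  qed
  have neq: "q \<bullet> u \<noteq> 0" if inj: "inj_on (\<lambda>x. q \<bullet> x) (vertices S)" and u: "u \<in> vertices Y" for q u
  proof -
    obtain y where y: "y \<in> vertices (S \<inter> vs.hyp)" "u = \<psi> y"
      using u unfolding Y_def \<psi>_def sim_vertices[OF t0'] by blast
    have "q \<bullet> y \<noteq> q \<bullet> v" by (rule vs.vertex_slice_vertex_ne[OF inj y(1)])
    then show ?thesis using t0(1) by (simp add: y(2) \<psi> inner_diff_right)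
  qed
  have t1: "0 < min 1 t0" using t0(1) by simp
  have "\<forall>\<^sub>F \<epsilon> in at_right 0. \<forall>P a b x s. swept_truncation.modelled P a b \<epsilon> S \<alpha> \<gamma> k x s \<longrightarrow>
       swept_truncation.Q P a b \<epsilon> (sim x s ` S) (sim x s v) = sim (sim x s v) (s * depth \<epsilon> k {v}) ` Y \<and>
       swept_truncation.modelled P a b \<epsilon> Y \<alpha>' (\<lambda>_. 0) 0 (sim x s v) (s * depth \<epsilon> k {v}) \<and>
       swept_truncation.vertex_section P a b \<epsilon> (sim x s ` S) (sim x s v)"
    using eventually_far_vertex[OF S(1) sup polY vS, of k] eventually_small[OF t1]
  proof eventually_elim
    case (elim \<epsilon>)
    have e: "0 < \<epsilon>" "\<epsilon> < 1" "\<epsilon> < t0" using elim(2) t0(1) by auto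
    have far: "\<alpha> F \<bullet> (v + depth \<epsilon> k {v} *\<^sub>R y) \<le> \<gamma> F - depth \<epsilon> k F"
      if "F \<in> proper_faces S" "v \<notin> F" "y \<in> Y" for F y
      using elim(1) that by blast
    define \<delta> where "\<delta> = depth \<epsilon> k {v}"
    have \<delta>: "0 < \<delta>" "\<delta> \<le> t0" using depth_pos[OF e(1), of k "{v}"] depth_le[OF e(1,2), of k "{v}"] e(3) by (auto simp: \<delta>_def)
    interpret vd: vertex_slice S v ?c "?h - \<delta>" by (rule slice[OF \<delta>])
    show ?case
    proof (intro allI impI)
      fix P :: "'a set" and a b x s
      assume mo: "swept_truncation.modelled P a b \<epsilon> S \<alpha> \<gamma> k x s"
      interpret swept_truncation P a b \<epsilon> .
      have s: "0 < s" by (rule mo_pos[OF mo])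
      then have s0: "s \<noteq> 0" by simp
      let ?v = "sim x s v" and ?t = "s * \<delta>"
      have sect: "sim x s ` F \<inter> cut_hyperplane {?v} = sim ?v ?t ` \<psi> ` (F \<inter> vs.hyp)"
        "sim x s ` F \<inter> cut_hyperplane {?v} = sim x s ` (F \<inter> vd.hyp)"
        if F: "F face_of S" "v \<in> F" for F
      proof -
        have "sim x s y \<in> cut_hyperplane {?v} \<longleftrightarrow> ?c \<bullet> y = ?h - \<delta>" for y
          using mo_hyperplane[OF mo vP, of y] by (simp add: \<delta>_def)
        then show 1: "sim x s ` F \<inter> cut_hyperplane {?v} = sim x s ` (F \<inter> vd.hyp)" by blast
        have "sim x s ` sim v \<delta> ` A = sim ?v ?t ` A" for A by (simp add: image_image sim_sim)
        then show "sim x s ` F \<inter> cut_hyperplane {?v} = sim ?v ?t ` \<psi> ` (F \<inter> vs.hyp)"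
          unfolding 1 level[OF F \<delta>] by simp
      qed
      have QY: "Q (sim x s ` S) ?v = sim ?v ?t ` Y"
        unfolding Q_def Y_def by (rule sect(1)[OF SS vS])
      have cut: "cut_halfspace (sim x s ` (F \<inter> vd.hyp)) = cut_halfspace (sim x s ` F)"
        "cut_hyperplane (sim x s ` (F \<inter> vd.hyp)) = cut_hyperplane (sim x s ` F)"
        if F: "F face_of S" "v \<in> F" "F \<noteq> {v}" for F
      proof -
        have "F \<inter> vd.hyp \<noteq> {}" using vd.vertex_slice_nonempty_iff[OF F(1)] F(2,3) by simp
        then have "rel_interior F \<inter> vd.hyp \<noteq> {}" by (rule vd.slice_rel_interior[OF F(1)])
        then have 2: "(F \<inter> vd.hyp) \<inter> rel_interior F \<noteq> {}" using rel_interior_subset[of F] by blast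
        show "cut_halfspace (sim x s ` (F \<inter> vd.hyp)) = cut_halfspace (sim x s ` F)"
          "cut_hyperplane (sim x s ` (F \<inter> vd.hyp)) = cut_hyperplane (sim x s ` F)"
          by (rule modelled_cut[OF mo F(1) Int_lower1 2])+
      qed
      have imE: "sim ?v ?t ` E = sim x s ` (up E \<inter> vd.hyp)" if E: "E \<in> proper_faces Y" for E
        using sect[OF upE(5,2)[OF E]] upE(4)[OF E] by simp
      \<comment> \<open>The exponent splits into \<open>1 + k\<close>, which is that of the cut at
        \<open>v\<close>, and the dimension of \<open>E\<close> plus one; so the shift is reset to
        0.\<close>
      have dep: "depth \<epsilon> k (up E) = \<delta> * depth \<epsilon> 0 E" if E: "E \<in> proper_faces Y" for E
      proof -
        have "aff_dim E = aff_dim (up E) - 1" using dims[OF upE(5,2,3)[OF E]] upE(4)[OF E] by simp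
        moreover have "0 \<le> aff_dim E" using proper_face_aff_dim(1)[OF polY E] .
        ultimately have "nat (aff_dim (up E)) = Suc (nat (aff_dim E))" by simp
        then show ?thesis by (simp add: depth_def \<delta>_def power_add algebra_simps)
      qed
      have val: "\<alpha> F \<bullet> (v + \<delta> *\<^sub>R y) = \<gamma> F + \<delta> * (\<alpha> F \<bullet> y)" if "F \<in> proper_faces S" "v \<in> F" for F y
        using \<alpha>v[OF that] by (simp add: inner_add_right)
      have le: "\<alpha> (up E) \<bullet> (v + \<delta> *\<^sub>R y) \<le> \<gamma> (up E) - depth \<epsilon> k (up E) \<longleftrightarrow> \<alpha>' E \<bullet> y \<le> 0 - depth \<epsilon> 0 E"
        "\<alpha> (up E) \<bullet> (v + \<delta> *\<^sub>R y) = \<gamma> (up E) - depth \<epsilon> k (up E) \<longleftrightarrow> \<alpha>' E \<bullet> y = 0 - depth \<epsilon> 0 E"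
        if E: "E \<in> proper_faces Y" for E y
      proof -
        have "\<alpha> (up E) \<bullet> (v + \<delta> *\<^sub>R y) \<le> \<gamma> (up E) - depth \<epsilon> k (up E) \<longleftrightarrow>
            \<delta> * (\<alpha> (up E) \<bullet> y) \<le> \<delta> * (- depth \<epsilon> 0 E)"
          unfolding val[OF upE(1,2)[OF E]] dep[OF E] by simp
        also have "\<dots> \<longleftrightarrow> \<alpha> (up E) \<bullet> y \<le> - depth \<epsilon> 0 E" using \<delta>(1) by (rule mult_le_cancel_left_pos)
        finally show "\<alpha> (up E) \<bullet> (v + \<delta> *\<^sub>R y) \<le> \<gamma> (up E) - depth \<epsilon> k (up E) \<longleftrightarrow> \<alpha>' E \<bullet> y \<le> 0 - depth \<epsilon> 0 E"
          by (simp add: \<alpha>'_def)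
        have "\<alpha> (up E) \<bullet> (v + \<delta> *\<^sub>R y) = \<gamma> (up E) - depth \<epsilon> k (up E) \<longleftrightarrow>
            \<delta> * (\<alpha> (up E) \<bullet> y) = \<delta> * (- depth \<epsilon> 0 E)"
          unfolding val[OF upE(1,2)[OF E]] dep[OF E] by simp
        also have "\<dots> \<longleftrightarrow> \<alpha> (up E) \<bullet> y = - depth \<epsilon> 0 E"
          unfolding mult_cancel_left using \<delta>(1) by simp
        finally show "\<alpha> (up E) \<bullet> (v + \<delta> *\<^sub>R y) = \<gamma> (up E) - depth \<epsilon> k (up E) \<longleftrightarrow> \<alpha>' E \<bullet> y = 0 - depth \<epsilon> 0 E"
          by (simp add: \<alpha>'_def)
      qed
      have pt: "sim ?v ?t y = sim x s (v + \<delta> *\<^sub>R y)" for y by (simp add: sim_def algebra_simps)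
      have mY: "modelled Y \<alpha>' (\<lambda>_. 0) 0 ?v ?t"
        unfolding modelled_def
      proof (intro conjI ballI allI)
        show "0 < ?t" using s \<delta>(1) by simp
        show "sim ?v ?t ` Y \<subseteq> P" using QY mo_sub[OF mo] unfolding Q_def by blast
      next
        fix E y assume E: "E \<in> proper_faces Y"
        show "sim ?v ?t y \<in> cut_halfspace (sim ?v ?t ` E) \<longleftrightarrow> \<alpha>' E \<bullet> y \<le> 0 - depth \<epsilon> 0 E"
          unfolding imE[OF E] cut(1)[OF upE(5,2,3)[OF E]] pt mo_halfspace[OF mo upE(1)[OF E]] by (rule le(1)[OF E])
        show "sim ?v ?t y \<in> cut_hyperplane (sim ?v ?t ` E) \<longleftrightarrow> \<alpha>' E \<bullet> y = 0 - depth \<epsilon> 0 E"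
          unfolding imE[OF E] cut(2)[OF upE(5,2,3)[OF E]] pt mo_hyperplane[OF mo upE(1)[OF E]] by (rule le(2)[OF E])
      next
        fix y assume y: "y \<in> Y"
        have "v + \<delta> *\<^sub>R y \<in> S \<inter> vd.hyp"
          using level[OF SS vS \<delta>] y unfolding Y_def by (auto simp: sim_def)
        then have yS: "v + \<delta> *\<^sub>R y \<in> S" "?c \<bullet> (v + \<delta> *\<^sub>R y) = ?h - \<delta>" by auto
        have "(\<forall>F\<in>proper_faces S. \<alpha> F \<bullet> (v + \<delta> *\<^sub>R y) \<le> \<gamma> F - depth \<epsilon> k F) \<longleftrightarrow>
            (\<forall>E\<in>proper_faces Y. \<alpha>' E \<bullet> y \<le> 0 - depth \<epsilon> 0 E)"
        proof (intro iffI ballI)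
          fix E assume *: "\<forall>F\<in>proper_faces S. \<alpha> F \<bullet> (v + \<delta> *\<^sub>R y) \<le> \<gamma> F - depth \<epsilon> k F" and E: "E \<in> proper_faces Y"
          show "\<alpha>' E \<bullet> y \<le> 0 - depth \<epsilon> 0 E" using bspec[OF * upE(1)[OF E]] le(1)[OF E, of y] by simp
        next
          fix F assume *: "\<forall>E\<in>proper_faces Y. \<alpha>' E \<bullet> y \<le> 0 - depth \<epsilon> 0 E" and F: "F \<in> proper_faces S"
          \<comment> \<open>Faces missing \<open>v\<close> are far away, the cut at \<open>v\<close>
            is the hyperplane of the section itself, and the remaining faces are those seen in the
            model.\<close>
          consider "v \<notin> F" | "F = {v}" | "v \<in> F" "F \<noteq> {v}" by blast
          then show "\<alpha> F \<bullet> (v + \<delta> *\<^sub>R y) \<le> \<gamma> F - depth \<epsilon> k F"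
          proof cases
            case 1
            then show ?thesis using far[OF F 1 y] by (simp add: \<delta>_def)
          next
            case 2
            then show ?thesis using yS(2) by (simp add: \<delta>_def)
          next
            case 3
            have E: "\<psi> ` (F \<inter> vs.hyp) \<in> proper_faces Y" unfolding PFY using F 3 by blast
            show ?thesis using bspec[OF * E] le(1)[OF E, of y] up_eq[OF F 3] by simp
          qed
        qed
        then show "sim ?v ?t y \<in> stage (nat (aff_dim P)) P \<longleftrightarrow> (\<forall>E\<in>proper_faces Y. \<alpha>' E \<bullet> y \<le> 0 - depth \<epsilon> 0 E)"
          using mo_stage[OF mo yS(1)] unfolding pt by simp
      qed
      have vsec: "vertex_section (sim x s ` S) ?v"
        unfolding vertex_section_def
      proof (intro conjI ballI impI)
        have half: "sim x s y \<in> cut_halfspace {?v} \<longleftrightarrow> ?c \<bullet> y \<le> ?h - \<delta>" for y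
          using mo_halfspace[OF mo vP, of y] by (simp add: \<delta>_def)
        have hyper: "sim x s y \<in> cut_hyperplane {?v} \<longleftrightarrow> ?c \<bullet> y = ?h - \<delta>" for y
          using mo_hyperplane[OF mo vP, of y] by (simp add: \<delta>_def)
        show "cut_offset (carrier_face {?v}) < a (carrier_face {?v}) \<bullet> ?v"
          using half[of v] vd.above by (simp add: cut_halfspace_def)
        fix u assume u: "u \<in> vertices (sim x s ` S) - {?v}"
        then obtain y where y: "y \<in> vertices S" "u = sim x s y" "y \<noteq> v"
          using sim_vertices[OF s0, of x S] by auto
        show "a (carrier_face {?v}) \<bullet> u < cut_offset (carrier_face {?v})"
          using half[of y] hyper[of y] vd.below[OF y(1,3)] y(2)
          by (simp add: cut_halfspace_def cut_hyperplane_def)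
      next
        fix F' assume F': "F' \<in> proper_faces (sim x s ` S)" "?v \<in> F'" "F' \<noteq> {?v}"
        then obtain F where F: "F \<in> proper_faces S" "F' = sim x s ` F"
          using sim_proper_faces[OF s0, of x S] by auto
        have vF: "v \<in> F" "F \<noteq> {v}" "F face_of S"
          using F'(2,3) F sim_eq_iff[OF s0, of x] by (auto simp: proper_faces_iff)
        show "cut_hyperplane (F' \<inter> cut_hyperplane {?v}) = cut_hyperplane F'"
          unfolding F(2) sect(2)[OF vF(3,1)] by (rule cut(2)[OF vF(3,1,2)])
      qed
      show "Q (sim x s ` S) ?v = sim ?v (s * depth \<epsilon> k {v}) ` Y \<and>
        modelled Y \<alpha>' (\<lambda>_. 0) 0 ?v (s * depth \<epsilon> k {v}) \<and> vertex_section (sim x s ` S) ?v"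
        using QY mY vsec unfolding \<delta>_def by simp
    qed
  qed
  then show ?thesis using polY dimY supY neq by blast
qed

subsection \<open>Induction on the dimension\<close>

lemma faces_singleton: "faces {v} = {{v}}"
proof (intro equalityI subsetI)
  fix E assume "E \<in> faces {v}"
  then have "E \<subseteq> {v}" "E \<noteq> {}" by (auto simp: faces_iff dest: face_of_imp_subset)
  then show "E \<in> {{v}}" by blast
qed (simp add: faces_iff face_of_refl)

context swept_truncation
begin

text \<open>\<open>swept_rec\<close> is indexed by one less than the dimension, hence the form of
  the last conjunct. It is carried along since the step to the next dimension looks inside the
  blocks of the vertex sections.\<close>

definition resolved :: "nat \<Rightarrow> nat \<Rightarrow> 'a set \<Rightarrow> bool" where
  "resolved n r X \<longleftrightarrow> well_defined n r X \<and> partition_on (faces (T X)) (blocks n r X) \<and>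
     (\<forall>m. n = Suc m \<longrightarrow> swept_rec m r X)"

lemma stage_0:
  assumes "polytope X"
  shows "stage 0 X = X"
proof -
  have none: "{E \<in> proper_faces X. aff_dim E < int 0} = {}"
    using proper_face_aff_dim(1)[OF assms] by force
  show ?thesis unfolding stage_def none by simp
qed

text \<open>At stage 0 nothing has been cut, so genericity covers the vertices of the placed
  polytope. A placement only shifts and rescales the sweep values, so injectivity passes to the
  model, where it does not depend on \<epsilon>.\<close>

lemma generic_inj:
  assumes S: "polytope S" and s: "0 < s" and gen: "generic (Suc n) r (sim x s ` S)"
  shows "inj_on (\<lambda>y. p r \<bullet> y) (vertices S)"
proof -
  have s0: "s \<noteq> 0" using s by simp
  have "inj_on (\<lambda>y. p r \<bullet> y) (\<Union>k\<le>Suc n. vertices (stage k (sim x s ` S)))"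
    using gen by simp
  moreover have "vertices (sim x s ` S) \<subseteq> (\<Union>k\<le>Suc n. vertices (stage k (sim x s ` S)))"
    unfolding UN_iff subset_iff using stage_0[OF sim_polytope[OF s0 S], of x] by (intro allI impI bexI[of _ 0]) simp_all
  ultimately have inj: "inj_on (\<lambda>y. p r \<bullet> y) (sim x s ` vertices S)"
    unfolding sim_vertices[OF s0] by (rule inj_on_subset)
  show ?thesis
  proof (rule inj_onI)
    fix u v assume u: "u \<in> vertices S" and v: "v \<in> vertices S" and eq: "p r \<bullet> u = p r \<bullet> v"
    have "p r \<bullet> sim x s u = p r \<bullet> sim x s v" using eq by (simp add: inner_sim)
    then have "sim x s u = sim x s v" using inj_onD[OF inj] u v by blast
    then show "u = v" using sim_eq_iff[OF s0, of x] by simp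
  qed
qed

text \<open>A point has no proper faces, so no cut removes it.\<close>

lemma resolved_0:
  assumes mo: "modelled {y} \<alpha> \<gamma> k x s"
  shows "resolved 0 r (sim x s ` {y})"
proof -
  let ?v = "sim x s y"
  have no: "proper_faces {y} = {}" by (simp add: proper_faces_def faces_singleton)
  have "?v \<in> T (sim x s ` {y})" using mo_T[OF mo, of y] no by simp
  then have T: "T {?v} = {?v}" using T_subset[of "{?v}"] by auto
  have "blocks 0 r {?v} = {{{?v}}}" by (simp add: blocks_def)
  then show ?thesis
    using T by (simp add: resolved_def faces_singleton partition_on_def)
qed

lemma resolved_Suc:
  assumes st: "simple_truncation (Suc m) X" and ord: "ordered_near_vertices (p r) X"
    and inj: "inj_on (\<lambda>y. p r \<bullet> y) (vertices X)"
    and ver: "\<And>v. v \<in> vertices X \<Longrightarrow> simple_truncation m (Q X v) \<and> vertex_section X v \<and>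
      above_near_faces (p r) (p r \<bullet> v) (Q X v) \<and> above_near_faces (- p r) (- (p r \<bullet> v)) (Q X v)"
    and Qres: "\<And>v. v \<in> vertices X \<Longrightarrow> resolved m r (Q X v)"
    and Rres: "\<And>v. v \<in> vertices X \<Longrightarrow> R r X v \<noteq> {} \<Longrightarrow> resolved (m - 1) (Suc r) (R r X v)"
  shows "resolved (Suc m) r X"
proof -
  have sw: "swept m r X"
    unfolding swept_def using st ord inj ver by (intro conjI ballI) simp_all
  have swr: "swept_rec m r X"
  proof (cases m)
    case 0
    then show ?thesis using sw by simp
  next
    case (Suc m')
    then have "swept_rec m' r (Q X v)" if "v \<in> vertices X" for v
      using Qres[OF that] by (simp add: resolved_def)
    then show ?thesis using sw Suc by simp
  qed
  have Q: "well_defined m r (Q X v)" "partition_on (faces (T (Q X v))) (blocks m r (Q X v))"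
    if "v \<in> vertices X" for v
    using Qres[OF that] by (simp_all add: resolved_def)
  have R: "well_defined (m - 1) (Suc r) (R r X v)"
    "partition_on (faces (T (R r X v))) (blocks (m - 1) (Suc r) (R r X v))"
    if "v \<in> vertices X" "R r X v \<noteq> {}" for v
    using Rres[OF that] by (simp_all add: resolved_def)
  show ?thesis
    unfolding resolved_def
  proof (intro conjI allI impI)
    show "well_defined (Suc m) r X" by (rule swept_rec_partition(1)[OF swr Q R])
    show "partition_on (faces (T X)) (blocks (Suc m) r X)" by (rule swept_rec_partition(2)[OF swr Q R])
    show "swept_rec m' r X" if "Suc m = Suc m'" for m' using that swr by simp
  qed
qed

end

section \<open>Small \<epsilon> throughout the recursion\<close>

context
  fixes P :: "'a::euclidean_space set" and a :: "'a set \<Rightarrow> 'a" and b :: "'a set \<Rightarrow> real"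
    and p :: "nat \<Rightarrow> 'a"
begin

text \<open>The recursive conclusions are kept as implications from genericity, which may hold for
  some small \<epsilon> and fail for others.\<close>

definition vertex_ready :: "nat \<Rightarrow> nat \<Rightarrow> real \<Rightarrow> 'a set \<Rightarrow> 'a \<Rightarrow> bool" where
  "vertex_ready m r \<epsilon> X w \<longleftrightarrow>
     swept_truncation.simple_truncation P a b \<epsilon> m (swept_truncation.Q P a b \<epsilon> X w) \<and>
     swept_truncation.vertex_section P a b \<epsilon> X w \<and>
     swept_truncation.above_near_faces P a b \<epsilon> (p r) (p r \<bullet> w) (swept_truncation.Q P a b \<epsilon> X w) \<and>
     swept_truncation.above_near_faces P a b \<epsilon> (- p r) (- (p r \<bullet> w)) (swept_truncation.Q P a b \<epsilon> X w) \<and>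
     (swept_truncation.generic P a b \<epsilon> p m r (swept_truncation.Q P a b \<epsilon> X w) \<longrightarrow>
        swept_truncation.resolved P a b \<epsilon> p m r (swept_truncation.Q P a b \<epsilon> X w)) \<and>
     (swept_truncation.R P a b \<epsilon> p r X w \<noteq> {} \<longrightarrow>
        swept_truncation.generic P a b \<epsilon> p (m - 1) (Suc r) (swept_truncation.R P a b \<epsilon> p r X w) \<longrightarrow>
        swept_truncation.resolved P a b \<epsilon> p (m - 1) (Suc r) (swept_truncation.R P a b \<epsilon> p r X w))"

text \<open>The section at \<open>v\<close> is the fixed polytope \<open>Y\<close> at position
  \<open>x' \<epsilon>\<close> and scale \<open>s' \<epsilon>\<close>, so the induction hypothesis
  has to allow placements depending on \<epsilon>. As \<open>v\<close> is the origin of the model,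
  \<open>R r X v\<close> is modelled by the slice of \<open>Y\<close> by
  \<open>p r \<bullet> y = 0\<close>, again a fixed polytope.\<close>

lemma eventually_vertex_ready:
  fixes x :: "real \<Rightarrow> 'a" and s :: "real \<Rightarrow> real"
  assumes S: "polytope S" "aff_dim S = int (Suc m)" and sup: "supports S \<alpha> \<gamma>"
    and mo: "\<forall>\<^sub>F \<epsilon> in at_right 0. swept_truncation.modelled P a b \<epsilon> S \<alpha> \<gamma> k (x \<epsilon>) (s \<epsilon>)"
    and inj: "inj_on (\<lambda>y. p r \<bullet> y) (vertices S)" and v: "v \<in> vertices S"
    and IH: "\<And>n S \<alpha> \<gamma> k x s r. n < Suc m \<Longrightarrow> polytope S \<Longrightarrow> aff_dim S = int n \<Longrightarrow> supports S \<alpha> \<gamma> \<Longrightarrow>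
      \<forall>\<^sub>F \<epsilon> in at_right 0. swept_truncation.modelled P a b \<epsilon> S \<alpha> \<gamma> k (x \<epsilon>) (s \<epsilon>) \<Longrightarrow>
      \<forall>\<^sub>F \<epsilon> in at_right 0. swept_truncation.generic P a b \<epsilon> p n r (sim (x \<epsilon>) (s \<epsilon>) ` S) \<longrightarrow>
        swept_truncation.resolved P a b \<epsilon> p n r (sim (x \<epsilon>) (s \<epsilon>) ` S)"
  shows "\<forall>\<^sub>F \<epsilon> in at_right 0. vertex_ready m r \<epsilon> (sim (x \<epsilon>) (s \<epsilon>) ` S) (sim (x \<epsilon>) (s \<epsilon>) v)"
proof -
  obtain Y \<alpha>' where Y: "polytope Y" "aff_dim Y = int m" "supports Y \<alpha>' (\<lambda>_. 0)"
    and neY: "\<forall>q. inj_on (\<lambda>x. q \<bullet> x) (vertices S) \<longrightarrow> (\<forall>u\<in>vertices Y. q \<bullet> u \<noteq> 0)"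
    and evY: "\<forall>\<^sub>F \<epsilon> in at_right 0. \<forall>P a b x s. swept_truncation.modelled P a b \<epsilon> S \<alpha> \<gamma> k x s \<longrightarrow>
       swept_truncation.Q P a b \<epsilon> (sim x s ` S) (sim x s v) = sim (sim x s v) (s * depth \<epsilon> k {v}) ` Y \<and>
       swept_truncation.modelled P a b \<epsilon> Y \<alpha>' (\<lambda>_. 0) 0 (sim x s v) (s * depth \<epsilon> k {v}) \<and>
       swept_truncation.vertex_section P a b \<epsilon> (sim x s ` S) (sim x s v)"
    using vertex_model[OF S sup v, of k] by (elim exE conjE) (rule that)
  define x' where "x' = (\<lambda>\<epsilon>. sim (x \<epsilon>) (s \<epsilon>) v)"
  define s' where "s' = (\<lambda>\<epsilon>. s \<epsilon> * depth \<epsilon> k {v})"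
  let ?W = "Y \<inter> {y. p r \<bullet> y = 0}"
  have ev: "\<forall>\<^sub>F \<epsilon> in at_right 0.
      swept_truncation.Q P a b \<epsilon> (sim (x \<epsilon>) (s \<epsilon>) ` S) (x' \<epsilon>) = sim (x' \<epsilon>) (s' \<epsilon>) ` Y \<and>
      swept_truncation.modelled P a b \<epsilon> Y \<alpha>' (\<lambda>_. 0) 0 (x' \<epsilon>) (s' \<epsilon>) \<and>
      swept_truncation.vertex_section P a b \<epsilon> (sim (x \<epsilon>) (s \<epsilon>) ` S) (x' \<epsilon>)"
    using evY mo unfolding x'_def s'_def by eventually_elim blast
  have moY: "\<forall>\<^sub>F \<epsilon> in at_right 0. swept_truncation.modelled P a b \<epsilon> Y \<alpha>' (\<lambda>_. 0) 0 (x' \<epsilon>) (s' \<epsilon>)"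
    using ev by eventually_elim (elim conjE)
  have resQ: "\<forall>\<^sub>F \<epsilon> in at_right 0. swept_truncation.generic P a b \<epsilon> p m r (sim (x' \<epsilon>) (s' \<epsilon>) ` Y) \<longrightarrow>
        swept_truncation.resolved P a b \<epsilon> p m r (sim (x' \<epsilon>) (s' \<epsilon>) ` Y)"
    by (rule IH[OF lessI Y moY])
  have resR: "\<forall>\<^sub>F \<epsilon> in at_right 0. ?W \<noteq> {} \<longrightarrow>
      swept_truncation.generic P a b \<epsilon> p (m - 1) (Suc r) (sim (x' \<epsilon>) (s' \<epsilon>) ` ?W) \<longrightarrow>
      swept_truncation.resolved P a b \<epsilon> p (m - 1) (Suc r) (sim (x' \<epsilon>) (s' \<epsilon>) ` ?W)"
  proof (cases "?W = {}")
    case True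
    then show ?thesis by (intro always_eventually allI impI) simp
  next
    case False
    \<comment> \<open>Injectivity on the vertices of \<open>S\<close> keeps the vertices of
      \<open>Y\<close> off the hyperplane through the origin.\<close>
    have tr: "transversal_slice Y (p r) 0"
      using Y(1) neY inj by unfold_locales auto
    interpret ts: transversal_slice Y "p r" 0 by (rule tr)
    obtain \<alpha>'' \<gamma>'' where W: "supports ?W \<alpha>'' \<gamma>''"
      and evW: "\<forall>\<^sub>F \<epsilon> in at_right 0. \<forall>P a b x s. swept_truncation.modelled P a b \<epsilon> Y \<alpha>' (\<lambda>_. 0) 0 x s \<longrightarrow>
        swept_truncation.modelled P a b \<epsilon> ?W \<alpha>'' \<gamma>'' (Suc 0) x s"
      using slice_model[OF tr Y(3), of 0] by (elim exE conjE) (rule that)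
    have moW: "\<forall>\<^sub>F \<epsilon> in at_right 0. swept_truncation.modelled P a b \<epsilon> ?W \<alpha>'' \<gamma>'' (Suc 0) (x' \<epsilon>) (s' \<epsilon>)"
      using evW moY by eventually_elim blast
    have "Y face_of Y" using Y(1) by (simp add: face_of_refl polytope_imp_convex)
    then have "aff_dim ?W = int m - 1" using ts.slice_aff_dim[of Y] False Y(2) by simp
    \<comment> \<open>Nonemptiness excludes \<open>m = 0\<close>, so the subtraction in
      \<open>m - 1\<close> is exact.\<close>
    moreover have "0 \<le> aff_dim ?W" using False aff_dim_geq[of ?W] aff_dim_empty[of ?W] by linarith
    ultimately have dimW: "aff_dim ?W = int (m - 1)" by simp
    have "m - 1 < Suc m" by simp
    from IH[where r="Suc r", OF this ts.slice_polytope dimW W moW]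
    show ?thesis by (rule eventually_mono) simp
  qed
  have comb: "\<forall>\<^sub>F \<epsilon> in at_right 0. combinatorial \<epsilon> 0 Y \<alpha>' (\<lambda>_. 0)" by (rule eventually_combinatorial[OF Y])
  have os1: "\<forall>\<^sub>F \<epsilon> in at_right 0. one_sided \<epsilon> 0 Y \<alpha>' (\<lambda>_. 0) (p r)" by (rule eventually_one_sided[OF Y(1,3)])
  have os2: "\<forall>\<^sub>F \<epsilon> in at_right 0. one_sided \<epsilon> 0 Y \<alpha>' (\<lambda>_. 0) (- p r)" by (rule eventually_one_sided[OF Y(1,3)])
  show ?thesis
    using ev resQ resR comb os1 os2 eventually_at_right_less[of "0::real"]
  proof eventually_elim
    case (elim \<epsilon>)
    interpret tr: swept_truncation P a b \<epsilon> p .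
    let ?X = "sim (x \<epsilon>) (s \<epsilon>) ` S"
    have Q: "tr.Q ?X (x' \<epsilon>) = sim (x' \<epsilon>) (s' \<epsilon>) ` Y" and moY': "tr.modelled Y \<alpha>' (\<lambda>_. 0) 0 (x' \<epsilon>) (s' \<epsilon>)"
      and vsec: "tr.vertex_section ?X (x' \<epsilon>)"
      using elim(1) by simp_all
    have s': "0 < s' \<epsilon>" by (rule tr.mo_pos[OF moY'])
    have R: "tr.R r ?X (x' \<epsilon>) = sim (x' \<epsilon>) (s' \<epsilon>) ` ?W"
    proof -
      have "sim (x' \<epsilon>) (s' \<epsilon>) y \<in> tr.H r (x' \<epsilon>) \<longleftrightarrow> p r \<bullet> y = 0" for y
        using s' by (simp add: tr.H_def inner_sim)
      then show ?thesis unfolding tr.R_def Q by blast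
    qed
    have "vertex_ready m r \<epsilon> ?X (x' \<epsilon>)"
      unfolding vertex_ready_def R unfolding Q
    proof (intro conjI)
      show "tr.simple_truncation m (sim (x' \<epsilon>) (s' \<epsilon>) ` Y)"
        by (rule tr.modelled_simple_truncation[OF moY' Y(1,3) elim(7) Y(2) elim(4)])
      show "tr.vertex_section ?X (x' \<epsilon>)" by (rule vsec)
      show "tr.above_near_faces (p r) (p r \<bullet> x' \<epsilon>) (sim (x' \<epsilon>) (s' \<epsilon>) ` Y)"
        by (rule tr.modelled_above[OF moY' Y(1,3) elim(7,5)])
      show "tr.above_near_faces (- p r) (- (p r \<bullet> x' \<epsilon>)) (sim (x' \<epsilon>) (s' \<epsilon>) ` Y)"
        using tr.modelled_above[OF moY' Y(1,3) elim(7,6)] by simp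
      show "tr.generic m r (sim (x' \<epsilon>) (s' \<epsilon>) ` Y) \<longrightarrow> tr.resolved m r (sim (x' \<epsilon>) (s' \<epsilon>) ` Y)"
        by (rule elim(2))
      show "sim (x' \<epsilon>) (s' \<epsilon>) ` ?W \<noteq> {} \<longrightarrow> tr.generic (m - 1) (Suc r) (sim (x' \<epsilon>) (s' \<epsilon>) ` ?W) \<longrightarrow>
          tr.resolved (m - 1) (Suc r) (sim (x' \<epsilon>) (s' \<epsilon>) ` ?W)"
        using elim(3) by simp
    qed
    then show ?case by (simp add: x'_def)
  qed
qed

text \<open>Strong induction, because \<open>R r X v\<close> has dimension two less than
  \<open>X\<close>. If the sweep is not injective on the vertices of the model, genericity fails at
  every \<epsilon> for which the model applies; otherwise eventual statements for the finitely many
  vertices are combined.\<close>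

lemma eventually_resolved:
  fixes x :: "real \<Rightarrow> 'a" and s :: "real \<Rightarrow> real"
  assumes "polytope S" "aff_dim S = int n" "supports S \<alpha> \<gamma>"
    and "\<forall>\<^sub>F \<epsilon> in at_right 0. swept_truncation.modelled P a b \<epsilon> S \<alpha> \<gamma> k (x \<epsilon>) (s \<epsilon>)"
  shows "\<forall>\<^sub>F \<epsilon> in at_right 0. swept_truncation.generic P a b \<epsilon> p n r (sim (x \<epsilon>) (s \<epsilon>) ` S) \<longrightarrow>
    swept_truncation.resolved P a b \<epsilon> p n r (sim (x \<epsilon>) (s \<epsilon>) ` S)"
  using assms
proof (induction n arbitrary: S \<alpha> \<gamma> k x s r rule: less_induct)
  case (less n)
  note S = less.prems(1,2) and sup = less.prems(3) and mo = less.prems(4)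
  show ?case
  proof (cases n)
    case 0
    then obtain y where y: "S = {y}" using S(2) aff_dim_eq_0[of S] by auto
    show ?thesis
      using mo
    proof eventually_elim
      case (elim \<epsilon>)
      interpret tr: swept_truncation P a b \<epsilon> p .
      show ?case using tr.resolved_0[OF elim[unfolded y]] unfolding 0 y by blast
    qed
  next
    case (Suc m)
    have dim: "aff_dim S = int (Suc m)" using S(2) Suc by simp
    show ?thesis
    proof (cases "inj_on (\<lambda>y. p r \<bullet> y) (vertices S)")
      case False
      show ?thesis
        using mo
      proof eventually_elim
        case (elim \<epsilon>)
        interpret tr: swept_truncation P a b \<epsilon> p .
        show ?case
          using tr.generic_inj[OF S(1) tr.mo_pos[OF elim], of m r] False unfolding Suc by blast
      qed
    next
      case True
      have IH: "\<forall>\<^sub>F \<epsilon> in at_right 0. swept_truncation.generic P a b \<epsilon> p n' r (sim (x \<epsilon>) (s \<epsilon>) ` S) \<longrightarrow>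
          swept_truncation.resolved P a b \<epsilon> p n' r (sim (x \<epsilon>) (s \<epsilon>) ` S)"
        if "n' < Suc m" "polytope S" "aff_dim S = int n'" "supports S \<alpha> \<gamma>"
          "\<forall>\<^sub>F \<epsilon> in at_right 0. swept_truncation.modelled P a b \<epsilon> S \<alpha> \<gamma> k (x \<epsilon>) (s \<epsilon>)" for n' S \<alpha> \<gamma> k x s r
        using less.IH[of n' S \<alpha> \<gamma> k x s r] that Suc by simp
      have "\<forall>\<^sub>F \<epsilon> in at_right 0. \<forall>v\<in>vertices S.
          vertex_ready m r \<epsilon> (sim (x \<epsilon>) (s \<epsilon>) ` S) (sim (x \<epsilon>) (s \<epsilon>) v)"
      proof (intro eventually_ball_finite finite_vertices S(1) ballI)
        fix v assume v: "v \<in> vertices S"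
        show "\<forall>\<^sub>F \<epsilon> in at_right 0. vertex_ready m r \<epsilon> (sim (x \<epsilon>) (s \<epsilon>) ` S) (sim (x \<epsilon>) (s \<epsilon>) v)"
          by (rule eventually_vertex_ready[OF S(1) dim sup mo True v IH])
      qed
      moreover have "\<forall>\<^sub>F \<epsilon> in at_right 0. combinatorial \<epsilon> k S \<alpha> \<gamma>"
        by (rule eventually_combinatorial[OF S(1) dim sup])
      moreover have "\<forall>\<^sub>F \<epsilon> in at_right 0. separated \<epsilon> k S \<alpha> \<gamma> (p r)"
        by (rule eventually_separated[OF S(1) sup]) (simp add: dim)
      ultimately show ?thesis
        using mo eventually_at_right_less[of "0::real"]
      proof eventually_elim
        case (elim \<epsilon>)
        interpret tr: swept_truncation P a b \<epsilon> p .
        let ?X = "sim (x \<epsilon>) (s \<epsilon>) ` S"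
        have s: "0 < s \<epsilon>" by (rule tr.mo_pos[OF elim(4)])
        then have s0: "s \<epsilon> \<noteq> 0" by simp
        have ready: "vertex_ready m r \<epsilon> ?X w" if "w \<in> vertices ?X" for w
          using elim(1) that unfolding sim_vertices[where x="x \<epsilon>", OF s0] by blast
        show ?case
        proof
          assume gen: "tr.generic n r ?X"
          have genQ: "tr.generic m r (tr.Q ?X w)" "tr.R r ?X w \<noteq> {} \<Longrightarrow> tr.generic (m - 1) (Suc r) (tr.R r ?X w)"
            if "w \<in> vertices ?X" for w
            using gen that unfolding Suc by simp_all
          show "tr.resolved n r ?X"
            unfolding Suc
          proof (rule tr.resolved_Suc)
            show "tr.simple_truncation (Suc m) ?X"
              by (rule tr.modelled_simple_truncation[OF elim(4) S(1) sup elim(5) dim elim(2)])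
            show "tr.ordered_near_vertices (p r) ?X"
              by (rule tr.modelled_ordered[OF elim(4) S(1) sup elim(5) _ elim(3)]) (simp add: dim)
            show "inj_on (\<lambda>y. p r \<bullet> y) (vertices ?X)"
            proof (rule inj_onI)
              fix u w assume uw: "u \<in> vertices ?X" "w \<in> vertices ?X" "p r \<bullet> u = p r \<bullet> w"
              then obtain u' w' where u': "u' \<in> vertices S" "u = sim (x \<epsilon>) (s \<epsilon>) u'"
                and w': "w' \<in> vertices S" "w = sim (x \<epsilon>) (s \<epsilon>) w'"
                unfolding sim_vertices[where x="x \<epsilon>", OF s0] by blast
              then have "p r \<bullet> u' = p r \<bullet> w'" using uw(3) s0 by (simp add: inner_sim)
              then show "u = w" using inj_onD[OF True _ u'(1) w'(1)] u'(2) w'(2) by simp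
            qed
          next
            fix w assume w: "w \<in> vertices ?X"
            show "tr.simple_truncation m (tr.Q ?X w) \<and> tr.vertex_section ?X w \<and>
                tr.above_near_faces (p r) (p r \<bullet> w) (tr.Q ?X w) \<and>
                tr.above_near_faces (- p r) (- (p r \<bullet> w)) (tr.Q ?X w)"
              using ready[OF w] unfolding vertex_ready_def by simp
            show "tr.resolved m r (tr.Q ?X w)"
              using ready[OF w] genQ(1)[OF w] unfolding vertex_ready_def by simp
            show "tr.resolved (m - 1) (Suc r) (tr.R r ?X w)" if "tr.R r ?X w \<noteq> {}"
              using ready[OF w] genQ(2)[OF w that] that unfolding vertex_ready_def by simp
          qed
        qed
      qed
    qed
  qed
qed

end

section \<open>The polytope \<open>P\<close> as its own model\<close>

lemma sim_id: "sim 0 1 y = y"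
  by (simp add: sim_def)

context swept_truncation
begin

text \<open>A face of \<open>P\<close> is its own carrier, and every proper face has dimension below
  that of \<open>P\<close>, so the final stage contains all cuts.\<close>

lemma modelled_self:
  assumes P: "polytope P"
  shows "modelled P a b 0 0 1"
proof -
  have carrier: "carrier_face E = E" if "E \<in> proper_faces P" for E
  proof
    show "carrier_face E \<subseteq> E" using that by (auto simp: carrier_face_def proper_faces_iff)
    show "E \<subseteq> carrier_face E" by (auto simp: carrier_face_def)
  qed
  have half: "y \<in> cut_halfspace E \<longleftrightarrow> a E \<bullet> y \<le> b E - depth \<epsilon> 0 E" if "E \<in> proper_faces P" for E y
    using carrier[OF that] by (simp add: cut_halfspace_def cut_offset_def depth_def)
  have hyper: "y \<in> cut_hyperplane E \<longleftrightarrow> a E \<bullet> y = b E - depth \<epsilon> 0 E" if "E \<in> proper_faces P" for E y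
    using carrier[OF that] by (simp add: cut_hyperplane_def cut_offset_def depth_def)
  have all: "{E \<in> proper_faces P. aff_dim E < int (nat (aff_dim P))} = proper_faces P"
    using proper_face_aff_dim[OF P] by fastforce
  have stage: "y \<in> stage (nat (aff_dim P)) P \<longleftrightarrow> (\<forall>E\<in>proper_faces P. a E \<bullet> y \<le> b E - depth \<epsilon> 0 E)"
    if "y \<in> P" for y
    using that half unfolding stage_def all by auto
  show ?thesis
    unfolding modelled_def sim_id image_ident using half hyper stage by simp
qed

end

theorem theorem1:
  fixes P :: "'a::euclidean_space set" and d :: nat
    and a :: "'a set \<Rightarrow> 'a" and b :: "'a set \<Rightarrow> real"
    and p :: "nat \<Rightarrow> 'a"
  assumes "polytope P" and "aff_dim P = int d"
    and "supporting_hyperplanes P a b"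
  shows "\<forall>\<^sub>F \<epsilon> in at_right 0.
           swept_truncation.generic P a b \<epsilon> p d 0 P \<longrightarrow>
             swept_truncation.well_defined P a b \<epsilon> p d 0 P \<and>
             partition_on (faces (swept_truncation.T P a b \<epsilon> P))
               (swept_truncation.blocks P a b \<epsilon> p d 0 P)"
proof -
  have sup: "supports P a b"
    using assms(3) by (simp add: supporting_hyperplanes_def supports_def)
  have "\<forall>\<^sub>F \<epsilon> in at_right 0. swept_truncation.modelled P a b \<epsilon> P a b 0 0 1"
    by (intro always_eventually allI swept_truncation.modelled_self assms(1))
  from eventually_resolved[where x="\<lambda>_. 0" and s="\<lambda>_. 1", OF assms(1,2) sup this, of p 0]
  have "\<forall>\<^sub>F \<epsilon> in at_right 0. swept_truncation.generic P a b \<epsilon> p d 0 P \<longrightarrow>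
      swept_truncation.resolved P a b \<epsilon> p d 0 P"
    by (simp add: sim_id)
  then show ?thesis
    by eventually_elim (simp add: swept_truncation.resolved_def)
qed

end
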